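(* Let $n\in\mathbb{N}$ and let $\rho:\mathbb{R}^n\setminus\{0\}\to[0,\infty)$ be a radial kernel with $\rho\in L^1_{\mathrm{loc}}(\mathbb{R}^n)$, $\int_{\mathbb{R}^n}\min\{1,|x|^{-1}\}\rho(x)\,dx<\infty$ and $\inf_{\overline{B(0,\varepsilon)}}\rho>0$ for some $\varepsilon>0$. Assume that $K_\rho(x)\ge0$ for $x\neq0$. Then for every Schwartz function $u\in\mathcal{S}(\mathbb{R}^n)$ and $x\in\mathbb{R}^n$, $$\mathcal{L}_\rho u(x):=\int_{\mathbb{R}^n}\bigl(u(x)-u(x+h)\bigr)K_\rho(h)\,dh=-\Delta_\rho u(x),$$ where the integral is understood in the principal value sense $\lim_{r\to0^+}\int_{|h|>r}$.
   Context: Fourier transform convention: $\widehat f(\xi)=\int_{\mathbb{R}^n}f(x)e^{-2\pi i x\cdot\xi}\,dx$, extended to tempered distributions. $\overline\rho$ is the radial representation of $\rho$, $\rho(x)=\overline\rho(|x|)$. For $u\in \mathcal{S}(\mathbb{R}^n)$ the nonlocal gradient is $D_\rho u(x)=\int_{\mathbb{R}^n}\frac{u(x)-u(y)}{|x-y|}\frac{x-y}{|x-y|}\rho(x-y)\,dy$, for a vector field $v$ the nonlocal divergence is $\operatorname{div}_\rho v(x)=\int_{\mathbb{R}^n}\frac{v(x)-v(y)}{|x-y|}\cdot\frac{x-y}{|x-y|}\rho(x-y)\,dy$ (absolutely convergent for smooth functions/fields bounded together with their first derivatives), and $\Delta_\rho u:=\operatorname{div}_\rho(D_\rho u)$. $Q_\rho(x):=\int_{|x|}^\infty\frac{\overline\rho(t)}{t}\,dt$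 ($x\ne0$) is a locally integrable tempered distribution; its Fourier transform is the function $\widehat{Q_\rho}(\xi)=\frac{1}{2\pi|\xi|}\int_{\mathbb{R}^n}\frac{\rho(x)x_1}{|x|^2}\sin(2\pi|\xi|x_1)\,dx$, $\xi\ne0$, and $\lambda_\rho(\xi):=2\pi i\,\xi\,\widehat{Q_\rho}(\xi)$. $K_\rho$ is the tempered distribution $K_\rho=\sum_{j}\partial_jQ_\rho*\partial_jQ_\rho$, equivalently the one with $\widehat{K_\rho}(\xi)=-|\lambda_\rho(\xi)|^2$. The assumption "$K_\rho(x)\ge0$ for $x\ne0$" means that the restriction of $K_\rho$ to $\mathbb{R}^n\setminus\{0\}$ is given by a nonnegative function in $L^1_{\mathrm{loc}}(\mathbb{R}^n\setminus\{0\})$, again denoted $K_\rho$ and used in the integral. *)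

theory Defs
  imports "HOL-Analysis.Analysis"
begin

section \<open>Schwartz functions and test functions\<close>

definition partial_deriv :: "'n \<Rightarrow> (real ^ 'n \<Rightarrow> complex) \<Rightarrow> real ^ 'n \<Rightarrow> complex" where
  "partial_deriv j f x = frechet_derivative f (at x) (axis j 1)"

definition iter_partial :: "'n list \<Rightarrow> (real ^ 'n \<Rightarrow> complex) \<Rightarrow> real ^ 'n \<Rightarrow> complex" where
  "iter_partial js f = foldr partial_deriv js f"

text \<open>Every iterated partial derivative is Frechet differentiable everywhere, in particular
  continuous; this is the same as being of class \<open>C\<^sup>k\<close> for every \<open>k\<close>.\<close>

definition smooth_fun :: "(real ^ 'n \<Rightarrow> complex) \<Rightarrow> bool" where
  "smooth_fun f \<longleftrightarrow> (\<forall>js x. iter_partial js f differentiable (at x))"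

definition schwartz :: "(real ^ 'n \<Rightarrow> complex) \<Rightarrow> bool" where
  "schwartz f \<longleftrightarrow> smooth_fun f \<and>
     (\<forall>js (k::nat). bounded (range (\<lambda>x. norm x ^ k *\<^sub>R iter_partial js f x)))"

definition test_fun_off_zero :: "(real ^ 'n \<Rightarrow> complex) \<Rightarrow> bool" where
  "test_fun_off_zero \<phi> \<longleftrightarrow> smooth_fun \<phi> \<and>
     compact (closure {x. \<phi> x \<noteq> 0}) \<and> 0 \<notin> closure {x. \<phi> x \<noteq> 0}"


section \<open>Fourier transform and distributions\<close>

definition fourier :: "(real ^ 'n \<Rightarrow> complex) \<Rightarrow> real ^ 'n \<Rightarrow> complex" where
  "fourier f \<xi> = (LINT x|lebesgue. f x * exp (- (2 * pi * (x \<bullet> \<xi>)) *\<^sub>R \<i>))"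

definition inverse_fourier :: "(real ^ 'n \<Rightarrow> complex) \<Rightarrow> real ^ 'n \<Rightarrow> complex" where
  "inverse_fourier f x = (LINT \<xi>|lebesgue. f \<xi> * exp ((2 * pi * (x \<bullet> \<xi>)) *\<^sub>R \<i>))"

text \<open>A tempered distribution is treated as the functional it induces; only its values at
  Schwartz functions are meaningful. The Fourier transform and its inverse act by duality.\<close>

type_synonym 'n distribution = "(real ^ 'n \<Rightarrow> complex) \<Rightarrow> complex"

definition regular_dist :: "(real ^ 'n \<Rightarrow> complex) \<Rightarrow> ('n::finite) distribution" where
  "regular_dist f \<phi> = (LINT x|lebesgue. f x * \<phi> x)"

definition fourier_dist :: "('n::finite) distribution \<Rightarrow> ('n::finite) distribution" where
  "fourier_dist T \<phi> = T (fourier \<phi>)"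

definition inverse_fourier_dist :: "('n::finite) distribution \<Rightarrow> ('n::finite) distribution" where
  "inverse_fourier_dist T \<phi> = T (inverse_fourier \<phi>)"

text \<open>The restriction of \<open>T\<close> to the complement of the origin is given by the function \<open>f\<close>,
  which is locally integrable there (and possibly not near the origin).\<close>

definition given_off_zero_by :: "('n::finite) distribution \<Rightarrow> (real ^ 'n \<Rightarrow> complex) \<Rightarrow> bool" where
  "given_off_zero_by T f \<longleftrightarrow>
     (\<forall>S. compact S \<and> 0 \<notin> S \<longrightarrow> set_integrable lebesgue S f) \<and>
     (\<forall>\<phi>. test_fun_off_zero \<phi> \<longrightarrow> T \<phi> = regular_dist f \<phi>)"


section \<open>Nonlocal operators\<close>

text \<open>A kernel on the punctured space is a total function whose value at the origin never
  matters. Since \<open>u\<close> is complex valued, \<open>D\<^sub>\<rho> u\<close> takes values in \<open>complex ^ 'n\<close>, and the dot product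
  in the divergence is the bilinear one.\<close>

definition nonlocal_grad ::
    "(real ^ 'n \<Rightarrow> real) \<Rightarrow> (real ^ 'n \<Rightarrow> complex) \<Rightarrow> real ^ 'n \<Rightarrow> complex ^ 'n" where
  "nonlocal_grad \<rho> u x =
     (LINT y|lebesgue. (\<chi> j. (u x - u y) / of_real (norm (x - y))
        * of_real ((x - y) $ j / norm (x - y)) * of_real (\<rho> (x - y))))"

definition nonlocal_div ::
    "(real ^ 'n \<Rightarrow> real) \<Rightarrow> (real ^ 'n \<Rightarrow> complex ^ 'n) \<Rightarrow> real ^ 'n \<Rightarrow> complex" where
  "nonlocal_div \<rho> v x =
     (LINT y|lebesgue. (\<Sum>j\<in>UNIV. (v x $ j - v y $ j) / of_real (norm (x - y))
        * of_real ((x - y) $ j / norm (x - y))) * of_real (\<rho> (x - y)))"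

definition nonlocal_laplacian ::
    "(real ^ 'n \<Rightarrow> real) \<Rightarrow> (real ^ 'n \<Rightarrow> complex) \<Rightarrow> real ^ 'n \<Rightarrow> complex" where
  "nonlocal_laplacian \<rho> u = nonlocal_div \<rho> (nonlocal_grad \<rho> u)"


section \<open>The distributions associated with a radial kernel\<close>

definition radial :: "(real ^ 'n \<Rightarrow> real) \<Rightarrow> bool" where
  "radial \<rho> \<longleftrightarrow> (\<forall>x y. x \<noteq> 0 \<and> y \<noteq> 0 \<and> norm x = norm y \<longrightarrow> \<rho> x = \<rho> y)"

definition radial_rep :: "(real ^ 'n \<Rightarrow> real) \<Rightarrow> real \<Rightarrow> real" where
  "radial_rep \<rho> t = (THE c. \<forall>x. norm x = t \<longrightarrow> \<rho> x = c)"

definition Q_kernel :: "(real ^ 'n \<Rightarrow> real) \<Rightarrow> real ^ 'n \<Rightarrow> real" where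
  "Q_kernel \<rho> x = (LINT t:{norm x<..}|lebesgue. radial_rep \<rho> t / t)"

text \<open>The Fourier transform of \<open>Q\<^sub>\<rho>\<close> is a function off the origin; continuity selects its
  representative, which is then unique at every \<open>\<xi> \<noteq> 0\<close>. Local integrability at the
  origin is not demanded: it can fail in dimension one, where only
  \<open>\<xi>\<close> times the function is needed.\<close>

definition Q_hat :: "(real ^ 'n \<Rightarrow> real) \<Rightarrow> real ^ 'n \<Rightarrow> complex" where
  "Q_hat \<rho> = (SOME q. continuous_on (- {0}) q \<and>
     given_off_zero_by (fourier_dist (regular_dist (\<lambda>x. of_real (Q_kernel \<rho> x)))) q)"

definition lambda_symbol :: "(real ^ 'n \<Rightarrow> real) \<Rightarrow> real ^ 'n \<Rightarrow> complex ^ 'n" where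
  "lambda_symbol \<rho> \<xi> = (\<chi> j. 2 * of_real pi * \<i> * of_real (\<xi> $ j) * Q_hat \<rho> \<xi>)"

text \<open>The tempered distribution with Fourier transform \<open>- |\<lambda>\<^sub>\<rho>|\<^sup>2\<close>; the value of
  \<open>\<lambda>\<^sub>\<rho>\<close> at the origin is immaterial.\<close>

definition K_dist :: "(real ^ 'n \<Rightarrow> real) \<Rightarrow> ('n::finite) distribution" where
  "K_dist \<rho> =
     inverse_fourier_dist (regular_dist (\<lambda>\<xi>. - of_real ((norm (lambda_symbol \<rho> \<xi>))\<^sup>2)))"

end

theory Submission
  imports Defs "HOL-Probability.Distributions"
begin

text \<open>Let \<open>s(\<xi>)\<close> be the vector with components \<open>\<integral> z\<^sub>j \<rho>(z) / |z|\<^sup>2 sin(2\<pi> z\<bullet>\<xi>) dz\<close>. Writing \<open>Q\<^sub>\<rho>\<close> as a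
  superposition of indicators of balls and integrating by parts on each ball gives
  \<open>\<lambda>\<^sub>\<rho> = \<i> s\<close>, while Fourier inversion of \<open>u\<close> shows that both nonlocal operators act as
  multiplication by \<open>\<i> s\<close>; hence \<open>-\<Delta>\<^sub>\<rho> u\<close> has Fourier transform \<open>\<psi> u^\<close> with
  \<open>\<psi> = |s|\<^sup>2\<close>, and \<open>K\<^sub>\<rho>\<close> has Fourier transform \<open>-\<psi>\<close>.

  It remains to prove the Levy-Khintchine formula for \<open>\<psi>\<close> and the Levy measure \<open>K\<^sub>\<rho> dh\<close>. The mollification
  \<open>K\<^sub>d\<close> of \<open>K\<^sub>\<rho>\<close> at scale \<open>d\<close> is a bounded even function which is nonnegative outside the ball of radius \<open>d\<close>.
  Testing it with wide Gaussians and using Fatou's lemma, it is integrable, and its integral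
  is \<open>-\<psi>(0) = 0\<close>. Therefore \<open>\<integral> K\<^sub>d(h) (u(x) - u(x+h)) dh\<close> tends to \<open>-\<Delta>\<^sub>\<rho> u(x)\<close> as \<open>d\<close> tends
  to \<open>0\<close>. On the ball of radius \<open>2d\<close> the symmetrised integrand contributes nothing in the limit, because
  \<open>\<psi>(\<xi>) = o(|\<xi>|\<^sup>2)\<close>. Away from it, Fatou's lemma with a Gaussian \<open>u\<close> yields
  \<open>\<integral> min(1, |h|\<^sup>2) K\<^sub>\<rho>(h) dh < \<infinity>\<close>, and then dominated convergence replaces \<open>K\<^sub>d\<close> by \<open>K\<^sub>\<rho>\<close>. The odd part of
  the integrand vanishes on every region \<open>|h| > r\<close>, since every \<open>K\<^sub>d\<close> is even.\<close>


section \<open>Integration on Euclidean space\<close>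

text \<open>The obstacle is the origin. \<open>K_dist \<rho>\<close> is known to be a function only
  away from \<open>0\<close>, and test functions off \<open>0\<close> do not see a point mass or
  derivatives of a point mass sitting there. Two properties of the symbol replace this missing
  information: its value 0 at the origin fixes the total mass of every mollification, and its growth
  o(|\<xi>|^2) rules out a second order term at the origin, that is, a Gaussian part. The growth
  bound holds because the sine is bounded: d sin(2 pi z.\<eta> / d) tends to 0 with d at every fixed
  z, with a majorant independent of d.

  The kernel has no regularity, so neither \<open>\<rho>\<close> nor the potential can be
  differentiated. Derivatives fall only on smooth functions over balls, and the profile of the
  kernel enters afterwards, as a weight on the radii of these balls.

  \<open>Q_hat\<close> is an arbitrary choice among functions with a certain property. Hence a
  function with this property has to be exhibited first, and the chosen one is then identified from
  the property alone.\<close>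

lemma measure_eqI_atMost:
  fixes M N :: "real measure"
  assumes sets: "sets M = sets borel" "sets N = sets borel"
  assumes fin: "\<And>x. emeasure M {..x} < \<infinity>"
  assumes eq: "\<And>x. emeasure M {..x} = emeasure N {..x}"
  shows "M = N"
proof (rule measure_eqI_generator_eq_countable)
  let ?E = "range (\<lambda>a::real. {..a})"
  show "Int_stable ?E" by (auto simp: Int_stable_def)
  show "?E \<subseteq> Pow UNIV" "sets M = sigma_sets UNIV ?E" "sets N = sigma_sets UNIV ?E"
    unfolding sets borel_eq_atMost by auto
  show "range (\<lambda>n. {..real n}) \<subseteq> ?E" "(\<Union>(range (\<lambda>n. {..real n}))) = UNIV"
    using real_arch_simple by auto
  show "countable (range (\<lambda>n. {..real n}))" by simp
  show "emeasure M a \<noteq> \<infinity>" if "a \<in> range (\<lambda>n. {..real n})" for a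
    using that fin by (auto simp: less_top)
  show "emeasure M X = emeasure N X" if "X \<in> ?E" for X using that eq by auto
qed

section \<open>Affine changes of variables and product majorants\<close>

lemma lborel_integral_affine:
  fixes f :: "'a::euclidean_space \<Rightarrow> 'b::{banach, second_countable_topology}"
  assumes [measurable]: "f \<in> borel_measurable borel" and c: "c \<noteq> 0"
  shows "(LINT x|lborel. f x) = \<bar>c\<bar>^DIM('a) *\<^sub>R (LINT x|lborel. f (t + c *\<^sub>R x))"
  by (subst lborel_affine[OF c, of t]) (simp add: integral_density integral_distr)

lemma lborel_integrable_affine:
  fixes f :: "'a::euclidean_space \<Rightarrow> 'b::{banach, second_countable_topology}"
  assumes [measurable]: "f \<in> borel_measurable borel" and c: "c \<noteq> 0"
  shows "integrable lborel (\<lambda>x. f (t + c *\<^sub>R x)) \<longleftrightarrow> integrable lborel f"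
proof -
  have "integrable lborel f \<longleftrightarrow> integrable (density (distr lborel borel (\<lambda>x. t + c *\<^sub>R x)) (\<lambda>_. \<bar>c\<bar>^DIM('a))) f"
    using lborel_affine[OF c, of t] by simp
  also have "\<dots> \<longleftrightarrow> integrable lborel (\<lambda>x. \<bar>c\<bar>^DIM('a) *\<^sub>R f (t + c *\<^sub>R x))"
    by (simp add: integrable_density integrable_distr_eq)
  also have "\<dots> \<longleftrightarrow> integrable lborel (\<lambda>x. f (t + c *\<^sub>R x))"
  proof
    assume "integrable lborel (\<lambda>x. \<bar>c\<bar>^DIM('a) *\<^sub>R f (t + c *\<^sub>R x))"
    then have "integrable lborel (\<lambda>x. inverse (\<bar>c\<bar>^DIM('a)) *\<^sub>R (\<bar>c\<bar>^DIM('a) *\<^sub>R f (t + c *\<^sub>R x)))"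
      by (rule integrable_scaleR_right)
    then show "integrable lborel (\<lambda>x. f (t + c *\<^sub>R x))" using c by simp
  qed auto
  finally show ?thesis by simp
qed

lemma lborel_integral_translate:
  fixes f :: "'a::euclidean_space \<Rightarrow> 'b::{banach, second_countable_topology}"
  assumes "f \<in> borel_measurable borel"
  shows "(LINT x|lborel. f (t + x)) = (LINT x|lborel. f x)"
    "(LINT x|lborel. f (x + t)) = (LINT x|lborel. f x)"
  using lborel_integral_affine[OF assms, of 1 t] by (simp_all add: add.commute)

lemma lborel_integrable_translate:
  fixes f :: "'a::euclidean_space \<Rightarrow> 'b::{banach, second_countable_topology}"
  assumes "f \<in> borel_measurable borel"
  shows "integrable lborel (\<lambda>x. f (t + x)) \<longleftrightarrow> integrable lborel f"
    "integrable lborel (\<lambda>x. f (x + t)) \<longleftrightarrow> integrable lborel f"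
  using lborel_integrable_affine[OF assms, of 1 t] by (simp_all add: add.commute)

lemma lborel_integral_minus:
  fixes f :: "'a::euclidean_space \<Rightarrow> 'b::{banach, second_countable_topology}"
  assumes "f \<in> borel_measurable borel"
  shows "(LINT x|lborel. f (t - x)) = (LINT x|lborel. f x)"
    "(LINT x|lborel. f (- x)) = (LINT x|lborel. f x)"
  using lborel_integral_affine[OF assms, of "-1" t] lborel_integral_affine[OF assms, of "-1" 0] by simp_all

lemma lborel_integrable_minus:
  fixes f :: "'a::euclidean_space \<Rightarrow> 'b::{banach, second_countable_topology}"
  assumes "f \<in> borel_measurable borel"
  shows "integrable lborel (\<lambda>x. f (t - x)) \<longleftrightarrow> integrable lborel f"
    "integrable lborel (\<lambda>x. f (- x)) \<longleftrightarrow> integrable lborel f"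
  using lborel_integrable_affine[OF assms, of "-1" t] lborel_integrable_affine[OF assms, of "-1" 0] by simp_all

lemma integrable_real_bound:
  fixes f :: "'a \<Rightarrow> 'b::{banach, second_countable_topology}" and g :: "'a \<Rightarrow> real"
  assumes "integrable M g" "f \<in> borel_measurable M" "\<And>x. norm (f x) \<le> g x"
  shows "integrable M f"
  by (rule Bochner_Integration.integrable_bound[OF assms(1,2)]) (use assms(3) in \<open>auto intro: order_trans[OF _ abs_ge_self]\<close>)

text \<open>In most uses of Fubini below a function of one variable meets a character or a sine in
  the product of both variables, and the majorant splits into one weight per variable.\<close>

lemma integrable_pair_bound:
  fixes f :: "'a::euclidean_space \<times> 'c::euclidean_space \<Rightarrow> 'b::{banach, second_countable_topology}"
    and g :: "'a \<Rightarrow> real" and h :: "'c \<Rightarrow> real"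
  assumes f[measurable]: "f \<in> borel_measurable (lborel \<Otimes>\<^sub>M lborel)"
    and g: "integrable lborel g" and h: "integrable lborel h"
    and le: "\<And>x y. norm (f (x, y)) \<le> g x * h y"
  shows "integrable (lborel \<Otimes>\<^sub>M lborel) f"
proof (rule lborel_pair.Fubini_integrable[OF f])
  have *: "integrable lborel (\<lambda>y. f (x, y))" for x
    by (rule integrable_real_bound[where g="\<lambda>y. g x * h y"]) (use h le in auto)
  then show "AE x in lborel. integrable lborel (\<lambda>y. f (x, y))" by simp
  show "integrable lborel (\<lambda>x. LINT y|lborel. norm (f (x, y)))"
  proof (rule integrable_real_bound[where g="\<lambda>x. g x * (LINT y|lborel. h y)"])
    fix x
    have "(LINT y|lborel. norm (f (x, y))) \<le> (LINT y|lborel. g x * h y)"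
      using * h le by (intro integral_mono) auto
    then show "norm (LINT y|lborel. norm (f (x, y))) \<le> g x * (LINT y|lborel. h y)" by simp
  qed (use g in auto)
qed

section \<open>Derivatives along a line and their integrals\<close>

lemma has_vector_derivative_line:
  fixes f :: "'a::real_normed_vector \<Rightarrow> 'b::real_normed_vector"
  assumes "\<And>x. ((\<lambda>\<tau>. f (x + \<tau> *\<^sub>R v)) has_vector_derivative Df x) (at 0)"
  shows "((\<lambda>\<tau>. f (x + \<tau> *\<^sub>R v)) has_vector_derivative Df (x + \<sigma> *\<^sub>R v)) (at \<sigma>)"
proof -
  have "((\<lambda>s. s - \<sigma>) has_vector_derivative 1) (at \<sigma>)"
    by (auto intro!: derivative_eq_intros)
  moreover have "((\<lambda>\<tau>. f ((x + \<sigma> *\<^sub>R v) + \<tau> *\<^sub>R v)) has_vector_derivative Df (x + \<sigma> *\<^sub>R v)) (at (\<sigma> - \<sigma>))"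
    using assms[of "x + \<sigma> *\<^sub>R v"] by simp
  ultimately have "((\<lambda>\<tau>. f ((x + \<sigma> *\<^sub>R v) + \<tau> *\<^sub>R v)) \<circ> (\<lambda>s. s - \<sigma>) has_vector_derivative 1 *\<^sub>R Df (x + \<sigma> *\<^sub>R v)) (at \<sigma>)"
    by (rule vector_diff_chain_at)
  then show ?thesis by (simp add: o_def algebra_simps)
qed

lemma norm_diff_le_line:
  fixes f :: "'a::real_normed_vector \<Rightarrow> 'b::real_normed_vector"
  assumes d: "\<And>x. ((\<lambda>\<tau>. f (x + \<tau> *\<^sub>R v)) has_vector_derivative Df x) (at 0)"
    and B: "\<And>\<sigma>. \<sigma> \<in> {0..\<tau>} \<Longrightarrow> norm (Df (x + \<sigma> *\<^sub>R v)) \<le> B" and t: "0 \<le> \<tau>"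
  shows "norm (f (x + \<tau> *\<^sub>R v) - f x) \<le> B * \<tau>"
proof -
  have "norm (f (x + \<tau> *\<^sub>R v) - f (x + 0 *\<^sub>R v)) \<le> B * norm (\<tau> - 0)"
  proof (rule differentiable_bound[where S="{0..\<tau>}" and f'="\<lambda>\<sigma> h. h *\<^sub>R Df (x + \<sigma> *\<^sub>R v)"])
    fix \<sigma> assume s: "\<sigma> \<in> {0..\<tau>}"
    show "((\<lambda>\<tau>. f (x + \<tau> *\<^sub>R v)) has_derivative (\<lambda>h. h *\<^sub>R Df (x + \<sigma> *\<^sub>R v))) (at \<sigma> within {0..\<tau>})"
      using has_vector_derivative_line[of f v Df, OF d, of x \<sigma>]
      by (auto simp: has_vector_derivative_def intro: has_derivative_at_withinI)
    show "onorm (\<lambda>h. h *\<^sub>R Df (x + \<sigma> *\<^sub>R v)) \<le> B"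
      by (rule onorm_le) (use B[OF s] in \<open>simp add: mult.commute[of B] mult_left_mono\<close>)
  qed (use t in auto)
  then show ?thesis using t by simp
qed

lemma has_vector_derivative_at_0_iff:
  "(g has_vector_derivative D) (at 0) \<longleftrightarrow> ((\<lambda>\<tau>. (g \<tau> - g 0) /\<^sub>R \<tau>) \<longlongrightarrow> D) (at 0)"
proof -
  have "(g has_vector_derivative D) (at 0) \<longleftrightarrow> ((\<lambda>\<tau>. norm (g \<tau> - g 0 - \<tau> *\<^sub>R D) / norm \<tau>) \<longlongrightarrow> 0) (at 0)"
    by (simp add: has_vector_derivative_def has_derivative_at bounded_linear_scaleR_left)
  also have "\<dots> \<longleftrightarrow> ((\<lambda>\<tau>. norm ((g \<tau> - g 0) /\<^sub>R \<tau> - D)) \<longlongrightarrow> 0) (at 0)"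
  proof (rule tendsto_cong)
    have "norm (g \<tau> - g 0 - \<tau> *\<^sub>R D) / norm \<tau> = norm ((g \<tau> - g 0) /\<^sub>R \<tau> - D)" if "\<tau> \<noteq> 0" for \<tau>
    proof -
      have "(g \<tau> - g 0) /\<^sub>R \<tau> - D = (g \<tau> - g 0 - \<tau> *\<^sub>R D) /\<^sub>R \<tau>"
        using that by (simp add: scaleR_diff_right)
      then show ?thesis by (simp add: divide_inverse mult.commute)
    qed
    then show "\<forall>\<^sub>F \<tau> in at 0. norm (g \<tau> - g 0 - \<tau> *\<^sub>R D) / norm \<tau> = norm ((g \<tau> - g 0) /\<^sub>R \<tau> - D)"
      by (auto simp: eventually_at_filter)
  qed
  also have "\<dots> \<longleftrightarrow> ((\<lambda>\<tau>. (g \<tau> - g 0) /\<^sub>R \<tau>) \<longlongrightarrow> D) (at 0)"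
    by (metis Lim_null tendsto_norm_zero_iff)
  finally show ?thesis .
qed

text \<open>The integral of a difference quotient vanishes by translation invariance.\<close>

lemma integral_directional_derivative:
  fixes f D :: "'a::euclidean_space \<Rightarrow> complex" and g :: "'a \<Rightarrow> real"
  assumes f: "integrable lborel f" and D[measurable]: "D \<in> borel_measurable borel"
    and d: "AE x in lborel. ((\<lambda>\<tau>. f (x + \<tau> *\<^sub>R v)) has_vector_derivative D x) (at 0)"
    and g: "integrable lborel g"
    and le: "\<And>x \<tau>. 0 < \<tau> \<Longrightarrow> \<tau> \<le> 1 \<Longrightarrow> norm (f (x + \<tau> *\<^sub>R v) - f x) \<le> \<tau> * g x"
  shows "integrable lborel D" "(LINT x|lborel. D x) = 0"
proof -
  define q where "q = (\<lambda>m::nat. \<lambda>x. (f (x + (1 / real (Suc m)) *\<^sub>R v) - f x) /\<^sub>R (1 / real (Suc m)))"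
  have [measurable]: "f \<in> borel_measurable borel" using f by auto
  have lim: "AE x in lborel. (\<lambda>m. q m x) \<longlonglongrightarrow> D x"
    using d
  proof eventually_elim
    case (elim x)
    have "filterlim (\<lambda>m. 1 / real (Suc m)) (at 0) sequentially"
      by (auto simp: filterlim_at intro!: LIMSEQ_Suc[OF lim_1_over_n] simp del: of_nat_Suc)
    from filterlim_compose[OF _ this, of "\<lambda>\<tau>. (f (x + \<tau> *\<^sub>R v) - f x) /\<^sub>R \<tau>" "nhds (D x)"]
    show ?case using elim
      by (simp add: q_def has_vector_derivative_at_0_iff)
  qed
  have bd: "norm (q m x) \<le> g x" for m x
    using le[of "1 / real (Suc m)" x] unfolding q_def by (simp add: divide_simps mult.commute del: of_nat_Suc)
  have qm: "q m \<in> borel_measurable lborel" for m unfolding q_def by simp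
  have "integrable lborel D \<and> (\<lambda>m. LINT x|lborel. q m x) \<longlonglongrightarrow> (LINT x|lborel. D x)"
    using integrable_dominated_convergence[of D lborel q g] integral_dominated_convergence[of D lborel q g] qm g lim bd by auto
  moreover have "(LINT x|lborel. q m x) = 0" for m
  proof -
    have "integrable lborel (\<lambda>x. f (x + (1 / real (Suc m)) *\<^sub>R v))"
      using f by (subst lborel_integrable_translate(2)) auto
    then have "(LINT x|lborel. f (x + (1 / real (Suc m)) *\<^sub>R v) - f x) = 0"
      using f by (simp add: lborel_integral_translate(2))
    then show ?thesis unfolding q_def by simp
  qed
  ultimately show "integrable lborel D" "(LINT x|lborel. D x) = 0"
    using LIMSEQ_unique[OF _ tendsto_const] by auto
qed

section \<open>Polar coordinates for radial functions\<close>

definition radial_density :: "nat \<Rightarrow> real \<Rightarrow> real" where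
  "radial_density n t = (if 0 \<le> t then real n * unit_ball_vol (real n) * t ^ (n - 1) else 0)"

lemma radial_density_nonneg [simp]: "0 \<le> radial_density n t"
  by (simp add: radial_density_def)

lemma radial_density_measurable [measurable]: "radial_density n \<in> borel_measurable borel"
  unfolding radial_density_def by measurable

text \<open>Both measures give a half-line the volume of the ball of that radius, because
  \<open>radial_density\<close> is the derivative of the ball volume, the area of the sphere. In
  dimension one the power is \<open>t ^ 0\<close> and the density is the constant 2.\<close>

lemma distr_norm_lborel:
  "distr lborel borel (norm :: 'a::euclidean_space \<Rightarrow> real) = density lborel (\<lambda>t. ennreal (radial_density DIM('a) t))"
proof (rule measure_eqI_atMost)
  let ?n = "DIM('a)"
  fix t :: real
  have pre: "norm -` {..t} = cball (0::'a) t" by auto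
  have L: "emeasure (distr lborel borel (norm :: 'a \<Rightarrow> real)) {..t} = emeasure lborel (cball (0::'a) t)"
    using pre by (simp add: emeasure_distr)
  then show "emeasure (distr lborel borel (norm :: 'a \<Rightarrow> real)) {..t} < \<infinity>"
    using emeasure_lborel_cball_finite by simp
  show "emeasure (distr lborel borel (norm :: 'a \<Rightarrow> real)) {..t} = emeasure (density lborel (\<lambda>t. ennreal (radial_density ?n t))) {..t}"
  proof (cases "0 \<le> t")
    case True
    have "emeasure (density lborel (\<lambda>t. ennreal (radial_density ?n t))) {..t}
        = (\<integral>\<^sup>+s. ennreal (real ?n * unit_ball_vol ?n * s ^ (?n - 1)) * indicator {0..t} s \<partial>lborel)"
      by (subst emeasure_density) (auto simp: radial_density_def intro!: nn_integral_cong split: split_indicator)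
    also have "\<dots> = ennreal (unit_ball_vol ?n * t ^ ?n - unit_ball_vol ?n * 0 ^ ?n)"
      using True by (intro nn_integral_FTC_Icc) (auto intro!: derivative_eq_intros)
    also have "\<dots> = emeasure lborel (cball (0::'a) t)"
      using True by (simp add: emeasure_cball)
    finally show ?thesis using L by simp
  next
    case False
    then have "(\<lambda>s. ennreal (radial_density ?n s) * indicator {..t} s) = (\<lambda>s. 0)"
      by (auto simp: radial_density_def split: split_indicator)
    then have "emeasure (density lborel (\<lambda>t. ennreal (radial_density ?n t))) {..t} = 0"
      by (subst emeasure_density) simp_all
    then show ?thesis using False L by simp
  qed
qed auto

lemma integral_norm_lborel:
  fixes f :: "real \<Rightarrow> 'b::{banach, second_countable_topology}"
  assumes [measurable]: "f \<in> borel_measurable borel"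
  shows "(LINT x|(lborel::'a::euclidean_space measure). f (norm x)) = (LINT t|lborel. radial_density DIM('a) t *\<^sub>R f t)"
    and "integrable (lborel::'a measure) (\<lambda>x. f (norm x)) \<longleftrightarrow> integrable lborel (\<lambda>t. radial_density DIM('a) t *\<^sub>R f t)"
  using distr_norm_lborel[where 'a='a]
  by (simp_all add: integral_density integrable_density flip: integral_distr[of norm lborel borel f] integrable_distr_eq[of norm lborel borel f])

text \<open>In polar coordinates the integrand is at most a constant times
  \<open>1 / (1 + t)^2\<close>. This is the common majorant for Schwartz functions, Gaussians and
  their transforms.\<close>

lemma integrable_inverse_power:
  "integrable lborel (\<lambda>x::'a::euclidean_space. 1 / (1 + norm x) ^ (DIM('a) + 1))"
proof -
  let ?n = "DIM('a)"
  have fin: "integrable lborel (\<lambda>t::real. indicator {0..} t * (1 / (1 + t)^2))"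
  proof (rule integrableI_nn_integral_finite)
    have "(\<integral>\<^sup>+ t. ennreal (1 / (1 + t)^2) * indicator {0..} t \<partial>lborel) = ennreal (0 - (- 1 / (1 + 0::real)))"
    proof (rule nn_integral_FTC_atLeast)
      show "((\<lambda>t::real. - 1 / (1 + t)) has_real_derivative 1 / (1 + t)^2) (at t)" if "0 \<le> t" for t
        using that by (auto intro!: derivative_eq_intros simp: power2_eq_square)
      show "((\<lambda>t::real. - 1 / (1 + t)) \<longlongrightarrow> 0) at_top" by real_asymp
    qed auto
    also have "(\<integral>\<^sup>+ t. ennreal (1 / (1 + t)^2) * indicator {0..} t \<partial>lborel)
        = (\<integral>\<^sup>+ t. ennreal (indicator {0..} t * (1 / (1 + t)^2)) \<partial>lborel)"
      by (intro nn_integral_cong) (auto split: split_indicator)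
    finally show "(\<integral>\<^sup>+ t. ennreal (indicator {0..} t * (1 / (1 + t)^2)) \<partial>lborel) = ennreal 1" by simp
  qed auto
  have "integrable lborel (\<lambda>t. radial_density ?n t *\<^sub>R (1 / (1 + t) ^ (?n + 1)))"
  proof (rule integrable_real_bound[OF integrable_mult_right[OF fin, of "real ?n * unit_ball_vol ?n"]])
    fix t :: real
    show "norm (radial_density ?n t *\<^sub>R (1 / (1 + t) ^ (?n + 1)))
        \<le> real ?n * unit_ball_vol ?n * (indicator {0..} t * (1 / (1 + t)^2))"
    proof (cases "0 \<le> t")
      case True
      have "t ^ (?n - 1) / (1 + t) ^ (?n + 1) \<le> (1 + t) ^ (?n - 1) / (1 + t) ^ (?n + 1)"
        using True by (intro divide_right_mono power_mono) auto
      also have "?n + 1 = (?n - 1) + 2" by simp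
      also have "(1 + t) ^ (?n - 1) / (1 + t) ^ (?n - 1 + 2) = 1 / (1 + t)^2"
        using True by (simp only: power_add) simp
      finally have "real ?n * unit_ball_vol ?n * (t ^ (?n - 1) / (1 + t) ^ (?n + 1)) \<le> real ?n * unit_ball_vol ?n * (1 / (1 + t)^2)"
        by (intro mult_left_mono) auto
      then show ?thesis using True by (simp add: radial_density_def abs_mult)
    qed (simp add: radial_density_def)
  qed auto
  then show ?thesis by (subst integral_norm_lborel) auto
qed


section \<open>Integration by parts on balls\<close>

lemma AE_norm_neq: "AE x in (lborel :: 'a::euclidean_space measure). norm x \<noteq> t"
proof -
  have "sphere (0::'a) t \<in> null_sets lborel"
    using negligible_sphere[of "0::'a" t] by (auto simp: negligible_iff_null_sets null_sets_completion_iff)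
  then show ?thesis by (rule AE_I') auto
qed

text \<open>The divergence theorem on balls, already integrated over the radius, so that no surface
  measure occurs. The directional derivative of \<open>\<eta> x *\<^sub>R f x\<close> has integral
  zero for the tent function \<open>\<eta>\<close>. Differentiating the tent produces -(x.v)/|x| on
  the ball of radius t, and the tent itself is the integral of the indicators of the balls of radius
  s over s in [0,t].\<close>

lemma integral_ball_directional_derivative:
  fixes f Df :: "'a::euclidean_space \<Rightarrow> complex"
  assumes d: "\<And>x. ((\<lambda>\<tau>. f (x + \<tau> *\<^sub>R v)) has_vector_derivative Df x) (at 0)"
    and [measurable]: "f \<in> borel_measurable borel" "Df \<in> borel_measurable borel"
    and bf: "\<And>x. norm (f x) \<le> C" and bd: "\<And>x. norm (Df x) \<le> C" and t: "0 < t"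
  shows "(LINT x|lborel. indicator {..t} (norm x) *\<^sub>R ((x \<bullet> v / norm x) *\<^sub>R f x))
    = (LINT s|lborel. indicator {0..t} s *\<^sub>R (LINT x|lborel. indicator {..s} (norm x) *\<^sub>R Df x))"
proof -
  define \<eta> where "\<eta> = (\<lambda>x::'a. max 0 (t - norm x))"
  define F where "F x = \<eta> x *\<^sub>R f x" for x
  define D where "D x = \<eta> x *\<^sub>R Df x - indicator {..t} (norm x) *\<^sub>R ((x \<bullet> v / norm x) *\<^sub>R f x)" for x
  have C: "0 \<le> C" using bf[of 0] norm_ge_zero order_trans by blast
  have [measurable]: "\<eta> \<in> borel_measurable borel" unfolding \<eta>_def by simp
  have \<eta>: "0 \<le> \<eta> x" "\<eta> x \<le> t" for x using t by (auto simp: \<eta>_def)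
  have cb: "integrable lborel (\<lambda>x. c * indicator (cball (0::'a) r) x :: real)" for c r
    by (intro integrable_mult_right integrable_real_indicator) (auto simp: emeasure_lborel_cball_finite[unfolded infinity_ennreal_def])
  have Fint: "integrable lborel F"
  proof (rule integrable_real_bound[OF cb[of "t * C" t]])
    show "norm (F x) \<le> t * C * indicator (cball 0 t) x" for x
    proof (cases "norm x \<le> t")
      case True
      have "\<eta> x * norm (f x) \<le> t * C" using \<eta> bf C t by (intro mult_mono) auto
      then show ?thesis using True \<eta>(1)[of x] by (simp add: F_def)
    qed (simp add: F_def \<eta>_def)
  qed (unfold F_def, measurable)
  have Dint1: "integrable lborel (\<lambda>x. \<eta> x *\<^sub>R Df x)"
  proof (rule integrable_real_bound[OF cb[of "t * C" t]])
    show "norm (\<eta> x *\<^sub>R Df x) \<le> t * C * indicator (cball 0 t) x" for x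
    proof (cases "norm x \<le> t")
      case True
      have "\<eta> x * norm (Df x) \<le> t * C" using \<eta> bd C t by (intro mult_mono) auto
      then show ?thesis using True \<eta>(1)[of x] by simp
    qed (simp add: \<eta>_def)
  qed measurable
  have Dmeas: "D \<in> borel_measurable borel" unfolding D_def by measurable
  \<comment> \<open>The tent has kinks only at the origin and on the sphere of radius t, which are
    null sets.\<close>
  have AEd: "AE x in lborel. ((\<lambda>\<tau>. F (x + \<tau> *\<^sub>R v)) has_vector_derivative D x) (at 0)"
    using AE_norm_neq[of t] AE_lborel_singleton[of 0]
  proof eventually_elim
    case (elim x)
    have cont: "continuous_on UNIV (\<lambda>\<tau>. norm (x + \<tau> *\<^sub>R v))" by (intro continuous_intros)
    show ?case
    proof (cases "norm x < t")
      case True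
      have n: "((\<lambda>\<tau>. t - norm (x + \<tau> *\<^sub>R v)) has_vector_derivative - (x \<bullet> v / norm x)) (at 0)"
      proof -
        have "((\<lambda>\<tau>. x + \<tau> *\<^sub>R v) has_derivative (\<lambda>\<tau>. \<tau> *\<^sub>R v)) (at 0)"
          by (auto intro!: derivative_eq_intros)
        moreover have "(norm has_derivative (\<lambda>h. inner h (sgn x))) (at (x + 0 *\<^sub>R v))"
          using GDERIV_norm[OF elim(2)] by (simp add: gderiv_def)
        ultimately have "((\<lambda>\<tau>. norm (x + \<tau> *\<^sub>R v)) has_derivative (\<lambda>\<tau>. inner (\<tau> *\<^sub>R v) (sgn x))) (at 0)"
          by (rule has_derivative_compose)
        then have "((\<lambda>\<tau>. norm (x + \<tau> *\<^sub>R v)) has_vector_derivative x \<bullet> v / norm x) (at 0)"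
          by (simp add: has_vector_derivative_def sgn_div_norm inner_commute divide_inverse ac_simps)
        then show ?thesis by (auto intro!: derivative_eq_intros)
      qed
      have "((\<lambda>\<tau>. (t - norm (x + \<tau> *\<^sub>R v)) *\<^sub>R f (x + \<tau> *\<^sub>R v)) has_vector_derivative
          (t - norm (x + 0 *\<^sub>R v)) *\<^sub>R Df x + (- (x \<bullet> v / norm x)) *\<^sub>R f (x + 0 *\<^sub>R v)) (at 0)"
        by (rule has_vector_derivative_scaleR[OF n[folded has_real_derivative_iff_has_vector_derivative] d])
      then have "((\<lambda>\<tau>. (t - norm (x + \<tau> *\<^sub>R v)) *\<^sub>R f (x + \<tau> *\<^sub>R v)) has_vector_derivative D x) (at 0)"
        using True by (simp add: D_def \<eta>_def algebra_simps)
      moreover have "open {\<tau>. norm (x + \<tau> *\<^sub>R v) < t}" by (intro open_Collect_less cont continuous_on_const)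
      ultimately show ?thesis
        by (rule has_vector_derivative_transform_within_open) (use True in \<open>auto simp: F_def \<eta>_def\<close>)
    next
      case False
      then have "t < norm x" using elim by simp
      then have "D x = 0" by (simp add: D_def \<eta>_def)
      then have "((\<lambda>\<tau>. 0) has_vector_derivative D x) (at 0)" by simp
      moreover have "open {\<tau>. t < norm (x + \<tau> *\<^sub>R v)}" by (intro open_Collect_less cont continuous_on_const)
      ultimately show ?thesis
        by (rule has_vector_derivative_transform_within_open) (use \<open>t < norm x\<close> in \<open>auto simp: F_def \<eta>_def\<close>)
    qed
  qed
  \<comment> \<open>Since \<open>\<tau> \<le> 1\<close>, both values of F vanish when x lies outside
    the ball of radius t + |v|. Inside, the two terms of the constant come from the slope 1 of the
    tent and from its maximum t.\<close>
  have lip: "norm (F (x + \<tau> *\<^sub>R v) - F x) \<le> \<tau> * ((norm v * C + t * C) * indicator (cball 0 (t + norm v)) x)"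
    if "0 < \<tau>" "\<tau> \<le> 1" for x \<tau>
  proof -
    have tv: "norm (\<tau> *\<^sub>R v) \<le> norm v" using that by (simp add: mult_left_le_one_le)
    have tri: "norm x - norm (\<tau> *\<^sub>R v) \<le> norm (x + \<tau> *\<^sub>R v)" "norm (x + \<tau> *\<^sub>R v) \<le> norm x + norm (\<tau> *\<^sub>R v)"
      using norm_diff_ineq[of x "\<tau> *\<^sub>R v"] norm_triangle_ineq[of x "\<tau> *\<^sub>R v"] by auto
    show ?thesis
    proof (cases "norm x \<le> t + norm v")
      case True
      have e: "\<bar>\<eta> (x + \<tau> *\<^sub>R v) - \<eta> x\<bar> \<le> \<tau> * norm v"
        using tri that unfolding \<eta>_def by (auto simp: max_def abs_if)
      have b: "norm (f (x + \<tau> *\<^sub>R v) - f x) \<le> C * \<tau>"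
        by (rule norm_diff_le_line[OF d bd]) (use that in auto)
      have "F (x + \<tau> *\<^sub>R v) - F x = (\<eta> (x + \<tau> *\<^sub>R v) - \<eta> x) *\<^sub>R f (x + \<tau> *\<^sub>R v) + \<eta> x *\<^sub>R (f (x + \<tau> *\<^sub>R v) - f x)"
        by (simp add: F_def algebra_simps)
      also have "norm \<dots> \<le> \<bar>\<eta> (x + \<tau> *\<^sub>R v) - \<eta> x\<bar> * norm (f (x + \<tau> *\<^sub>R v)) + \<eta> x * norm (f (x + \<tau> *\<^sub>R v) - f x)"
        using norm_triangle_ineq \<eta>(1)[of x] by (metis abs_of_nonneg norm_scaleR)
      also have "\<dots> \<le> (\<tau> * norm v) * C + t * (C * \<tau>)"
        using e b \<eta> bf C that t by (intro add_mono mult_mono) auto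
      finally show ?thesis using True by (simp add: algebra_simps)
    next
      case False
      then have "F (x + \<tau> *\<^sub>R v) = 0" "F x = 0" using tri tv t norm_ge_zero[of v] by (auto simp: F_def \<eta>_def)
      then show ?thesis using False by simp
    qed
  qed
  note zero = integral_directional_derivative[OF Fint Dmeas AEd cb lip]
  have "integrable lborel (\<lambda>x. \<eta> x *\<^sub>R Df x - D x)" using Dint1 zero(1) by (rule Bochner_Integration.integrable_diff)
  have "(LINT x|lborel. indicator {..t} (norm x) *\<^sub>R ((x \<bullet> v / norm x) *\<^sub>R f x)) = (LINT x|lborel. \<eta> x *\<^sub>R Df x - D x)"
    by (simp add: D_def)
  also have "\<dots> = (LINT x|lborel. \<eta> x *\<^sub>R Df x)" using Dint1 zero by simp
  also have "\<dots> = (LINT x|lborel. LINT s|lborel. indicator {0..t} s *\<^sub>R (indicator {..s} (norm x) *\<^sub>R Df x))"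
  proof (rule Bochner_Integration.integral_cong[OF refl])
    fix x
    have "(LINT s|lborel. indicator {0..t} s *\<^sub>R (indicator {..s} (norm x) *\<^sub>R Df x))
        = (LINT s|lborel. indicator {norm x..t} s *\<^sub>R Df x)"
    proof (rule Bochner_Integration.integral_cong[OF refl])
      fix s show "indicator {0..t} s *\<^sub>R (indicator {..s} (norm x) *\<^sub>R Df x) = indicator {norm x..t} s *\<^sub>R Df x"
        using norm_ge_zero[of x] by (auto split: split_indicator simp del: norm_ge_zero)
    qed
    also have "\<dots> = \<eta> x *\<^sub>R Df x" by (simp add: \<eta>_def max_def)
    finally show "\<eta> x *\<^sub>R Df x = (LINT s|lborel. indicator {0..t} s *\<^sub>R (indicator {..s} (norm x) *\<^sub>R Df x))" ..
  qed
  also have "\<dots> = (LINT s|lborel. LINT x|lborel. indicator {0..t} s *\<^sub>R (indicator {..s} (norm x) *\<^sub>R Df x))"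
  proof (rule lborel_pair.Fubini_integral[symmetric])
    show "integrable (lborel \<Otimes>\<^sub>M lborel) (\<lambda>(x, s). indicator {0..t} s *\<^sub>R (indicator {..s} (norm x) *\<^sub>R Df x))"
    proof (rule integrable_pair_bound[where h="indicator {0..t}" and g="\<lambda>x. C * indicator (cball 0 t) x"])
      show "(\<lambda>(x, s). indicator {0..t} s *\<^sub>R (indicator {..s} (norm x) *\<^sub>R Df x)) \<in> borel_measurable (lborel \<Otimes>\<^sub>M lborel)"
        unfolding indicator_def atMost_iff by measurable
      show "integrable lborel (indicator {0..t} :: real \<Rightarrow> real)" using t by (intro integrable_real_indicator) auto
      show "integrable lborel (\<lambda>x::'a. C * indicator (cball 0 t) x :: real)" by (rule cb)
      show "norm (case (x, s) of (x, s) \<Rightarrow> indicator {0..t} s *\<^sub>R (indicator {..s} (norm x) *\<^sub>R Df x))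
          \<le> C * indicator (cball 0 t) x * indicator {0..t} s" for s x
        using bd[of x] C by (auto split: split_indicator)
    qed
  qed
  also have "\<dots> = (LINT s|lborel. indicator {0..t} s *\<^sub>R (LINT x|lborel. indicator {..s} (norm x) *\<^sub>R Df x))"
    by (intro Bochner_Integration.integral_cong refl) (auto split: split_indicator)
  finally show ?thesis .
qed

text \<open>Equality on balls determines a density transfer: both sides become genuine measures on the
  line after adding a radial majorant, and these agree on the half-lines.\<close>

lemma radial_weight_transfer:
  fixes h :: "'a::euclidean_space \<Rightarrow> real" and A a :: "real \<Rightarrow> real"
  assumes [measurable]: "h \<in> borel_measurable borel" "A \<in> borel_measurable borel" "a \<in> borel_measurable borel"
    and bh: "\<And>x. \<bar>h x\<bar> \<le> C * min 1 (norm x)"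
    and bA: "\<And>t. 0 < t \<Longrightarrow> \<bar>A t\<bar> \<le> C * min 1 t * radial_density DIM('a) t"
    and eq: "\<And>t. 0 < t \<Longrightarrow> (LINT x|lborel. indicator {..t} (norm x) * h x) = (LINT s|lborel. indicator {0..t} s * A s)"
    and a: "\<And>t. 0 \<le> a t" and int: "integrable lborel (\<lambda>x::'a. a (norm x) * min 1 (norm x))"
  shows "integrable lborel (\<lambda>x. a (norm x) * h x)"
    and "integrable lborel (\<lambda>t. indicator {0<..} t * (a t * A t))"
    and "(LINT x|lborel. a (norm x) * h x) = (LINT t|lborel. indicator {0<..} t * (a t * A t))"
proof -
  let ?r = "radial_density DIM('a)"
  define w where "w t = C * min 1 t" for t :: real
  have [measurable]: "w \<in> borel_measurable borel" unfolding w_def by simp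
  obtain e :: 'a where e: "norm e = 1" using vector_choose_size[of 1] by auto
  have C: "0 \<le> C" using order_trans[OF abs_ge_zero bh[of e]] e by simp
  have w0: "0 \<le> w (norm x)" for x :: 'a using C by (simp add: w_def)
  have hw: "0 \<le> h x + w (norm x)" for x using bh[of x] by (auto simp: w_def)
  have Aw: "0 \<le> indicator {0<..} t * (A t + w t * ?r t)" for t
    using bA[of t] by (auto simp: w_def split: split_indicator)
  have cb: "integrable lborel (\<lambda>x. c * indicator (cball (0::'a) r) x :: real)" for c r
    by (intro integrable_mult_right integrable_real_indicator) (auto simp: emeasure_lborel_cball_finite[unfolded infinity_ennreal_def])
  have fin_h: "integrable lborel (\<lambda>x. indicator {..t} (norm x) * h x)" for t
    by (rule integrable_real_bound[OF cb[of C t]])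
      (use bh C in \<open>auto split: split_indicator intro!: order_trans[OF bh] mult_left_le\<close>)
  have fin_w: "integrable lborel (\<lambda>x::'a. indicator {..t} (norm x) * w (norm x))" for t
    by (rule integrable_real_bound[OF cb[of C t]])
      (use C in \<open>auto simp: w_def abs_mult split: split_indicator intro!: mult_left_le\<close>)
  have fin_wr: "integrable lborel (\<lambda>s. ?r s * (indicator {..t} s * w s))"
    and int_wr: "(LINT x|(lborel::'a measure). indicator {..t} (norm x) * w (norm x)) = (LINT s|lborel. ?r s * (indicator {..t} s * w s))" for t
    using fin_w[of t] integral_norm_lborel[where 'a='a, of "\<lambda>s. indicator {..t} s * w s"] by auto
  have rw0: "?r s * w s = 0" if "s \<le> 0" for s
    using that by (cases "s = 0") (auto simp: radial_density_def w_def)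
  have fin_A: "integrable lborel (\<lambda>s. indicator {0<..t} s * A s)" for t
  proof (rule integrable_real_bound[OF fin_wr[of t]])
    show "norm (indicator {0<..t} s * A s) \<le> ?r s * (indicator {..t} s * w s)" for s
      using bA[of s] rw0[of s] by (cases "0 < s") (auto simp: w_def mult.commute split: split_indicator)
  qed measurable
  define M1 where "M1 = distr (density (lborel::'a measure) (\<lambda>x. ennreal (h x + w (norm x)))) borel norm"
  define M2 where "M2 = density lborel (\<lambda>t. ennreal (indicator {0<..} t * (A t + w t * ?r t)))"
  have E1: "emeasure M1 {..t} = ennreal ((LINT x|lborel. indicator {..t} (norm x) * h x) + (LINT s|lborel. ?r s * (indicator {..t} s * w s)))" for t
  proof -
    have "norm -` {..t} = cball (0::'a) t" by auto
    then have [measurable]: "norm -` {..t} \<in> sets (borel :: 'a measure)" by simp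
    have "emeasure M1 {..t} = (\<integral>\<^sup>+x. ennreal (h x + w (norm x)) * indicator (norm -` {..t}) x \<partial>lborel)"
      unfolding M1_def by (subst emeasure_distr) (auto simp: emeasure_density)
    also have "\<dots> = (\<integral>\<^sup>+x. ennreal (indicator {..t} (norm x) * h x + indicator {..t} (norm x) * w (norm x)) \<partial>lborel)"
      by (intro nn_integral_cong) (auto split: split_indicator)
    also have "\<dots> = ennreal (LINT x|lborel. indicator {..t} (norm x) * h x + indicator {..t} (norm x) * w (norm x))"
      by (intro nn_integral_eq_integral Bochner_Integration.integrable_add fin_h fin_w)
        (use hw in \<open>auto split: split_indicator\<close>)
    also have "(LINT x|lborel. indicator {..t} (norm x) * h x + indicator {..t} (norm x) * w (norm x))
        = (LINT x|lborel. indicator {..t} (norm x) * h x) + (LINT s|lborel. ?r s * (indicator {..t} s * w s))"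
      using fin_h fin_w by (simp add: int_wr)
    finally show ?thesis .
  qed
  have E2: "emeasure M2 {..t} = ennreal ((LINT s|lborel. indicator {0<..t} s * A s) + (LINT s|lborel. ?r s * (indicator {..t} s * w s)))" for t
  proof -
    have "emeasure M2 {..t} = (\<integral>\<^sup>+s. ennreal (indicator {0<..} s * (A s + w s * ?r s)) * indicator {..t} s \<partial>lborel)"
      unfolding M2_def by (simp add: emeasure_density)
    also have "\<dots> = (\<integral>\<^sup>+s. ennreal (indicator {0<..t} s * A s + ?r s * (indicator {..t} s * w s)) \<partial>lborel)"
    proof (intro nn_integral_cong)
      fix s
      show "ennreal (indicator {0<..} s * (A s + w s * ?r s)) * indicator {..t} s
          = ennreal (indicator {0<..t} s * A s + ?r s * (indicator {..t} s * w s))"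
        using rw0[of s] by (auto split: split_indicator simp: mult.commute)
    qed
    also have "\<dots> = ennreal (LINT s|lborel. indicator {0<..t} s * A s + ?r s * (indicator {..t} s * w s))"
    proof (intro nn_integral_eq_integral Bochner_Integration.integrable_add fin_A fin_wr AE_I2)
      fix s
      show "0 \<le> indicator {0<..t} s * A s + ?r s * (indicator {..t} s * w s)"
        using Aw[of s] rw0[of s] by (auto split: split_indicator_asm split_indicator simp: mult.commute)
    qed
    finally show ?thesis using fin_A fin_wr by simp
  qed
  have ae0: "AE s in lborel. (s::real) \<noteq> 0" by (rule AE_lborel_singleton)
  have eq': "(LINT x|lborel. indicator {..t} (norm x) * h x) = (LINT s|lborel. indicator {0<..t} s * A s)" for t
  proof (cases "0 < t")
    case True
    have "(LINT s|lborel. indicator {0..t} s * A s) = (LINT s|lborel. indicator {0<..t} s * A s)"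
      by (intro integral_cong_AE) (use ae0 in \<open>auto elim!: eventually_mono split: split_indicator\<close>)
    then show ?thesis using eq[OF True] by simp
  next
    case False
    have "(LINT x|lborel. indicator {..t} (norm x) * h x) = (LINT x|lborel. 0 * h x)"
    proof (intro integral_cong_AE)
      show "AE x in lborel. indicator {..t} (norm x) * h x = 0 * h x"
        using AE_lborel_singleton[of "0::'a"]
      proof eventually_elim
        case (elim x)
        then have "\<not> norm x \<le> t" using False zero_less_norm_iff[of x] by linarith
        then show ?case by simp
      qed
    qed measurable
    then show ?thesis using False by simp
  qed
  have M: "M1 = M2"
    by (rule measure_eqI_atMost) (auto simp: E1 E2 eq' M1_def[THEN arg_cong[where f=sets]] M2_def[THEN arg_cong[where f=sets]])
  have i1: "integrable lborel (\<lambda>x::'a. a (norm x) * w (norm x))"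
    using integrable_mult_right[OF int, of C] by (simp add: w_def algebra_simps)
  show ah: "integrable lborel (\<lambda>x. a (norm x) * h x)"
    by (rule integrable_real_bound[OF i1])
      (use bh a in \<open>auto simp: w_def abs_mult intro!: mult_left_mono\<close>)
  have i2: "integrable lborel (\<lambda>t. ?r t * (a t * w t))"
    and i12: "(LINT x|(lborel::'a measure). a (norm x) * w (norm x)) = (LINT t|lborel. ?r t * (a t * w t))"
    using i1 integral_norm_lborel[where 'a='a, of "\<lambda>t. a t * w t"] by auto
  show aA: "integrable lborel (\<lambda>t. indicator {0<..} t * (a t * A t))"
  proof (rule integrable_real_bound[OF i2])
    show "norm (indicator {0<..} t * (a t * A t)) \<le> ?r t * (a t * w t)" for t
    proof (cases "0 < t")
      case True
      have "a t * \<bar>A t\<bar> \<le> a t * (w t * ?r t)" using bA[OF True] a by (intro mult_left_mono) (auto simp: w_def)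
      then show ?thesis using True a[of t] by (simp add: abs_mult algebra_simps)
    next
      case False
      have "?r t * w t = 0" using False rw0 by simp
      then show ?thesis using False by auto
    qed
  qed measurable
  \<comment> \<open>Integrating \<open>a\<close> against the common measure leaves the contribution
    of the majorant on both sides, where polar coordinates cancel it.\<close>
  have "(LINT x|lborel. a (norm x) * h x + a (norm x) * w (norm x)) = (LINT t|M1. a t)"
    unfolding M1_def using hw by (simp add: integral_distr integral_density algebra_simps)
  also have "\<dots> = (LINT t|lborel. indicator {0<..} t * (A t + w t * ?r t) * a t)"
    unfolding M M2_def using Aw by (simp add: integral_density)
  also have "\<dots> = (LINT t|lborel. indicator {0<..} t * (a t * A t) + ?r t * (a t * w t))"
  proof (rule Bochner_Integration.integral_cong[OF refl])
    fix t
    show "indicator {0<..} t * (A t + w t * ?r t) * a t = indicator {0<..} t * (a t * A t) + ?r t * (a t * w t)"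
      using rw0[of t] by (auto split: split_indicator simp: algebra_simps)
  qed
  finally show "(LINT x|lborel. a (norm x) * h x) = (LINT t|lborel. indicator {0<..} t * (a t * A t))"
    using ah i1 aA i2 i12 by simp
qed



section \<open>The Fourier transform of integrable functions\<close>

lemma borel_measurable_cis [measurable]: "cis \<in> borel_measurable borel"
  by (intro borel_measurable_continuous_onI continuous_intros)

text \<open>The given transforms integrate over the completed measure, while Fubini and changes of
  variables are used for \<open>lborel\<close>. The inverse transform is this one at the reflected
  point and gets no name of its own.\<close>

definition ft :: "('a::euclidean_space \<Rightarrow> complex) \<Rightarrow> 'a \<Rightarrow> complex" where
  "ft f \<xi> = (LINT x|lborel. f x * cis (- (2 * pi * (x \<bullet> \<xi>))))"

lemma cis_eq_exp_scaleR: "exp (t *\<^sub>R \<i>) = cis t" "exp (- t *\<^sub>R \<i>) = cis (- t)"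
  by (simp_all add: cis_conv_exp scaleR_conv_of_real mult.commute)

lemma fourier_eq_ft:
  assumes [measurable]: "f \<in> borel_measurable borel"
  shows "fourier f \<xi> = ft f \<xi>" "inverse_fourier f x = ft f (- x)"
  unfolding fourier_def inverse_fourier_def ft_def cis_eq_exp_scaleR
  by (simp_all add: integral_completion inner_commute)

lemma norm_cis_minus_1_le: "norm (cis a - 1) \<le> \<bar>a\<bar>"
proof -
  have *: "norm (cis a - 1) \<le> a" if "0 \<le> a" for a :: real
  proof -
    have "norm (cis (0 + a *\<^sub>R 1) - cis 0) \<le> 1 * a"
    proof (rule norm_diff_le_line[where Df="\<lambda>x. \<i> * cis x"])
      show "((\<lambda>\<tau>. cis (x + \<tau> *\<^sub>R 1)) has_vector_derivative \<i> * cis x) (at 0)" for x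
        unfolding has_vector_derivative_def
        by (auto intro!: derivative_eq_intros simp: scaleR_conv_of_real)
    qed (use that in \<open>auto simp: norm_mult\<close>)
    then show ?thesis by simp
  qed
  show ?thesis
  proof (cases "0 \<le> a")
    case False
    have "norm (cis a - 1) = norm (cnj (cis (- a) - 1))" by (simp add: cis_cnj)
    also have "\<dots> \<le> - a" unfolding complex_mod_cnj by (rule *) (use False in simp)
    finally show ?thesis using False by simp
  qed (use * in simp)
qed

lemma integrable_mult_cis:
  assumes "integrable M f" "g \<in> borel_measurable M"
  shows "integrable M (\<lambda>x. f x * cis (g x))"
  by (rule Bochner_Integration.integrable_bound[OF assms(1)]) (use assms in \<open>auto simp: norm_mult\<close>)

lemma integrable_ft:
  "integrable lborel f \<Longrightarrow> integrable lborel (\<lambda>x. f x * cis (- (2 * pi * (x \<bullet> \<xi>))))"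
  by (rule integrable_mult_cis) auto

lemma norm_ft_le: "norm (ft f \<xi>) \<le> (LINT x|lborel. norm (f x))"
  unfolding ft_def
  by (rule order_trans[OF integral_norm_bound]) (simp add: norm_mult)

lemma ft_sum: "(\<And>j. j \<in> I \<Longrightarrow> integrable lborel (f j)) \<Longrightarrow> ft (\<lambda>x. \<Sum>j\<in>I. f j x) \<xi> = (\<Sum>j\<in>I. ft (f j) \<xi>)"
  unfolding ft_def by (simp add: integrable_ft sum_distrib_right)

lemma ft_cmult: "ft (\<lambda>x. c * f x) \<xi> = c * ft f \<xi>"
  unfolding ft_def by (simp add: mult.assoc)

lemma ft_continuous:
  assumes f: "integrable lborel f"
  shows "continuous_on UNIV (ft f)"
proof -
  have [measurable]: "f \<in> borel_measurable borel" using f by auto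
  have "(\<lambda>m. ft f (X m)) \<longlonglongrightarrow> ft f \<xi>" if "X \<longlonglongrightarrow> \<xi>" for X \<xi>
    unfolding ft_def
    by (rule integral_dominated_convergence[where w="\<lambda>x. norm (f x)"])
      (use f in \<open>auto simp: norm_mult intro!: tendsto_intros that\<close>)
  then show ?thesis
    by (auto simp: continuous_on_eq_continuous_at continuous_at_sequentially o_def)
qed

lemma ft_measurable [measurable]: "integrable lborel f \<Longrightarrow> ft f \<in> borel_measurable borel"
  by (intro borel_measurable_continuous_onI ft_continuous)

text \<open>Differentiation under the integral: the difference quotient of the character is at most
  2 pi |x| |v|, so the first moment of \<open>f\<close> is the majorant.\<close>

lemma ft_has_vector_derivative:
  assumes f: "integrable lborel f" and xf: "integrable lborel (\<lambda>x. norm x * norm (f x))"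
  shows "((\<lambda>\<tau>. ft f (\<xi> + \<tau> *\<^sub>R v)) has_vector_derivative
    ft (\<lambda>x. - (2 * pi * (x \<bullet> v)) *\<^sub>R (\<i> * f x)) \<xi>) (at 0)"
  unfolding has_vector_derivative_at_0_iff tendsto_at_iff_sequentially
proof (intro allI impI)
  fix X :: "nat \<Rightarrow> real" assume X: "\<forall>i. X i \<in> UNIV - {0}" "X \<longlonglongrightarrow> 0"
  have [measurable]: "f \<in> borel_measurable borel" using f by auto
  define q where "q m x = f x * cis (- (2 * pi * (x \<bullet> \<xi>))) * ((cis (X m * - (2 * pi * (x \<bullet> v))) - 1) /\<^sub>R X m)" for m x
  have "(ft f (\<xi> + X m *\<^sub>R v) - ft f (\<xi> + 0 *\<^sub>R v)) /\<^sub>R X m = (LINT x|lborel. q m x)" for m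
  proof -
    have "ft f (\<xi> + X m *\<^sub>R v) - ft f (\<xi> + 0 *\<^sub>R v)
       = (LINT x|lborel. f x * cis (- (2 * pi * (x \<bullet> (\<xi> + X m *\<^sub>R v)))) - f x * cis (- (2 * pi * (x \<bullet> \<xi>))))"
      unfolding ft_def using f by (simp add: integrable_ft)
    also have "\<dots> = (LINT x|lborel. X m *\<^sub>R q m x)"
    proof (rule Bochner_Integration.integral_cong[OF refl])
      fix x
      have "cis (- (2 * pi * (x \<bullet> (\<xi> + X m *\<^sub>R v)))) = cis (- (2 * pi * (x \<bullet> \<xi>))) * cis (X m * - (2 * pi * (x \<bullet> v)))"
        unfolding cis_mult by (simp add: inner_add_right algebra_simps)
      then show "f x * cis (- (2 * pi * (x \<bullet> (\<xi> + X m *\<^sub>R v)))) - f x * cis (- (2 * pi * (x \<bullet> \<xi>))) = X m *\<^sub>R q m x"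
        using X(1) by (simp add: q_def algebra_simps)
    qed
    finally show ?thesis using X(1) by simp
  qed
  moreover have "(\<lambda>m. LINT x|lborel. q m x) \<longlonglongrightarrow> ft (\<lambda>x. - (2 * pi * (x \<bullet> v)) *\<^sub>R (\<i> * f x)) \<xi>"
    unfolding ft_def
  proof (rule integral_dominated_convergence[where w="\<lambda>x. 2 * pi * norm v * (norm x * norm (f x))"])
    show "integrable lborel (\<lambda>x. 2 * pi * norm v * (norm x * norm (f x)))" using xf by simp
    show "AE x in lborel. (\<lambda>m. q m x) \<longlonglongrightarrow> - (2 * pi * (x \<bullet> v)) *\<^sub>R (\<i> * f x) * cis (- (2 * pi * (x \<bullet> \<xi>)))"
    proof (rule AE_I2)
      fix x
      define a where "a = - (2 * pi * (x \<bullet> v))"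
      have "((\<lambda>\<tau>. cis (\<tau> * a)) has_vector_derivative a *\<^sub>R \<i>) (at 0)"
        unfolding has_vector_derivative_def by (auto intro!: derivative_eq_intros simp: scaleR_conv_of_real)
      then have "((\<lambda>\<tau>. (cis (\<tau> * a) - 1) /\<^sub>R \<tau>) \<longlongrightarrow> a *\<^sub>R \<i>) (at 0)"
        by (simp add: has_vector_derivative_at_0_iff)
      then have "(\<lambda>m. (cis (X m * a) - 1) /\<^sub>R X m) \<longlonglongrightarrow> a *\<^sub>R \<i>"
        using X by (simp add: tendsto_at_iff_sequentially o_def)
      then have "(\<lambda>m. f x * cis (- (2 * pi * (x \<bullet> \<xi>))) * ((cis (X m * a) - 1) /\<^sub>R X m))
          \<longlonglongrightarrow> f x * cis (- (2 * pi * (x \<bullet> \<xi>))) * (a *\<^sub>R \<i>)"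
        by (rule tendsto_mult[OF tendsto_const])
      then show "(\<lambda>m. q m x) \<longlonglongrightarrow> - (2 * pi * (x \<bullet> v)) *\<^sub>R (\<i> * f x) * cis (- (2 * pi * (x \<bullet> \<xi>)))"
        by (simp add: q_def a_def ac_simps)
    qed
    show "AE x in lborel. norm (q m x) \<le> 2 * pi * norm v * (norm x * norm (f x))" for m
    proof (rule AE_I2)
      fix x
      have "norm ((cis (X m * - (2 * pi * (x \<bullet> v))) - 1) /\<^sub>R X m) \<le> \<bar>X m * - (2 * pi * (x \<bullet> v))\<bar> / \<bar>X m\<bar>"
        using norm_cis_minus_1_le[of "X m * - (2 * pi * (x \<bullet> v))"]
        by (simp add: divide_inverse mult.commute[of "inverse _"] mult_right_mono)
      also have "\<dots> = 2 * pi * \<bar>x \<bullet> v\<bar>" using X(1) by (simp add: abs_mult)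
      also have "\<dots> \<le> 2 * pi * (norm x * norm v)" using Cauchy_Schwarz_ineq2 by (intro mult_left_mono) auto
      finally have "norm (f x) * norm ((cis (X m * - (2 * pi * (x \<bullet> v))) - 1) /\<^sub>R X m) \<le> norm (f x) * (2 * pi * (norm x * norm v))"
        by (rule mult_left_mono) simp
      then show "norm (q m x) \<le> 2 * pi * norm v * (norm x * norm (f x))"
        by (simp add: q_def norm_mult ac_simps)
    qed
  qed (auto simp: q_def)
  ultimately show "((\<lambda>\<tau>. (ft f (\<xi> + \<tau> *\<^sub>R v) - ft f (\<xi> + 0 *\<^sub>R v)) /\<^sub>R \<tau>) \<circ> X) \<longlonglongrightarrow> ft (\<lambda>x. - (2 * pi * (x \<bullet> v)) *\<^sub>R (\<i> * f x)) \<xi>"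
    by (simp add: o_def)
qed

text \<open>Peetre's inequality: it moves a polynomial weight from a shifted point back to the
  original one at the price of a factor depending on the shift only.\<close>

lemma Peetre_le: "1 + norm x \<le> (1 + norm (x + y)) * (1 + norm y)" for x y :: "'a::real_normed_vector"
proof -
  have "norm x \<le> norm (x + y) + norm y"
    using norm_triangle_ineq4[of "x + y" y] by simp
  moreover have "0 \<le> norm (x + y) * norm y" by simp
  ultimately show ?thesis unfolding distrib_left distrib_right mult_1_left mult_1_right by linarith
qed

text \<open>Integration by parts without boundary terms: the derivative of \<open>f\<close> times
  the character has integral zero. Peetre's inequality makes the bound on this derivative along a
  segment of length at most |v| a single integrable function of the starting point.\<close>

lemma ft_derivative:
  fixes f Df :: "'a::euclidean_space \<Rightarrow> complex"
  assumes d: "\<And>x. ((\<lambda>\<tau>. f (x + \<tau> *\<^sub>R v)) has_vector_derivative Df x) (at 0)"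
    and [measurable]: "f \<in> borel_measurable borel" "Df \<in> borel_measurable borel"
    and bf: "\<And>x. norm (f x) \<le> C / (1 + norm x) ^ (DIM('a) + 1)"
    and bd: "\<And>x. norm (Df x) \<le> C / (1 + norm x) ^ (DIM('a) + 1)"
  shows "ft Df \<xi> = (2 * pi * (v \<bullet> \<xi>)) *\<^sub>R (\<i> * ft f \<xi>)"
proof -
  let ?p = "\<lambda>x::'a. (1 + norm x) ^ (DIM('a) + 1)"
  have pI: "integrable lborel (\<lambda>x. c * (1 / ?p x))" for c
    using integrable_inverse_power by (rule integrable_mult_right)
  have pp: "0 < ?p x" for x by (simp add: add_pos_nonneg)
  have fI: "integrable lborel f" "integrable lborel Df"
    using bf bd by (auto intro!: integrable_real_bound[OF pI[of C]])
  have C: "0 \<le> C" using order_trans[OF norm_ge_zero bf[of 0]] by simp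
  define c where "c = - (2 * pi * (v \<bullet> \<xi>))"
  define F where "F x = f x * cis (- (2 * pi * (x \<bullet> \<xi>)))" for x
  define D where "D x = Df x * cis (- (2 * pi * (x \<bullet> \<xi>))) + c *\<^sub>R (\<i> * F x)" for x
  have dF: "((\<lambda>\<tau>. F (x + \<tau> *\<^sub>R v)) has_vector_derivative D x) (at 0)" for x
  proof -
    have "((\<lambda>\<tau>. cis (- (2 * pi * ((x + \<tau> *\<^sub>R v) \<bullet> \<xi>)))) has_vector_derivative
        c *\<^sub>R (\<i> * cis (- (2 * pi * (x \<bullet> \<xi>))))) (at 0)"
      unfolding has_vector_derivative_def
      by (auto intro!: derivative_eq_intros simp: c_def inner_add_left scaleR_conv_of_real algebra_simps)
    from has_vector_derivative_mult[OF d[of x] this]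
    show ?thesis by (simp add: F_def D_def algebra_simps)
  qed
  have FI: "integrable lborel F" unfolding F_def by (intro integrable_ft fI)
  have nF: "norm (F x) = norm (f x)" for x by (simp add: F_def norm_mult)
  have nD: "norm (D x) \<le> (1 + \<bar>c\<bar>) * C / ?p x" for x
  proof -
    have "norm (D x) \<le> norm (Df x) + \<bar>c\<bar> * norm (f x)"
      unfolding D_def by (rule order_trans[OF norm_triangle_ineq]) (simp add: norm_mult nF)
    also have "\<dots> \<le> C / ?p x + \<bar>c\<bar> * (C / ?p x)"
      using bf bd by (intro add_mono mult_left_mono) auto
    finally show ?thesis by (simp only: distrib_right mult_1_left add_divide_distrib times_divide_eq_right)
  qed
  have Dm: "D \<in> borel_measurable borel" unfolding D_def F_def by measurable
  have lip: "norm (F (x + \<tau> *\<^sub>R v) - F x) \<le> \<tau> * ((1 + \<bar>c\<bar>) * C * (1 + norm v) ^ (DIM('a) + 1) * (1 / ?p x))"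
      if t: "0 < \<tau>" "\<tau> \<le> 1" for x \<tau>
    proof -
      have "norm (D (x + \<sigma> *\<^sub>R v)) \<le> (1 + \<bar>c\<bar>) * C * (1 + norm v) ^ (DIM('a) + 1) * (1 / ?p x)"
        if "\<sigma> \<in> {0..\<tau>}" for \<sigma>
      proof -
        have "norm (\<sigma> *\<^sub>R v) \<le> norm v" using that t by (simp add: mult_left_le_one_le)
        then have "1 + norm x \<le> (1 + norm (x + \<sigma> *\<^sub>R v)) * (1 + norm v)"
          using Peetre_le[of x "\<sigma> *\<^sub>R v"] by (smt (verit, best) mult_left_mono norm_ge_zero)
        then have "?p x \<le> ?p (x + \<sigma> *\<^sub>R v) * (1 + norm v) ^ (DIM('a) + 1)"
          unfolding power_mult_distrib[symmetric] by (rule power_mono) simp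
        then have "1 / ?p (x + \<sigma> *\<^sub>R v) \<le> (1 + norm v) ^ (DIM('a) + 1) * (1 / ?p x)"
          using pp[of x] pp[of "x + \<sigma> *\<^sub>R v"] by (simp add: field_simps)
        then have "(1 + \<bar>c\<bar>) * C * (1 / ?p (x + \<sigma> *\<^sub>R v)) \<le> (1 + \<bar>c\<bar>) * C * ((1 + norm v) ^ (DIM('a) + 1) * (1 / ?p x))"
          using C by (intro mult_left_mono) auto
        then show ?thesis using nD[of "x + \<sigma> *\<^sub>R v"] by (simp add: mult.assoc)
      qed
      from norm_diff_le_line[OF dF this] t show ?thesis by (simp add: mult.commute)
    qed
  note integral_directional_derivative[OF FI Dm AE_I2[OF dF] pI lip]
  moreover have "(LINT x|lborel. D x) = ft Df \<xi> + c *\<^sub>R (\<i> * ft f \<xi>)"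
    unfolding D_def F_def ft_def using fI by (simp add: integrable_ft)
  ultimately show ?thesis by (simp add: c_def add_eq_0_iff)
qed

lemma ft_scale:
  fixes f :: "'a::euclidean_space \<Rightarrow> complex"
  assumes [measurable]: "f \<in> borel_measurable borel" and c: "c \<noteq> 0"
  shows "ft (\<lambda>x. f (c *\<^sub>R x)) (c *\<^sub>R \<xi>) = (1 / \<bar>c\<bar> ^ DIM('a)) *\<^sub>R ft f \<xi>"
    and "ft (\<lambda>x. f (c *\<^sub>R x)) \<eta> = (1 / \<bar>c\<bar> ^ DIM('a)) *\<^sub>R ft f (\<eta> /\<^sub>R c)"
proof -
  have "ft f \<xi> = \<bar>c\<bar> ^ DIM('a) *\<^sub>R ft (\<lambda>x. f (c *\<^sub>R x)) (c *\<^sub>R \<xi>)" for \<xi>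
    unfolding ft_def by (subst lborel_integral_affine[OF _ c, of _ 0]) (auto simp: mult.left_commute)
  then show *: "ft (\<lambda>x. f (c *\<^sub>R x)) (c *\<^sub>R \<xi>) = (1 / \<bar>c\<bar> ^ DIM('a)) *\<^sub>R ft f \<xi>" for \<xi>
    using c by simp
  from *[of "\<eta> /\<^sub>R c"] show "ft (\<lambda>x. f (c *\<^sub>R x)) \<eta> = (1 / \<bar>c\<bar> ^ DIM('a)) *\<^sub>R ft f (\<eta> /\<^sub>R c)"
    using c by simp
qed

lemma ft_translate:
  fixes f :: "'a::euclidean_space \<Rightarrow> complex"
  assumes [measurable]: "f \<in> borel_measurable borel"
  shows "ft (\<lambda>x. f (x + a)) \<xi> = cis (2 * pi * (a \<bullet> \<xi>)) * ft f \<xi>"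
proof -
  have "ft f \<xi> = (LINT x|lborel. f (x + a) * cis (- (2 * pi * ((x + a) \<bullet> \<xi>))))"
    unfolding ft_def by (rule lborel_integral_translate(2)[symmetric]) simp
  also have "\<dots> = (LINT x|lborel. cis (- (2 * pi * (a \<bullet> \<xi>))) * (f (x + a) * cis (- (2 * pi * (x \<bullet> \<xi>)))))"
  proof (rule Bochner_Integration.integral_cong[OF refl])
    fix x
    have "cis (- (2 * pi * ((x + a) \<bullet> \<xi>))) = cis (- (2 * pi * (a \<bullet> \<xi>))) * cis (- (2 * pi * (x \<bullet> \<xi>)))"
      unfolding cis_mult by (simp add: inner_add_left algebra_simps)
    then show "f (x + a) * cis (- (2 * pi * ((x + a) \<bullet> \<xi>))) = cis (- (2 * pi * (a \<bullet> \<xi>))) * (f (x + a) * cis (- (2 * pi * (x \<bullet> \<xi>))))"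
      by simp
  qed
  also have "\<dots> = cis (- (2 * pi * (a \<bullet> \<xi>))) * ft (\<lambda>x. f (x + a)) \<xi>"
    unfolding ft_def by simp
  finally have "cis (2 * pi * (a \<bullet> \<xi>)) * ft f \<xi> = (cis (2 * pi * (a \<bullet> \<xi>)) * cis (- (2 * pi * (a \<bullet> \<xi>)))) * ft (\<lambda>x. f (x + a)) \<xi>"
    by simp
  then show ?thesis by (simp add: cis_mult)
qed

lemma ft_reflect:
  fixes f :: "'a::euclidean_space \<Rightarrow> complex"
  assumes [measurable]: "f \<in> borel_measurable borel"
  shows "ft (\<lambda>x. f (- x)) \<xi> = ft f (- \<xi>)"
  unfolding ft_def by (subst lborel_integral_minus(2)[symmetric]) auto

text \<open>The multiplication formula, with majorant |f(x)| |g(\<xi>)|. It carries inversion, the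
  pairing of the mollified kernel with Gaussians, and its pairing with translates of u.\<close>

lemma ft_swap:
  fixes f g :: "'a::euclidean_space \<Rightarrow> complex"
  assumes f: "integrable lborel f" and g: "integrable lborel g"
  shows "(LINT \<xi>|lborel. ft f \<xi> * g \<xi>) = (LINT x|lborel. f x * ft g x)"
proof -
  have [measurable]: "f \<in> borel_measurable borel" "g \<in> borel_measurable borel" using f g by auto
  have "(LINT \<xi>|lborel. ft f \<xi> * g \<xi>) = (LINT \<xi>|lborel. LINT x|lborel. f x * g \<xi> * cis (- (2 * pi * (x \<bullet> \<xi>))))"
    unfolding ft_def by (intro Bochner_Integration.integral_cong refl, subst integral_mult_left_zero[symmetric]) (simp add: ac_simps)
  also have "\<dots> = (LINT x|lborel. LINT \<xi>|lborel. f x * g \<xi> * cis (- (2 * pi * (x \<bullet> \<xi>))))"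
  proof (rule lborel_pair.Fubini_integral)
    show "integrable (lborel \<Otimes>\<^sub>M lborel) (\<lambda>(x, \<xi>). f x * g \<xi> * cis (- (2 * pi * (x \<bullet> \<xi>))))"
      by (rule integrable_pair_bound[where g="\<lambda>x. norm (f x)" and h="\<lambda>x. norm (g x)"])
        (use f g in \<open>auto simp: norm_mult\<close>)
  qed
  also have "\<dots> = (LINT x|lborel. f x * ft g x)"
  proof (rule Bochner_Integration.integral_cong[OF refl])
    fix x
    show "(LINT \<xi>|lborel. f x * g \<xi> * cis (- (2 * pi * (x \<bullet> \<xi>)))) = f x * ft g x"
      unfolding ft_def inner_commute[of _ x] by (subst integral_mult_right_zero[symmetric]) (simp add: mult.assoc)
  qed
  finally show ?thesis .
qed

text \<open>The convolution is written in the rescaled variable, so that the majorant does not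
  depend on the scale. The scales may then have any sign, and mollification uses negative
  ones.\<close>

lemma approximate_identity:
  fixes F g :: "'a::euclidean_space \<Rightarrow> complex"
  assumes g: "integrable lborel g" and [measurable]: "F \<in> borel_measurable borel"
    and F: "\<And>y. norm (F y) \<le> C" and cont: "isCont F x" and X: "X \<longlonglongrightarrow> 0"
  shows "(\<lambda>m. LINT z|lborel. g z * F (x + X m *\<^sub>R z)) \<longlonglongrightarrow> (LINT z|lborel. g z) * F x"
proof -
  have [measurable]: "g \<in> borel_measurable borel" using g by auto
  have C: "0 \<le> C" using order_trans[OF norm_ge_zero F] by auto
  have "(\<lambda>m. LINT z|lborel. g z * F (x + X m *\<^sub>R z)) \<longlonglongrightarrow> (LINT z|lborel. g z * F x)"
  proof (rule integral_dominated_convergence[where w="\<lambda>z. C * norm (g z)"])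
    show "AE z in lborel. (\<lambda>m. g z * F (x + X m *\<^sub>R z)) \<longlonglongrightarrow> g z * F x"
    proof (rule AE_I2)
      fix z
      have "(\<lambda>m. x + X m *\<^sub>R z) \<longlonglongrightarrow> x + 0 *\<^sub>R z" by (intro tendsto_intros X)
      then have "(\<lambda>m. x + X m *\<^sub>R z) \<longlonglongrightarrow> x" by simp
      then have "(\<lambda>m. F (x + X m *\<^sub>R z)) \<longlonglongrightarrow> F x" by (rule isCont_tendsto_compose[OF cont])
      then show "(\<lambda>m. g z * F (x + X m *\<^sub>R z)) \<longlonglongrightarrow> g z * F x" by (intro tendsto_intros)
    qed
    show "AE z in lborel. norm (g z * F (x + X m *\<^sub>R z)) \<le> C * norm (g z)" for m
      using F by (auto simp: norm_mult mult.commute[of C] intro!: mult_left_mono)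
  qed (use g in auto)
  then show ?thesis by simp
qed

subsection \<open>The Gaussian and Fourier inversion\<close>

definition gauss :: "'a::euclidean_space \<Rightarrow> real" where
  "gauss x = exp (- (pi * (norm x)\<^sup>2))"

lemma gauss_measurable [measurable]: "gauss \<in> borel_measurable borel"
  unfolding gauss_def by measurable

lemma gauss_pos [simp]: "0 < gauss x" "0 \<le> gauss x" by (auto simp: gauss_def)

lemma gauss_le_1 [simp]: "gauss x \<le> 1" by (simp add: gauss_def)

lemma power_le_fact_exp: "0 \<le> (x::real) \<Longrightarrow> x ^ n \<le> fact n * exp x"
proof -
  assume x: "0 \<le> x"
  have "(\<Sum>k\<in>{n}. x ^ k /\<^sub>R fact k) \<le> (\<Sum>k. x ^ k /\<^sub>R fact k)"
    by (rule sum_le_suminf[OF summable_exp_generic]) (use x in auto)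
  then show ?thesis by (simp add: exp_def field_simps)
qed

lemma gauss_decay: "(1 + norm x) ^ N * gauss x \<le> fact N * exp 2"
proof -
  have "(1 + norm x) ^ N * gauss x \<le> fact N * exp (1 + norm x) * exp (- (pi * (norm x)\<^sup>2))"
    unfolding gauss_def by (intro mult_right_mono power_le_fact_exp) auto
  also have "\<dots> = fact N * exp (1 + norm x - pi * (norm x)\<^sup>2)" by (simp add: exp_diff exp_minus field_simps)
  \<comment> \<open>The 2 is 1 plus the crude bound t - t^2 <= 1, with pi replaced by 1.\<close>
  also have "\<dots> \<le> fact N * exp 2"
  proof -
    have "norm x - (norm x)\<^sup>2 \<le> 1" using zero_le_power2[of "norm x - 1/2"] by (simp add: power2_eq_square algebra_simps)
    moreover have "(norm x)\<^sup>2 \<le> pi * (norm x)\<^sup>2" using pi_ge_two by (intro mult_right_mono[of 1 pi, simplified]) auto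
    ultimately show ?thesis by simp
  qed
  finally show ?thesis .
qed

lemma gauss_bound: "gauss x \<le> fact N * exp 2 / (1 + norm x) ^ N"
  using gauss_decay[of x N] by (simp add: field_simps add_pos_nonneg)

lemma integrable_gauss: "integrable lborel (gauss :: 'a::euclidean_space \<Rightarrow> real)"
proof (rule integrable_real_bound[OF integrable_mult_right[OF integrable_inverse_power, of "fact (DIM('a) + 1) * exp 2"]])
  show "norm (gauss x) \<le> fact (DIM('a) + 1) * exp 2 * (1 / (1 + norm x) ^ (DIM('a) + 1))" for x :: 'a
    using gauss_bound[of x "DIM('a) + 1"]
    by (simp only: mult_1_right times_divide_eq_right real_norm_def abs_of_nonneg gauss_pos)
qed simp

lemma integral_gauss: "(LINT x|lborel. gauss (x::'a::euclidean_space)) = 1"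
proof -
  \<comment> \<open>The Gaussian is normalised as a probability density: on the line it is the
    normal density of variance 1/(2 pi).\<close>
  have 1: "exp (- (pi * t\<^sup>2)) = normal_density 0 (1 / sqrt (2 * pi)) t" for t :: real
    by (simp add: normal_density_def power_divide real_sqrt_divide)
  have "(\<integral>\<^sup>+x. ennreal (gauss (x::'a)) \<partial>lborel) = (\<integral>\<^sup>+x. (\<Prod>b\<in>Basis. ennreal (exp (- (pi * ((x::'a) \<bullet> b)\<^sup>2)))) \<partial>lborel)"
  proof (rule nn_integral_cong)
    fix x :: 'a
    have "(norm x)\<^sup>2 = (\<Sum>b\<in>Basis. (x \<bullet> b)\<^sup>2)"
      using euclidean_inner[of x x] by (simp add: power2_norm_eq_inner flip: power2_eq_square)
    then show "ennreal (gauss x) = (\<Prod>b\<in>Basis. ennreal (exp (- (pi * (x \<bullet> b)\<^sup>2))))"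
      by (simp add: gauss_def prod_ennreal sum_negf flip: exp_sum sum_distrib_left)
  qed
  also have "\<dots> = (\<Prod>b\<in>(Basis::'a set). (\<integral>\<^sup>+t. ennreal (exp (- (pi * t\<^sup>2))) \<partial>lborel))"
    by (rule nn_integral_lborel_prod) auto
  also have "(\<integral>\<^sup>+t. ennreal (exp (- (pi * t\<^sup>2))) \<partial>lborel) = 1"
    unfolding 1 by (subst nn_integral_eq_integral) auto
  finally have "(\<integral>\<^sup>+x. ennreal (gauss (x::'a)) \<partial>lborel) = 1" by simp
  then show ?thesis by (simp add: integral_eq_nn_integral)
qed

text \<open>The Gaussian satisfies the equation Dg = -2 pi (x.\<xi>) g, and transforming this gives
  the same equation for its transform. On the ray through \<open>\<xi>\<close> the integrating
  factor exp(pi \<tau>^2 |\<xi>|^2) turns the transform into a constant, which is the total mass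
  1.\<close>

lemma ft_gauss: "ft (\<lambda>x. of_real (gauss x)) \<xi> = of_real (gauss (\<xi> :: 'a::euclidean_space))"
proof -
  let ?g = "\<lambda>x::'a. complex_of_real (gauss x)"
  let ?n = "DIM('a) + 1"
  define Dg where "Dg x = complex_of_real (- (2 * pi * (x \<bullet> \<xi>)) * gauss x)" for x
  have gI: "integrable lborel ?g" using integrable_gauss by (rule integrable_of_real)
  have bnd: "norm x * gauss x \<le> fact (?n + 1) * exp 2 / (1 + norm x) ^ ?n" for x :: 'a
  proof -
    have "(1 + norm x) ^ ?n * (norm x * gauss x) \<le> (1 + norm x) ^ ?n * ((1 + norm x) * gauss x)"
      by (intro mult_left_mono mult_right_mono) auto
    also have "\<dots> = (1 + norm x) ^ (?n + 1) * gauss x" by (simp add: ac_simps)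
    also have "\<dots> \<le> fact (?n + 1) * exp 2" by (rule gauss_decay)
    finally show ?thesis by (simp add: field_simps add_pos_nonneg)
  qed
  have xgI: "integrable lborel (\<lambda>x. norm x * norm (?g x))"
  proof (rule integrable_real_bound[OF integrable_mult_right[OF integrable_inverse_power, of "fact (?n + 1) * exp 2"]])
    show "norm (norm x * norm (?g x)) \<le> fact (?n + 1) * exp 2 * (1 / (1 + norm x) ^ ?n)" for x
      using bnd[of x] by (simp only: mult_1_right times_divide_eq_right norm_of_real real_norm_def abs_mult abs_norm_cancel abs_of_nonneg gauss_pos)
  qed simp
  have dg: "((\<lambda>\<tau>. ?g (x + \<tau> *\<^sub>R \<xi>)) has_vector_derivative Dg x) (at 0)" for x
  proof -
    have "((\<lambda>\<tau>. gauss (x + \<tau> *\<^sub>R \<xi>)) has_real_derivative - (2 * pi * (x \<bullet> \<xi>)) * gauss x) (at 0)"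
      unfolding gauss_def power2_norm_eq_inner
      by (auto intro!: derivative_eq_intros simp: inner_add_left inner_add_right inner_commute algebra_simps)
    then show ?thesis unfolding Dg_def
      unfolding has_real_derivative_iff_has_vector_derivative
      by (rule bounded_linear.has_vector_derivative[OF bounded_linear_of_real])
  qed
  have bDg: "norm (Dg x) \<le> (1 + 2 * pi * norm \<xi>) * (fact (?n + 1) * exp 2) / (1 + norm x) ^ ?n" for x
  proof -
    have "norm (Dg x) \<le> 2 * pi * (norm x * norm \<xi>) * gauss x"
      unfolding Dg_def norm_of_real using Cauchy_Schwarz_ineq2[of x \<xi>] by (simp add: abs_mult mult_right_mono)
    also have "\<dots> = 2 * pi * norm \<xi> * (norm x * gauss x)" by simp
    also have "\<dots> \<le> (1 + 2 * pi * norm \<xi>) * (fact (?n + 1) * exp 2 / (1 + norm x) ^ ?n)"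
      using bnd by (intro mult_mono) auto
    finally show ?thesis by simp
  qed
  have bg: "norm (?g x) \<le> (1 + 2 * pi * norm \<xi>) * (fact (?n + 1) * exp 2) / (1 + norm x) ^ ?n" for x
  proof -
    have "gauss x \<le> 1 * (fact (?n + 1) * exp 2 / (1 + norm x) ^ ?n)"
    proof -
      have "fact ?n * exp 2 / (1 + norm x) ^ ?n \<le> fact (?n + 1) * exp 2 / (1 + norm x) ^ ?n"
        by (intro divide_right_mono mult_right_mono fact_mono) auto
      then show ?thesis using gauss_bound[of x ?n] by linarith
    qed
    also have "\<dots> \<le> (1 + 2 * pi * norm \<xi>) * (fact (?n + 1) * exp 2 / (1 + norm x) ^ ?n)"
      by (intro mult_right_mono) auto
    finally show ?thesis by simp
  qed
  have key: "((\<lambda>\<tau>. ft ?g (\<eta> + \<tau> *\<^sub>R \<xi>)) has_vector_derivative - (2 * pi * (\<xi> \<bullet> \<eta>)) *\<^sub>R ft ?g \<eta>) (at 0)" for \<eta>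
  proof -
    have "ft (\<lambda>x. - (2 * pi * (x \<bullet> \<xi>)) *\<^sub>R (\<i> * ?g x)) \<eta> = ft (\<lambda>x. \<i> * Dg x) \<eta>"
      by (simp add: Dg_def scaleR_conv_of_real mult.left_commute)
    also have "\<dots> = \<i> * ft Dg \<eta>" by (rule ft_cmult)
    also have "ft Dg \<eta> = (2 * pi * (\<xi> \<bullet> \<eta>)) *\<^sub>R (\<i> * ft ?g \<eta>)"
      by (rule ft_derivative[OF dg _ _ bg bDg]) (auto simp: Dg_def)
    also have "\<i> * ((2 * pi * (\<xi> \<bullet> \<eta>)) *\<^sub>R (\<i> * ft ?g \<eta>)) = - (2 * pi * (\<xi> \<bullet> \<eta>)) *\<^sub>R ft ?g \<eta>"
      by (simp add: mult.assoc[symmetric])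
    finally show ?thesis using ft_has_vector_derivative[OF gI xgI, of \<eta> \<xi>] by simp
  qed
  define h where "h \<tau> = exp (pi * \<tau>\<^sup>2 * (norm \<xi>)\<^sup>2) *\<^sub>R ft ?g (0 + \<tau> *\<^sub>R \<xi>)" for \<tau>
  have "(h has_vector_derivative 0) (at \<tau>)" for \<tau>
  proof -
    have 1: "((\<lambda>\<tau>. exp (pi * \<tau>\<^sup>2 * (norm \<xi>)\<^sup>2)) has_real_derivative 2 * pi * \<tau> * (norm \<xi>)\<^sup>2 * exp (pi * \<tau>\<^sup>2 * (norm \<xi>)\<^sup>2)) (at \<tau>)"
      by (auto intro!: derivative_eq_intros)
    have "((\<lambda>\<tau>. ft ?g (0 + \<tau> *\<^sub>R \<xi>)) has_vector_derivative - (2 * pi * (\<xi> \<bullet> (0 + \<tau> *\<^sub>R \<xi>))) *\<^sub>R ft ?g (0 + \<tau> *\<^sub>R \<xi>)) (at \<tau>)"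
      by (rule has_vector_derivative_line[where f="ft ?g", OF key])
    from has_vector_derivative_scaleR[OF 1 this]
    show ?thesis unfolding h_def by (simp add: power2_norm_eq_inner algebra_simps)
  qed
  then obtain c where c: "h \<tau> = c" for \<tau>
    using has_vector_derivative_zero_constant[of UNIV h] by auto
  have "h 1 = h 0" by (simp add: c)
  moreover have "ft ?g 0 = 1" unfolding ft_def by (simp add: integral_gauss)
  ultimately have "exp (pi * (norm \<xi>)\<^sup>2) *\<^sub>R ft ?g \<xi> = 1" by (simp add: h_def)
  then have "exp (- (pi * (norm \<xi>)\<^sup>2)) *\<^sub>R (exp (pi * (norm \<xi>)\<^sup>2) *\<^sub>R ft ?g \<xi>) = of_real (gauss \<xi>)"
    by (simp add: gauss_def scaleR_conv_of_real)
  then show ?thesis by (simp flip: exp_add)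
qed

lemma ft_gauss_scale:
  "ft (\<lambda>x. of_real (gauss (\<epsilon> *\<^sub>R x))) (\<xi> :: 'a::euclidean_space) = of_real (gauss (\<xi> /\<^sub>R \<epsilon>) / \<bar>\<epsilon>\<bar> ^ DIM('a))" if "\<epsilon> \<noteq> 0"
  using ft_scale(2)[of "\<lambda>x::'a. complex_of_real (gauss x)" \<epsilon> \<xi>] that
  by (simp add: ft_gauss scaleR_conv_of_real)

lemma integrable_gauss_scale:
  "integrable lborel (\<lambda>x::'a::euclidean_space. complex_of_real (gauss (\<epsilon> *\<^sub>R x)))" if "\<epsilon> \<noteq> 0"
proof -
  have "integrable lborel (\<lambda>x::'a. complex_of_real (gauss (0 + \<epsilon> *\<^sub>R x)))"
    by (subst lborel_integrable_affine[OF _ that]) (use integrable_gauss in auto)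
  then show ?thesis by simp
qed

theorem ft_inversion:
  fixes f :: "'a::euclidean_space \<Rightarrow> complex"
  assumes f: "integrable lborel f" and ff: "integrable lborel (ft f)"
    and b: "\<And>x. norm (f x) \<le> C" and cont: "isCont f x"
  shows "ft (ft f) (- x) = f x"
proof -
  have [measurable]: "f \<in> borel_measurable borel" using f by auto
  define X where "X m = 1 / real (Suc m)" for m
  have X: "X \<longlonglongrightarrow> 0" "X m > 0" for m unfolding X_def using LIMSEQ_Suc[OF lim_1_over_n] by auto
  let ?G = "\<lambda>m (\<xi>::'a). complex_of_real (gauss (X m *\<^sub>R \<xi>))"
  have gI: "integrable lborel (?G m)" for m using X(2)[of m] by (intro integrable_gauss_scale) auto
  have gcI: "integrable lborel (\<lambda>\<xi>. ?G m \<xi> * cis (2 * pi * (\<xi> \<bullet> x)))" for m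
    by (rule integrable_mult_cis[OF gI]) simp
  have ftG: "ft (\<lambda>\<xi>. ?G m \<xi> * cis (2 * pi * (\<xi> \<bullet> x))) y = of_real (gauss ((y - x) /\<^sub>R X m) / X m ^ DIM('a))" for m y
  proof -
    have "ft (\<lambda>\<xi>. ?G m \<xi> * cis (2 * pi * (\<xi> \<bullet> x))) y = ft (?G m) (y - x)"
      unfolding ft_def by (intro Bochner_Integration.integral_cong refl) (simp add: mult.assoc cis_mult inner_diff_right algebra_simps)
    then show ?thesis using X(2)[of m] by (simp add: ft_gauss_scale)
  qed
  have "(LINT \<xi>|lborel. ft f \<xi> * (?G m \<xi> * cis (2 * pi * (\<xi> \<bullet> x)))) = (LINT z|lborel. of_real (gauss z) * f (x + X m *\<^sub>R z))" for m
  proof -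
    have "(LINT \<xi>|lborel. ft f \<xi> * (?G m \<xi> * cis (2 * pi * (\<xi> \<bullet> x)))) = (LINT y|lborel. f y * of_real (gauss ((y - x) /\<^sub>R X m) / X m ^ DIM('a)))"
      unfolding ft_swap[OF f gcI] ftG ..
    also have "\<dots> = \<bar>X m\<bar> ^ DIM('a) *\<^sub>R (LINT z|lborel. f (x + X m *\<^sub>R z) * of_real (gauss (((x + X m *\<^sub>R z) - x) /\<^sub>R X m) / X m ^ DIM('a)))"
      by (rule lborel_integral_affine) (use X(2)[of m] in auto)
    also have "\<dots> = (LINT z|lborel. of_real (gauss z) * f (x + X m *\<^sub>R z))"
      using X(2)[of m] by (simp flip: integral_scaleR_right) (simp add: scaleR_conv_of_real mult.commute)
    finally show ?thesis .
  qed
  moreover have "(\<lambda>m. LINT z|lborel. of_real (gauss z) * f (x + X m *\<^sub>R z)) \<longlonglongrightarrow> (LINT z|lborel. complex_of_real (gauss (z::'a))) * f x"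
    by (rule approximate_identity[OF _ _ b cont X(1)]) (use integrable_gauss in auto)
  ultimately have L1: "(\<lambda>m. LINT \<xi>|lborel. ft f \<xi> * (?G m \<xi> * cis (2 * pi * (\<xi> \<bullet> x)))) \<longlonglongrightarrow> f x"
    by (simp add: integral_gauss)
  have "(\<lambda>m. LINT \<xi>|lborel. ft f \<xi> * (?G m \<xi> * cis (2 * pi * (\<xi> \<bullet> x)))) \<longlonglongrightarrow> (LINT \<xi>|lborel. ft f \<xi> * (1 * cis (2 * pi * (\<xi> \<bullet> x))))"
  proof (rule integral_dominated_convergence[where w="\<lambda>\<xi>. norm (ft f \<xi>)"])
    show "AE \<xi> in lborel. (\<lambda>m. ft f \<xi> * (?G m \<xi> * cis (2 * pi * (\<xi> \<bullet> x)))) \<longlonglongrightarrow> ft f \<xi> * (1 * cis (2 * pi * (\<xi> \<bullet> x)))"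
    proof (rule AE_I2)
      fix \<xi> :: 'a
      have "(\<lambda>m. complex_of_real (exp (- (pi * (norm (X m *\<^sub>R \<xi>))\<^sup>2)))) \<longlonglongrightarrow> of_real (exp (- (pi * (norm (0 *\<^sub>R \<xi>))\<^sup>2)))"
        by (intro tendsto_intros X)
      then have "(\<lambda>m. ?G m \<xi>) \<longlonglongrightarrow> 1" by (simp add: gauss_def)
      then show "(\<lambda>m. ft f \<xi> * (?G m \<xi> * cis (2 * pi * (\<xi> \<bullet> x)))) \<longlonglongrightarrow> ft f \<xi> * (1 * cis (2 * pi * (\<xi> \<bullet> x)))"
        by (intro tendsto_intros)
    qed
  qed (use f ff in \<open>auto simp: norm_mult mult_left_le\<close>)
  then have "(\<lambda>m. LINT \<xi>|lborel. ft f \<xi> * (?G m \<xi> * cis (2 * pi * (\<xi> \<bullet> x)))) \<longlonglongrightarrow> ft (ft f) (- x)"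
    by (simp add: ft_def)
  then show ?thesis using L1 by (rule LIMSEQ_unique)
qed



section \<open>Smooth and rapidly decreasing functions\<close>

lemma partial_deriv_eq: "(f has_derivative f') (at x) \<Longrightarrow> partial_deriv j f x = f' (axis j 1)"
  unfolding partial_deriv_def using frechet_derivative_at by metis

lemma iter_partial_Nil [simp]: "iter_partial [] f = f"
  and iter_partial_Cons [simp]: "iter_partial (j # js) f = partial_deriv j (iter_partial js f)"
  and iter_partial_snoc: "iter_partial (js @ [j]) f = iter_partial js (partial_deriv j f)"
  by (simp_all add: iter_partial_def)

text \<open>An invariant for smoothness: once a class is stable under partial derivatives, iterated
  derivatives never have to be computed.\<close>

lemma smooth_fun_closed:
  assumes "f \<in> S" and "\<And>g x. g \<in> S \<Longrightarrow> g differentiable (at x)" and "\<And>g j. g \<in> S \<Longrightarrow> partial_deriv j g \<in> S"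
  shows "smooth_fun f"
proof -
  have "iter_partial js f \<in> S" for js by (induction js) (use assms in auto)
  then show ?thesis using assms(2) by (auto simp: smooth_fun_def)
qed

lemma smooth_fun_differentiable: "smooth_fun f \<Longrightarrow> f differentiable (at x)"
  unfolding smooth_fun_def by (metis iter_partial_Nil)

lemma smooth_fun_iter_partial: "smooth_fun f \<Longrightarrow> smooth_fun (iter_partial js f)"
proof (induction js)
  case (Cons j js)
  have "smooth_fun (partial_deriv j g)" if "smooth_fun g" for g
    using that unfolding smooth_fun_def by (metis iter_partial_snoc)
  then show ?case using Cons by simp
qed simp

lemma smooth_fun_partial: "smooth_fun f \<Longrightarrow> smooth_fun (partial_deriv j f)"
  using smooth_fun_iter_partial[of f "[j]"] by simp

lemma smooth_fun_continuous: "smooth_fun f \<Longrightarrow> continuous_on UNIV f"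
  by (auto simp: continuous_on_eq_continuous_at intro: differentiable_imp_continuous_within smooth_fun_differentiable)

lemma smooth_fun_line:
  assumes "smooth_fun f"
  shows "((\<lambda>\<tau>. f (x + \<tau> *\<^sub>R axis j 1)) has_vector_derivative partial_deriv j f x) (at 0)"
proof -
  have "(f has_derivative frechet_derivative f (at x)) (at (x + 0 *\<^sub>R axis j 1))"
    using smooth_fun_differentiable[OF assms, of x] by (simp add: frechet_derivative_works)
  moreover have "((\<lambda>\<tau>. x + \<tau> *\<^sub>R axis j 1) has_vector_derivative axis j 1) (at 0)"
    unfolding has_vector_derivative_def by (auto intro!: derivative_eq_intros)
  ultimately have "((f \<circ> (\<lambda>\<tau>. x + \<tau> *\<^sub>R axis j 1)) has_vector_derivative frechet_derivative f (at x) (axis j 1)) (at 0)"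
    by (intro vector_derivative_diff_chain_within) (auto intro: has_derivative_at_withinI)
  then show ?thesis by (simp add: o_def partial_deriv_def)
qed

text \<open>The algebra generated by B. By the sum and product rules it is stable under partial
  derivatives as soon as the derivatives of the generators lie in it, and then all its elements are
  smooth.\<close>

inductive_set fun_alg :: "(real ^ 'n \<Rightarrow> complex) set \<Rightarrow> (real ^ 'n \<Rightarrow> complex) set" for B where
  gen: "f \<in> B \<Longrightarrow> f \<in> fun_alg B"
| const: "(\<lambda>x. c) \<in> fun_alg B"
| add: "f \<in> fun_alg B \<Longrightarrow> g \<in> fun_alg B \<Longrightarrow> (\<lambda>x. f x + g x) \<in> fun_alg B"
| mult: "f \<in> fun_alg B \<Longrightarrow> g \<in> fun_alg B \<Longrightarrow> (\<lambda>x. f x * g x) \<in> fun_alg B"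

lemma smooth_fun_alg:
  assumes B: "\<And>b x. b \<in> B \<Longrightarrow> b differentiable (at x)" "\<And>b j. b \<in> B \<Longrightarrow> partial_deriv j b \<in> fun_alg B"
    and "f \<in> fun_alg B"
  shows "smooth_fun f"
proof (rule smooth_fun_closed[OF \<open>f \<in> fun_alg B\<close>])
  fix g x assume "g \<in> fun_alg B"
  then show "g differentiable (at x)" by induction (auto intro: B)
next
  fix g j assume "g \<in> fun_alg B"
  then have "(\<forall>x. g differentiable (at x)) \<and> partial_deriv j g \<in> fun_alg B"
  proof induction
    case (const c)
    have "partial_deriv j (\<lambda>x. c) = (\<lambda>x. 0)" by (rule ext, subst partial_deriv_eq) auto
    then show ?case by (auto intro: fun_alg.const)
  next
    case (add f g)
    then have d: "(f has_derivative frechet_derivative f (at x)) (at x)" "(g has_derivative frechet_derivative g (at x)) (at x)" for x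
      by (simp_all flip: frechet_derivative_works)
    have "partial_deriv j (\<lambda>x. f x + g x) = (\<lambda>x. partial_deriv j f x + partial_deriv j g x)"
      unfolding partial_deriv_def[of j f] partial_deriv_def[of j g]
      by (rule ext, rule partial_deriv_eq[OF has_derivative_add[OF d]])
    then show ?case using add by (auto intro: fun_alg.add)
  next
    case (mult f g)
    then have d: "(f has_derivative frechet_derivative f (at x)) (at x)" "(g has_derivative frechet_derivative g (at x)) (at x)" for x
      by (simp_all flip: frechet_derivative_works)
    have "partial_deriv j (\<lambda>x. f x * g x) = (\<lambda>x. f x * partial_deriv j g x + partial_deriv j f x * g x)"
      unfolding partial_deriv_def[of j f] partial_deriv_def[of j g]
      by (rule ext, rule partial_deriv_eq[OF has_derivative_mult[OF d]])
    then show ?case using mult by (auto intro: fun_alg.add fun_alg.mult)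
  qed (auto intro: B)
  then show "partial_deriv j g \<in> fun_alg B" by simp
qed

text \<open>All smooth functions serve as generators, so one application of the product rule in the
  generated algebra replaces a Leibniz formula for iterated derivatives.\<close>

lemma smooth_fun_mult:
  assumes "smooth_fun f" "smooth_fun g"
  shows "smooth_fun (\<lambda>x. f x * g x)"
proof (rule smooth_fun_alg[where B="{h. smooth_fun h}"])
  show "(\<lambda>x. f x * g x) \<in> fun_alg {h. smooth_fun h}"
    using assms by (intro fun_alg.mult fun_alg.gen) auto
qed (auto intro: fun_alg.gen smooth_fun_partial smooth_fun_differentiable)

lemma smooth_fun_const: "smooth_fun (\<lambda>x. c)"
  by (rule smooth_fun_alg[where B="{}"]) (auto intro: fun_alg.const)

lemma has_derivative_coordinate:
  "((\<lambda>x::real^'n. complex_of_real (x $ i)) has_derivative (\<lambda>h. of_real (h $ i))) (at x)"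
  by (intro bounded_linear_imp_has_derivative bounded_linear_compose[OF bounded_linear_of_real bounded_linear_vec_nth])

lemma partial_deriv_coordinate:
  "partial_deriv j (\<lambda>x::real^'n. complex_of_real (x $ i)) = (\<lambda>x. of_real (axis j 1 $ i))"
  using partial_deriv_eq[OF has_derivative_coordinate] by auto

lemma smooth_fun_coordinate: "smooth_fun (\<lambda>x::real^'n. complex_of_real (x $ i))"
proof (rule smooth_fun_alg[where B="{\<lambda>x. complex_of_real (x $ i)}"])
  fix b x j assume b: "b \<in> {\<lambda>x::real^'n. complex_of_real (x $ i)}"
  show "b differentiable (at x)" using b has_derivative_coordinate differentiableI by blast
  show "partial_deriv j b \<in> fun_alg {\<lambda>x. complex_of_real (x $ i)}"
    using b fun_alg.const by (simp add: partial_deriv_coordinate)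
qed (rule fun_alg.gen, simp)

subsection \<open>Decay\<close>

lemma schwartz_decay:
  assumes "schwartz f"
  shows "\<exists>C\<ge>0. \<forall>x. norm (iter_partial js f x) \<le> C / (1 + norm x) ^ N"
proof -
  have b: "bounded (range (\<lambda>x. norm x ^ k *\<^sub>R iter_partial js f x))" for k
    using assms by (auto simp: schwartz_def)
  obtain A where A: "\<And>x. norm (norm x ^ 0 *\<^sub>R iter_partial js f x) \<le> A"
    using b[of 0] unfolding bounded_iff by blast
  obtain B where B: "\<And>x. norm (norm x ^ N *\<^sub>R iter_partial js f x) \<le> B"
    using b[of N] unfolding bounded_iff by blast
  have "norm (iter_partial js f x) \<le> (2 ^ N * (A + B)) / (1 + norm x) ^ N" for x
  proof -
    \<comment> \<open>Bounding 1 + t by 2 max(1,t) reduces the weight to the pure powers 0 and N in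
      the definition of a Schwartz function.\<close>
    have "(1 + norm x) ^ N \<le> (2 * max 1 (norm x)) ^ N" by (intro power_mono) auto
    also have "\<dots> \<le> 2 ^ N * (1 + norm x ^ N)" by (auto simp: power_mult_distrib max_def)
    finally have "norm (iter_partial js f x) * (1 + norm x) ^ N \<le> norm (iter_partial js f x) * (2 ^ N * (1 + norm x ^ N))"
      by (rule mult_left_mono) simp
    also have "\<dots> = 2 ^ N * (norm (norm x ^ 0 *\<^sub>R iter_partial js f x) + norm (norm x ^ N *\<^sub>R iter_partial js f x))"
      by (simp add: algebra_simps)
    also have "\<dots> \<le> 2 ^ N * (A + B)" by (intro mult_left_mono add_mono A B) simp
    finally show ?thesis by (simp add: pos_le_divide_eq add_pos_nonneg)
  qed
  moreover have "0 \<le> 2 ^ N * (A + B)"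
    using order_trans[OF norm_ge_zero A] order_trans[OF norm_ge_zero B] by auto
  ultimately show ?thesis by blast
qed

lemma schwartz_iter_partial: "schwartz f \<Longrightarrow> schwartz (iter_partial js f)"
proof -
  have "iter_partial ks (iter_partial js f) = iter_partial (ks @ js) f" for ks
    by (simp add: iter_partial_def)
  then show "schwartz f \<Longrightarrow> schwartz (iter_partial js f)"
    by (simp add: schwartz_def smooth_fun_iter_partial)
qed

lemma schwartz_measurable: "schwartz f \<Longrightarrow> f \<in> borel_measurable borel"
  by (intro borel_measurable_continuous_onI smooth_fun_continuous) (simp add: schwartz_def)

lemma schwartz_integrable:
  assumes "schwartz (f :: real^'n \<Rightarrow> complex)"
  shows "integrable lborel f"
proof -
  obtain C where "\<And>x. norm (iter_partial [] f x) \<le> C / (1 + norm x) ^ (DIM(real^'n) + 1)"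
    using schwartz_decay[OF assms] by blast
  then show ?thesis
    by (intro integrable_real_bound[OF integrable_mult_right[OF integrable_inverse_power, of C]])
      (auto simp: schwartz_measurable[OF assms])
qed

lemma ft_partial_deriv:
  assumes f: "schwartz f"
  shows "ft (partial_deriv j f) \<xi> = (2 * pi * (\<xi> $ j)) *\<^sub>R (\<i> * ft f \<xi>)"
proof -
  let ?n = "DIM(real^'a) + 1"
  have s: "schwartz (partial_deriv j f)" using schwartz_iter_partial[OF f, of "[j]"] by simp
  obtain A where A: "0 \<le> A" "\<And>x. norm (iter_partial [] f x) \<le> A / (1 + norm x) ^ ?n"
    using schwartz_decay[OF f] by blast
  obtain B where B: "0 \<le> B" "\<And>x. norm (iter_partial [j] f x) \<le> B / (1 + norm x) ^ ?n"
    using schwartz_decay[OF f] by blast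
  have "A / (1 + norm x) ^ ?n \<le> (A + B) / (1 + norm x) ^ ?n" "B / (1 + norm x) ^ ?n \<le> (A + B) / (1 + norm x) ^ ?n"
    for x :: "real^'a" using A(1) B(1) by (auto intro!: divide_right_mono)
  then have "norm (f x) \<le> (A + B) / (1 + norm x) ^ ?n" "norm (partial_deriv j f x) \<le> (A + B) / (1 + norm x) ^ ?n" for x
    using A(2)[of x] B(2)[of x] by (auto intro: order_trans)
  from ft_derivative[OF smooth_fun_line _ _ this] f s
  have "ft (partial_deriv j f) \<xi> = (2 * pi * (axis j 1 \<bullet> \<xi>)) *\<^sub>R (\<i> * ft f \<xi>)"
    by (auto simp: schwartz_measurable schwartz_def)
  then show ?thesis by (simp add: inner_axis')
qed

text \<open>The coordinate of \<open>\<xi>\<close> of largest modulus controls |\<xi>| up to the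
  dimension, so pure derivatives of order N in that one coordinate suffice. Summing over all
  coordinates makes the constant independent of the choice.\<close>

lemma ft_schwartz_decay:
  assumes f: "schwartz (f :: real^'n \<Rightarrow> complex)"
  shows "\<exists>C\<ge>0. \<forall>\<xi>. norm (ft f \<xi>) \<le> C / (1 + norm \<xi>) ^ N"
proof -
  let ?n = "real CARD('n)"
  have it: "norm (ft (iter_partial (replicate m j) f) \<xi>) = (2 * pi * \<bar>\<xi> $ j\<bar>) ^ m * norm (ft f \<xi>)" for m j \<xi>
  proof (induction m)
    case (Suc m)
    then show ?case
      using ft_partial_deriv[OF schwartz_iter_partial[OF f, of "replicate m j"], of j \<xi>]
      by (simp add: norm_mult abs_mult)
  qed simp
  define I where "I j m = (LINT x|lborel. norm (iter_partial (replicate m j) f x))" for j m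
  have I: "(2 * pi * \<bar>\<xi> $ j\<bar>) ^ m * norm (ft f \<xi>) \<le> I j m" for m j \<xi>
    unfolding it[symmetric] I_def by (rule norm_ft_le)
  have I0: "0 \<le> I j m" for j m unfolding I_def by simp
  \<comment> \<open>\<open>j0\<close> only ever occurs with order 0, where the list of derivatives
    is empty and the index is immaterial.\<close>
  define j0 :: 'n where "j0 = undefined"
  define C where "C = 2 ^ N * (I j0 0 + ?n ^ N * (\<Sum>j\<in>UNIV. I j N))"
  have C0: "0 \<le> C" unfolding C_def by (intro mult_nonneg_nonneg add_nonneg_nonneg sum_nonneg I0) auto
  have "norm (ft f \<xi>) \<le> C / (1 + norm \<xi>) ^ N" for \<xi>
  proof -
    have "Max (range (\<lambda>j. \<bar>\<xi> $ j\<bar>)) \<in> range (\<lambda>j. \<bar>\<xi> $ j\<bar>)" by (rule Max_in) auto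
    then obtain j where "Max (range (\<lambda>j. \<bar>\<xi> $ j\<bar>)) = \<bar>\<xi> $ j\<bar>" by blast
    moreover have "\<bar>\<xi> $ i\<bar> \<le> Max (range (\<lambda>j. \<bar>\<xi> $ j\<bar>))" for i by (rule Max_ge) auto
    ultimately have j: "\<bar>\<xi> $ i\<bar> \<le> \<bar>\<xi> $ j\<bar>" for i by simp
    have "norm \<xi> \<le> (\<Sum>i\<in>UNIV. \<bar>\<xi> $ i\<bar>)" by (rule norm_le_l1_cart)
    also have "\<dots> \<le> ?n * \<bar>\<xi> $ j\<bar>" using sum_bounded_above[of UNIV "\<lambda>i. \<bar>\<xi> $ i\<bar>" "\<bar>\<xi> $ j\<bar>"] j by simp
    also have "\<dots> \<le> ?n * (2 * pi * \<bar>\<xi> $ j\<bar>)"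
    proof (intro mult_left_mono)
      have "1 * \<bar>\<xi> $ j\<bar> \<le> 2 * pi * \<bar>\<xi> $ j\<bar>" using pi_ge_two by (intro mult_right_mono) auto
      then show "\<bar>\<xi> $ j\<bar> \<le> 2 * pi * \<bar>\<xi> $ j\<bar>" by simp
    qed simp
    finally have "norm \<xi> ^ N \<le> (?n * (2 * pi * \<bar>\<xi> $ j\<bar>)) ^ N" by (rule power_mono) simp
    then have "norm \<xi> ^ N * norm (ft f \<xi>) \<le> (?n * (2 * pi * \<bar>\<xi> $ j\<bar>)) ^ N * norm (ft f \<xi>)"
      by (rule mult_right_mono) simp
    also have "\<dots> = ?n ^ N * ((2 * pi * \<bar>\<xi> $ j\<bar>) ^ N * norm (ft f \<xi>))" by (simp only: power_mult_distrib mult.assoc)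
    also have "\<dots> \<le> ?n ^ N * (\<Sum>j\<in>UNIV. I j N)"
    proof (rule mult_left_mono)
      have "I j N \<le> (\<Sum>j\<in>UNIV. I j N)" by (rule member_le_sum) (auto simp: I0)
      then show "(2 * pi * \<bar>\<xi> $ j\<bar>) ^ N * norm (ft f \<xi>) \<le> (\<Sum>j\<in>UNIV. I j N)" by (rule order_trans[OF I])
    qed simp
    finally have 1: "norm \<xi> ^ N * norm (ft f \<xi>) \<le> ?n ^ N * (\<Sum>j\<in>UNIV. I j N)" .
    have 2: "norm (ft f \<xi>) \<le> I j0 0" using I[of \<xi> j0 0] by simp
    have "(1 + norm \<xi>) ^ N \<le> (2 * max 1 (norm \<xi>)) ^ N" by (intro power_mono) auto
    also have "\<dots> \<le> 2 ^ N * (1 + norm \<xi> ^ N)" by (auto simp: power_mult_distrib max_def)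
    finally have "(1 + norm \<xi>) ^ N * norm (ft f \<xi>) \<le> 2 ^ N * (1 + norm \<xi> ^ N) * norm (ft f \<xi>)"
      by (rule mult_right_mono) simp
    also have "\<dots> = 2 ^ N * (norm (ft f \<xi>) + norm \<xi> ^ N * norm (ft f \<xi>))" by (simp add: algebra_simps)
    also have "\<dots> \<le> C" unfolding C_def using 1 2 by (intro mult_left_mono add_mono) auto
    finally show ?thesis by (simp add: pos_le_divide_eq add_pos_nonneg mult.commute)
  qed
  then show ?thesis using C0 by blast
qed

text \<open>This absorbs the growth of the symbol, which is linear for \<open>sym\<close> and
  quadratic for \<open>psi\<close>.\<close>

lemma schwartz_ft_integrable_weight:
  fixes f :: "real^'n \<Rightarrow> complex"
  assumes f: "schwartz f" and [measurable]: "w \<in> borel_measurable borel"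
    and w: "\<And>\<xi>. \<bar>w \<xi>\<bar> \<le> A * (1 + norm \<xi>) ^ N"
  shows "integrable lborel (\<lambda>\<xi>. w \<xi> *\<^sub>R ft f \<xi>)"
proof -
  let ?n = "DIM(real^'n) + 1"
  obtain C where C: "0 \<le> C" "\<And>\<xi>. norm (ft f \<xi>) \<le> C / (1 + norm \<xi>) ^ (N + ?n)"
    using ft_schwartz_decay[OF f] by blast
  have [measurable]: "ft f \<in> borel_measurable borel" by (intro ft_measurable schwartz_integrable f)
  show ?thesis
  proof (rule integrable_real_bound[OF integrable_mult_right[OF integrable_inverse_power, of "A * C"]])
    fix \<xi> :: "real^'n"
    have "0 \<le> A * (1 + norm \<xi>) ^ N" using order_trans[OF abs_ge_zero w[of \<xi>]] .
    then have "norm (w \<xi> *\<^sub>R ft f \<xi>) \<le> (A * (1 + norm \<xi>) ^ N) * (C / (1 + norm \<xi>) ^ (N + ?n))"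
      unfolding norm_scaleR using C(2) by (intro mult_mono w) auto
    also have "\<dots> = A * C * (1 / (1 + norm \<xi>) ^ ?n)"
    proof -
      have "(1 + norm \<xi>) ^ N \<noteq> 0" by (simp add: add_nonneg_eq_0_iff)
      then show ?thesis unfolding power_add by (simp add: divide_simps)
    qed
    finally show "norm (w \<xi> *\<^sub>R ft f \<xi>) \<le> A * C * (1 / (1 + norm \<xi>) ^ ?n)" .
  qed measurable
qed

lemma partial_deriv_zero_open:
  assumes "open U" "\<And>x. x \<in> U \<Longrightarrow> f x = 0" "x \<in> U"
  shows "partial_deriv j f x = 0"
proof -
  have "((\<lambda>x. 0) has_derivative (\<lambda>h. 0)) (at x)" by simp
  then have "(f has_derivative (\<lambda>h. 0)) (at x)"
    by (rule has_derivative_transform_within_open) (use assms in auto)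
  then show ?thesis by (rule partial_deriv_eq)
qed

lemma schwartz_compact_support:
  assumes s: "smooth_fun f" and z: "\<And>x. R < norm x \<Longrightarrow> f x = 0"
  shows "schwartz f"
  unfolding schwartz_def
proof (intro conjI allI)
  fix js k
  have zero: "iter_partial js f x = 0" if "R < norm x" for x
    using that
  proof (induction js arbitrary: x)
    case (Cons j js)
    have "open {x. R < norm x}" by (intro open_Collect_less continuous_intros)
    then show ?case using Cons by (auto intro: partial_deriv_zero_open)
  qed (use z in simp)
  have "continuous_on (cball 0 R) (\<lambda>x. norm x ^ k *\<^sub>R iter_partial js f x)"
    by (intro continuous_intros continuous_on_subset[OF smooth_fun_continuous[OF smooth_fun_iter_partial[OF s]]]) auto
  then have "bounded ((\<lambda>x. norm x ^ k *\<^sub>R iter_partial js f x) ` cball 0 R)"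
    by (intro compact_imp_bounded compact_continuous_image) auto
  then have "bounded (insert 0 ((\<lambda>x. norm x ^ k *\<^sub>R iter_partial js f x) ` cball 0 R))" by simp
  moreover have "range (\<lambda>x. norm x ^ k *\<^sub>R iter_partial js f x) \<subseteq> insert 0 ((\<lambda>x. norm x ^ k *\<^sub>R iter_partial js f x) ` cball 0 R)"
  proof
    fix y assume "y \<in> range (\<lambda>x. norm x ^ k *\<^sub>R iter_partial js f x)"
    then obtain x where "y = norm x ^ k *\<^sub>R iter_partial js f x" by auto
    then show "y \<in> insert 0 ((\<lambda>x. norm x ^ k *\<^sub>R iter_partial js f x) ` cball 0 R)"
      using zero[of x] by (cases "norm x \<le> R") auto
  qed
  ultimately show "bounded (range (\<lambda>x. norm x ^ k *\<^sub>R iter_partial js f x))" by (rule bounded_subset)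
qed (rule s)

lemma test_fun_schwartz:
  assumes "test_fun_off_zero \<phi>"
  shows "schwartz \<phi>"
proof -
  have "bounded (closure {x. \<phi> x \<noteq> 0})" using assms by (auto simp: test_fun_off_zero_def intro: compact_imp_bounded)
  then obtain R where "\<And>x. x \<in> closure {x. \<phi> x \<noteq> 0} \<Longrightarrow> norm x \<le> R" by (auto simp: bounded_iff)
  then have "\<phi> x = 0" if "R < norm x" for x
    using that closure_subset[of "{x. \<phi> x \<noteq> 0}"] by (metis (mono_tags) leD mem_Collect_eq subsetD)
  then show ?thesis using assms by (intro schwartz_compact_support) (auto simp: test_fun_off_zero_def)
qed

lemma test_fun_zero_near:
  assumes "test_fun_off_zero \<phi>"
  shows "\<exists>r>0. \<forall>x. norm x < r \<longrightarrow> \<phi> x = 0"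
proof -
  have "open (- closure {x. \<phi> x \<noteq> 0})" "0 \<in> - closure {x. \<phi> x \<noteq> 0}"
    using assms by (auto simp: test_fun_off_zero_def)
  then obtain r where "r > 0" "ball 0 r \<subseteq> - closure {x. \<phi> x \<noteq> 0}" by (auto simp: open_contains_ball)
  moreover have "\<phi> x = 0" if "x \<in> - closure {x. \<phi> x \<noteq> 0}" for x
    using that closure_subset[of "{x. \<phi> x \<noteq> 0}"] by auto
  ultimately show ?thesis by (metis mem_ball_0 subsetD)
qed

text \<open>Testing with \<open>\<phi>\<close> times a coordinate gives access to
  \<open>\<xi> $ j\<close> times the transform of the potential, the only combination that the
  symbol contains.\<close>

lemma test_fun_coordinate_mult:
  assumes "test_fun_off_zero \<phi>"
  shows "test_fun_off_zero (\<lambda>x. of_real (x $ j) * \<phi> x)"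
proof -
  have "closure {x. of_real (x $ j) * \<phi> x \<noteq> 0} \<subseteq> closure {x. \<phi> x \<noteq> 0}" by (intro closure_mono) auto
  moreover have "compact (closure {x. of_real (x $ j) * \<phi> x \<noteq> 0})"
  proof -
    have "bounded {x. \<phi> x \<noteq> 0}" using assms by (simp add: test_fun_off_zero_def)
    then have "bounded {x. of_real (x $ j) * \<phi> x \<noteq> 0}" by (rule bounded_subset) auto
    then show ?thesis by simp
  qed
  ultimately show ?thesis
    using assms by (auto simp: test_fun_off_zero_def intro: smooth_fun_mult smooth_fun_coordinate)
qed

subsection \<open>A mollifier\<close>

text \<open>The powers of 1/t close the family of the usual flat function exp(-1/t) under
  differentiation, so that its smoothness becomes a statement about a generated algebra.\<close>

definition flat :: "nat \<Rightarrow> real \<Rightarrow> real" where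
  "flat m t = (if 0 < t then (1 / t) ^ m * exp (- (1 / t)) else 0)"

lemma flat_nonneg: "0 \<le> flat m t" by (simp add: flat_def)

lemma flat_le: "flat m t \<le> fact (m + 2) * t\<^sup>2"
proof (cases "0 < t")
  case True
  have "(1 / t) ^ (m + 2) * exp (- (1 / t)) \<le> fact (m + 2) * exp (1 / t) * exp (- (1 / t))"
    using True by (intro mult_right_mono power_le_fact_exp) auto
  also have "\<dots> = fact (m + 2)" by (simp add: exp_minus)
  finally have "(1 / t) ^ (m + 2) * exp (- (1 / t)) * t\<^sup>2 \<le> fact (m + 2) * t\<^sup>2"
    by (rule mult_right_mono) simp
  moreover have "flat m t = (1 / t) ^ (m + 2) * exp (- (1 / t)) * t\<^sup>2"
    using True by (simp add: flat_def power_add power2_eq_square)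
  ultimately show ?thesis by metis
qed (simp add: flat_def)

text \<open>Only t = 0 needs an argument. By \<open>flat_le\<close>, which keeps the term of order m
  + 2 of the exponential series, the difference quotient there is at most a constant times
  |h|.\<close>

lemma DERIV_flat: "(flat m has_real_derivative flat (m + 2) t - real m * flat (m + 1) t) (at t)"
proof -
  consider "0 < t" | "t < 0" | "t = 0" by linarith
  then show ?thesis
  proof cases
    case 1
    have "((\<lambda>t. (1 / t) ^ m * exp (- (1 / t))) has_real_derivative flat (m + 2) t - real m * flat (m + 1) t) (at t)"
    proof -
      have d: "((\<lambda>t. 1 / t) has_real_derivative - ((1 / t)\<^sup>2)) (at t)"
        using 1 by (auto intro!: derivative_eq_intros simp: power2_eq_square)
      have p: "((\<lambda>t. (1 / t) ^ m) has_real_derivative - real m * (1 / t) ^ (m + 1)) (at t)"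
      proof -
        have "real m * (- ((1 / t)\<^sup>2) * (1 / t) ^ (m - Suc 0)) = - real m * (1 / t) ^ (m + 1)"
          using 1 by (cases m) (simp_all add: power2_eq_square power_divide field_simps)
        then show ?thesis using DERIV_power[OF d, of m] by metis
      qed
      have e: "((\<lambda>t. exp (- (1 / t))) has_real_derivative exp (- (1 / t)) * (1 / t)\<^sup>2) (at t)"
        by (rule DERIV_fun_exp[OF DERIV_minus[OF d], simplified])
      show ?thesis using DERIV_mult[OF p e] 1 by (simp add: flat_def power2_eq_square algebra_simps)
    qed
    then show ?thesis
      by (rule has_field_derivative_transform_within_open[where S="{0<..}"]) (use 1 in \<open>auto simp: flat_def\<close>)
  next
    case 2
    have "((\<lambda>t. 0) has_real_derivative flat (m + 2) t - real m * flat (m + 1) t) (at t)"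
      using 2 by (simp add: flat_def)
    then show ?thesis
      by (rule has_field_derivative_transform_within_open[where S="{..<0}"]) (use 2 in \<open>auto simp: flat_def\<close>)
  next
    case 3
    have "((\<lambda>h. flat m h / h) \<longlongrightarrow> 0) (at 0)"
    proof (rule Lim_null_comparison[where g="\<lambda>h. fact (m + 2) * \<bar>h\<bar>"])
      have "norm (flat m h / h) \<le> fact (m + 2) * \<bar>h\<bar>" if "h \<noteq> 0" for h
      proof -
        have "\<bar>flat m h\<bar> \<le> fact (m + 2) * h\<^sup>2" using flat_le flat_nonneg by simp
        also have "h\<^sup>2 = \<bar>h\<bar> * \<bar>h\<bar>" by (simp add: power2_eq_square)
        finally show ?thesis using that by (simp add: abs_divide divide_le_eq mult.assoc)
      qed
      then show "\<forall>\<^sub>F h in at 0. norm (flat m h / h) \<le> fact (m + 2) * \<bar>h\<bar>"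
        by (auto simp: eventually_at_filter)
      show "((\<lambda>h::real. fact (m + 2) * \<bar>h\<bar>) \<longlongrightarrow> 0) (at 0)" by (auto intro!: tendsto_eq_intros)
    qed
    moreover have "flat k 0 = 0" for k by (simp add: flat_def)
    ultimately show ?thesis using 3 by (simp add: DERIV_def)
  qed
qed

lemma flat_continuous: "continuous_on UNIV (flat m)"
  using DERIV_flat by (meson DERIV_isCont continuous_at_imp_continuous_on)

text \<open>The generators are all \<open>flat m\<close> composed with the quadratic, together with
  the coordinates that appear as inner derivatives. Centre and dilation are kept general so that
  every translated and rescaled mollifier is an instance.\<close>

lemma smooth_fun_flat_ball:
  fixes c :: "real^'n"
  shows "smooth_fun (\<lambda>y. complex_of_real (flat m (1 - a * (norm (y - c))\<^sup>2)))"
proof -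
  define \<tau> where "\<tau> y = 1 - a * (norm (y - c))\<^sup>2" for y
  define B where "B = range (\<lambda>m y. complex_of_real (flat m (\<tau> y))) \<union> range (\<lambda>i y. complex_of_real (y $ i))"
  have d: "((\<lambda>y. complex_of_real (flat m (\<tau> y))) has_derivative
      (\<lambda>h. of_real ((flat (m + 2) (\<tau> y) - real m * flat (m + 1) (\<tau> y)) * (- (2 * a) * ((y - c) \<bullet> h))))) (at y)" for m y
  proof -
    have "(\<tau> has_derivative (\<lambda>h. - (2 * a) * ((y - c) \<bullet> h))) (at y)"
      unfolding \<tau>_def power2_norm_eq_inner
      by (auto intro!: derivative_eq_intros simp: inner_commute algebra_simps)
    from has_derivative_compose[OF this, of "flat m", OF DERIV_flat[unfolded has_field_derivative_def]]
    show ?thesis by (rule bounded_linear.has_derivative[OF bounded_linear_of_real])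
  qed
  show ?thesis
  proof (rule smooth_fun_alg[where B=B])
    fix b j assume "b \<in> B"
    then consider m where "b = (\<lambda>y. complex_of_real (flat m (\<tau> y)))" | i where "b = (\<lambda>y. complex_of_real (y $ i))"
      by (auto simp: B_def)
    then show "partial_deriv j b \<in> fun_alg B"
    proof cases
      case 1
      have f: "(\<lambda>y. complex_of_real (flat m (\<tau> y))) \<in> fun_alg B" for m by (rule fun_alg.gen) (auto simp: B_def)
      have x: "(\<lambda>y. complex_of_real (y $ j)) \<in> fun_alg B" by (rule fun_alg.gen) (auto simp: B_def)
      have "(\<lambda>y. (of_real (flat (m + 2) (\<tau> y)) + (- of_nat m) * of_real (flat (m + 1) (\<tau> y)))
          * (- of_real (2 * a) * (of_real (y $ j) + (- of_real (c $ j))))) \<in> fun_alg B"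
        by (intro fun_alg.add fun_alg.mult fun_alg.const f x)
      moreover have "partial_deriv j b = (\<lambda>y. (of_real (flat (m + 2) (\<tau> y)) + (- of_nat m) * of_real (flat (m + 1) (\<tau> y)))
          * (- of_real (2 * a) * (of_real (y $ j) + (- of_real (c $ j)))))"
        unfolding 1 by (rule ext, subst partial_deriv_eq[OF d]) (simp add: inner_axis)
      ultimately show ?thesis by simp
    qed (auto simp: partial_deriv_coordinate intro: fun_alg.const)
  next
    fix b y assume "b \<in> B"
    then show "b differentiable (at y)"
      unfolding B_def using differentiableI[OF d] differentiableI[OF has_derivative_coordinate] by auto
  qed (auto simp: B_def \<tau>_def intro!: fun_alg.gen)
qed

definition bump :: "real^'n \<Rightarrow> real" where
  "bump x = flat 0 (1 - (norm x)\<^sup>2) / (LINT y|lborel. flat 0 (1 - (norm (y::real^'n))\<^sup>2))"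

definition moll :: "real \<Rightarrow> real^'n \<Rightarrow> real" where
  "moll d x = bump (x /\<^sub>R d) / d ^ CARD('n)"

lemma flat_ball_continuous: "continuous_on UNIV (\<lambda>x::'a::euclidean_space. flat 0 (1 - (norm x)\<^sup>2))"
  by (intro continuous_on_compose2[OF flat_continuous] continuous_intros) auto

lemma flat_ball_zero: "1 \<le> norm x \<Longrightarrow> flat 0 (1 - (norm x)\<^sup>2) = 0"
  unfolding flat_def by (rule if_not_P) (use one_le_power[of "norm x" 2] in linarith)

lemma integrable_flat_ball: "integrable lborel (\<lambda>x::'a::euclidean_space. flat 0 (1 - (norm x)\<^sup>2))"
proof -
  have "integrable lborel (\<lambda>x. indicator (cball (0::'a) 1) x *\<^sub>R flat 0 (1 - (norm x)\<^sup>2))"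
    by (intro borel_integrable_compact continuous_on_subset[OF flat_ball_continuous]) auto
  moreover have "indicator (cball (0::'a) 1) x *\<^sub>R flat 0 (1 - (norm x)\<^sup>2) = flat 0 (1 - (norm x)\<^sup>2)" for x
    using flat_ball_zero[of x] by (auto split: split_indicator)
  ultimately show ?thesis by (simp only:)
qed

lemma integral_flat_ball_pos: "0 < (LINT y|lborel. flat 0 (1 - (norm (y::'a::euclidean_space))\<^sup>2))"
proof -
  have "(LINT y|lborel. flat 0 (1 - (norm (y::'a))\<^sup>2)) \<noteq> 0"
  proof
    assume "(LINT y|lborel. flat 0 (1 - (norm (y::'a))\<^sup>2)) = 0"
    then have "AE y in lborel. flat 0 (1 - (norm (y::'a))\<^sup>2) = 0"
      by (subst (asm) integral_nonneg_eq_0_iff_AE) (auto simp: flat_nonneg integrable_flat_ball)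
    then have "AE y in lborel. y \<notin> ball (0::'a) 1"
    proof eventually_elim
      case (elim y)
      then show ?case using power_strict_mono[of "norm y" 1 2] by (auto simp: flat_def split: if_splits)
    qed
    then have "ball (0::'a) 1 \<in> null_sets lborel" by (subst AE_iff_null_sets) auto
    then have "emeasure lborel (ball (0::'a) 1) = 0" by auto
    then show False using unit_ball_vol_pos[of "real DIM('a)"] by (simp add: emeasure_ball)
  qed
  moreover have "0 \<le> (LINT y|lborel. flat 0 (1 - (norm (y::'a))\<^sup>2))" by (simp add: flat_nonneg)
  ultimately show ?thesis by simp
qed

lemma bump_nonneg [simp]: "0 \<le> bump x"
  using integral_flat_ball_pos[where 'a="real^'a"] by (simp add: bump_def flat_nonneg)

lemma bump_zero: "1 \<le> norm x \<Longrightarrow> bump x = 0"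
  by (simp add: bump_def flat_ball_zero)

lemma bump_minus [simp]: "bump (- x) = bump x" by (simp add: bump_def)

lemma bump_continuous: "continuous_on UNIV bump"
  unfolding bump_def using integral_flat_ball_pos[where 'a="real^'a"]
  by (intro continuous_intros flat_ball_continuous) auto

lemma bump_measurable [measurable]: "bump \<in> borel_measurable borel"
  by (intro borel_measurable_continuous_onI bump_continuous)

lemma integrable_bump: "integrable lborel bump"
  unfolding bump_def by (intro integrable_divide integrable_flat_ball)

lemma integral_bump: "(LINT x|lborel. bump (x :: real^'n)) = 1"
  using integral_flat_ball_pos[where 'a="real^'n"] unfolding bump_def by simp

lemma moll_nonneg [simp]: "0 < d \<Longrightarrow> 0 \<le> moll d x"
  by (simp add: moll_def)

lemma moll_zero: "0 < d \<Longrightarrow> d \<le> norm x \<Longrightarrow> moll d x = 0"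
proof -
  assume "0 < d" "d \<le> norm x"
  then have "1 \<le> norm (x /\<^sub>R d)" by (simp add: field_simps)
  then show ?thesis by (simp add: moll_def bump_zero)
qed

lemma moll_measurable [measurable]: "moll d \<in> borel_measurable borel"
  unfolding moll_def by measurable

lemma moll_minus [simp]: "moll d (- x) = moll d x" by (simp add: moll_def)

lemma smooth_fun_cmult: "smooth_fun f \<Longrightarrow> smooth_fun (\<lambda>x. c * f x)"
  by (rule smooth_fun_mult[OF smooth_fun_const])

lemma smooth_fun_moll: "smooth_fun (\<lambda>y. complex_of_real (moll d (h - y)))"
proof -
  define c where "c = 1 / (d ^ CARD('a) * (LINT y|lborel. flat 0 (1 - (norm (y::real^'a))\<^sup>2)))"
  have "(norm ((h - y) /\<^sub>R d))\<^sup>2 = (inverse d)\<^sup>2 * (norm (y - h))\<^sup>2" for y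
    by (simp only: norm_scaleR power_mult_distrib power2_abs norm_minus_commute)
  then have "moll d (h - y) = c * flat 0 (1 - (inverse d)\<^sup>2 * (norm (y - h))\<^sup>2)" for y
    by (simp add: moll_def bump_def c_def mult.commute)
  then show ?thesis
    using smooth_fun_cmult[OF smooth_fun_flat_ball, of "of_real c" 0 "(inverse d)\<^sup>2" h] by simp
qed

lemma test_fun_moll:
  assumes "0 < d" "d < norm h"
  shows "test_fun_off_zero (\<lambda>y. complex_of_real (moll d (h - y)))"
proof -
  have "{y. complex_of_real (moll d (h - y)) \<noteq> 0} \<subseteq> cball h d"
    using moll_zero[OF \<open>0 < d\<close>] by (force simp: dist_norm)
  then have c: "closure {y. complex_of_real (moll d (h - y)) \<noteq> 0} \<subseteq> cball h d"
    by (rule closure_minimal) simp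
  then have "compact (closure {y. complex_of_real (moll d (h - y)) \<noteq> 0})"
    by (meson bounded_cball bounded_subset closed_closure compact_eq_bounded_closed)
  moreover have "0 \<notin> cball h d" using assms by simp
  ultimately show ?thesis using c smooth_fun_moll unfolding test_fun_off_zero_def by blast
qed

lemma integrable_moll: "0 < d \<Longrightarrow> integrable lborel (moll d)"
proof -
  assume d: "0 < d"
  have "integrable lborel (\<lambda>x. bump (0 + inverse d *\<^sub>R x))"
    by (subst lborel_integrable_affine) (use d integrable_bump in auto)
  then have "integrable lborel (\<lambda>x. bump (x /\<^sub>R d) / d ^ CARD('a))" by (intro integrable_divide) simp
  then show ?thesis unfolding moll_def .
qed

text \<open>The substitution y = h - d z; the scale is written \<open>- d\<close> to match
  \<open>approximate_identity\<close>.\<close>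

lemma moll_convolution:
  fixes F :: "real^'n \<Rightarrow> complex"
  assumes d: "0 < d" and [measurable]: "F \<in> borel_measurable borel"
  shows "(LINT y|lborel. F y * of_real (moll d (h - y))) = (LINT z|lborel. of_real (bump z) * F (h + (- d) *\<^sub>R z))"
proof -
  have "(LINT y|lborel. F y * of_real (moll d (h - y)))
      = \<bar>- d\<bar> ^ DIM(real^'n) *\<^sub>R (LINT z|lborel. F (h + (- d) *\<^sub>R z) * of_real (moll d (h - (h + (- d) *\<^sub>R z))))"
    by (rule lborel_integral_affine) (use d in auto)
  also have "\<dots> = (LINT z|lborel. of_real (bump z) * F (h + (- d) *\<^sub>R z))"
    unfolding integral_scaleR_right[symmetric]
  proof (rule Bochner_Integration.integral_cong[OF refl])
    fix z
    have "moll d (h - (h + (- d) *\<^sub>R z)) = bump z / d ^ CARD('n)" using d by (simp add: moll_def)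
    then show "\<bar>- d\<bar> ^ DIM(real^'n) *\<^sub>R (F (h + (- d) *\<^sub>R z) * of_real (moll d (h - (h + (- d) *\<^sub>R z))))
        = of_real (bump z) * F (h + (- d) *\<^sub>R z)"
      using d by (simp only: scaleR_conv_of_real[where 'a=complex]) simp
  qed
  finally show ?thesis .
qed

lemma ft_moll: "ft (\<lambda>x. of_real (moll d x)) \<xi> = ft (\<lambda>x. of_real (bump x)) (d *\<^sub>R \<xi>)" if d: "0 < d"
proof -
  have "ft (\<lambda>x. of_real (moll d x)) \<xi> = ft (\<lambda>x. (1 / of_real d ^ CARD('a)) * of_real (bump (inverse d *\<^sub>R x))) \<xi>"
    by (simp add: moll_def)
  also have "\<dots> = (1 / of_real d ^ CARD('a)) * ft (\<lambda>x. of_real (bump (inverse d *\<^sub>R x))) \<xi>"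
    by (rule ft_cmult)
  also have "ft (\<lambda>x. of_real (bump (inverse d *\<^sub>R x))) \<xi>
      = (1 / \<bar>inverse d\<bar> ^ DIM(real^'a)) *\<^sub>R ft (\<lambda>x. of_real (bump x)) (\<xi> /\<^sub>R inverse d)"
    by (rule ft_scale) (use d in auto)
  finally show ?thesis using d by (simp add: scaleR_conv_of_real power_inverse)
qed

lemma schwartz_bump: "schwartz (\<lambda>x. complex_of_real (bump x))"
proof (rule schwartz_compact_support)
  show "smooth_fun (\<lambda>x. complex_of_real (bump x))"
    using smooth_fun_moll[of 1 0] by (simp add: moll_def)
  show "complex_of_real (bump x) = 0" if "1 < norm x" for x using bump_zero[OF less_imp_le[OF that]] by simp
qed

lemma mollifier_tendsto:
  fixes F :: "real^'n \<Rightarrow> complex"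
  assumes [measurable]: "F \<in> borel_measurable borel" and F: "\<And>y. norm (F y) \<le> C" and "isCont F h"
    and X: "X \<longlonglongrightarrow> 0" "\<And>m. 0 < X m"
  shows "(\<lambda>m. LINT y|lborel. F y * of_real (moll (X m) (h - y))) \<longlonglongrightarrow> F h"
proof -
  have "(\<lambda>m. - X m) \<longlonglongrightarrow> 0" using tendsto_minus[OF X(1)] by simp
  then have "(\<lambda>m. LINT z|lborel. complex_of_real (bump z) * F (h + (- X m) *\<^sub>R z)) \<longlonglongrightarrow> (LINT z|lborel. complex_of_real (bump (z::real^'n))) * F h"
    by (intro approximate_identity[OF _ _ F \<open>isCont F h\<close>]) (use integrable_bump in auto)
  then show ?thesis using X(2) by (simp add: moll_convolution integral_bump)
qed

text \<open>Mollifiers centred at h of radius less than |h| are test functions off the origin and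
  concentrate at h. Since f may be unbounded near \<open>0\<close>, it is first cut off to the ball
  of radius |h|/2 around h.\<close>

lemma continuous_off_zero_eq_0:
  fixes f :: "real^'n \<Rightarrow> complex"
  assumes f: "continuous_on (- {0}) f"
    and z: "\<And>d h. 0 < d \<Longrightarrow> d < norm h \<Longrightarrow> (LINT y|lborel. f y * of_real (moll d (h - y))) = 0"
    and h: "h \<noteq> 0"
  shows "f h = 0"
proof -
  have [measurable]: "f \<in> borel_measurable borel"
    by (rule borel_measurable_continuous_countable_exceptions[OF _ f]) simp
  define r where "r = norm h / 2"
  have r: "0 < r" "r < norm h" using h by (auto simp: r_def)
  have 0: "0 \<notin> cball h r" using r by simp
  define F where "F y = indicator (cball h r) y *\<^sub>R f y" for y
  have [measurable]: "cball h r \<in> sets borel" by simp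
  have [measurable]: "F \<in> borel_measurable borel" unfolding F_def by measurable
  have "bounded (f ` cball h r)"
    by (intro compact_imp_bounded compact_continuous_image continuous_on_subset[OF f]) (use 0 in auto)
  then obtain C where C: "\<And>y. y \<in> cball h r \<Longrightarrow> norm (f y) \<le> C" unfolding bounded_iff by blast
  have C0: "0 \<le> C" using order_trans[OF norm_ge_zero C[of h]] r by auto
  have "isCont f h" using f h by (subst (asm) continuous_on_eq_continuous_at) auto
  moreover have "\<forall>\<^sub>F y in nhds h. F y = f y"
    using eventually_nhds_in_open[of "ball h r" h] r by (auto elim!: eventually_mono simp: F_def)
  ultimately have cont: "isCont F h" using isCont_cong by blast
  define X where "X m = r / real (Suc m)" for m
  have X: "X \<longlonglongrightarrow> 0" "0 < X m" "X m \<le> r" for m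
    unfolding X_def using LIMSEQ_Suc[OF lim_const_over_n[of r]] r by (auto simp: divide_le_eq)
  have "(\<lambda>m. LINT y|lborel. F y * of_real (moll (X m) (h - y))) \<longlonglongrightarrow> F h"
    by (rule mollifier_tendsto[OF _ _ cont X(1,2), of C]) (use C C0 in \<open>auto simp: F_def split: split_indicator\<close>)
  moreover have "(LINT y|lborel. F y * of_real (moll (X m) (h - y))) = 0" for m
  proof -
    have "F y * of_real (moll (X m) (h - y)) = f y * of_real (moll (X m) (h - y))" for y
      using moll_zero[OF X(2)[of m], of "h - y"] X(3)[of m] by (auto simp: F_def dist_norm split: split_indicator)
    then have "(LINT y|lborel. F y * of_real (moll (X m) (h - y))) = (LINT y|lborel. f y * of_real (moll (X m) (h - y)))"
      by (simp only:)
    also have "\<dots> = 0" by (rule z[OF X(2)]) (use X(3)[of m] r in linarith)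
    finally show ?thesis .
  qed
  ultimately have "F h = 0" by (simp add: LIMSEQ_const_iff)
  then show ?thesis using r by (simp add: F_def)
qed



section \<open>The symbol of a radial kernel\<close>

lemma abs_sin_le_min:
  fixes z \<xi> :: "'a::euclidean_space"
  shows "\<bar>sin (2 * pi * (z \<bullet> \<xi>))\<bar> \<le> (1 + 2 * pi * norm \<xi>) * min 1 (norm z)"
proof (cases "norm z \<le> 1")
  case True
  have "\<bar>sin (2 * pi * (z \<bullet> \<xi>))\<bar> \<le> 2 * pi * \<bar>z \<bullet> \<xi>\<bar>"
    using abs_sin_x_le_abs_x[of "2 * pi * (z \<bullet> \<xi>)"] by (simp add: abs_mult)
  also have "\<dots> \<le> 2 * pi * (norm z * norm \<xi>)" by (intro mult_left_mono Cauchy_Schwarz_ineq2) simp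
  also have "\<dots> \<le> (1 + 2 * pi * norm \<xi>) * norm z" by (simp add: algebra_simps)
  finally show ?thesis using True by simp
next
  case False
  have "\<bar>sin (2 * pi * (z \<bullet> \<xi>))\<bar> \<le> 1 + 2 * pi * norm \<xi>"
    by (rule order_trans[OF abs_sin_le_one]) simp
  then show ?thesis using False by simp
qed

lemma norm_1_minus_cis_le_min:
  fixes z \<xi> :: "'a::euclidean_space"
  shows "norm (1 - cis (- (2 * pi * (z \<bullet> \<xi>)))) \<le> (2 + 2 * pi * norm \<xi>) * min 1 (norm z)"
proof (cases "norm z \<le> 1")
  case True
  have "norm (1 - cis (- (2 * pi * (z \<bullet> \<xi>)))) \<le> 2 * pi * \<bar>z \<bullet> \<xi>\<bar>"
    using norm_cis_minus_1_le[of "- (2 * pi * (z \<bullet> \<xi>))"] by (simp add: abs_mult norm_minus_commute)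
  also have "\<dots> \<le> 2 * pi * (norm z * norm \<xi>)" by (intro mult_left_mono Cauchy_Schwarz_ineq2) simp
  also have "\<dots> \<le> (2 + 2 * pi * norm \<xi>) * norm z" by (simp add: algebra_simps)
  finally show ?thesis using True by simp
next
  case False
  have "norm (1 - cis (- (2 * pi * (z \<bullet> \<xi>)))) \<le> norm (1::complex) + norm (cis (- (2 * pi * (z \<bullet> \<xi>))))"
    by (rule norm_triangle_ineq4)
  also have "\<dots> \<le> 2 + 2 * pi * norm \<xi>" by simp
  finally show ?thesis using False by simp
qed

lemma integrable_complexI:
  fixes f :: "'a \<Rightarrow> complex"
  assumes "integrable M (\<lambda>x. Re (f x))" "integrable M (\<lambda>x. Im (f x))"
  shows "integrable M f"
proof -
  have "integrable M (\<lambda>x. of_real (Re (f x)) + \<i> * of_real (Im (f x)))"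
    using assms by (intro Bochner_Integration.integrable_add integrable_mult_right integrable_of_real)
  then show ?thesis by (simp flip: complex_eq)
qed

text \<open>The real version compares positive measures, so the complex one treats real and
  imaginary parts separately.\<close>

lemma radial_weight_transfer_complex:
  fixes h :: "'a::euclidean_space \<Rightarrow> complex" and A :: "real \<Rightarrow> complex" and a :: "real \<Rightarrow> real"
  assumes [measurable]: "h \<in> borel_measurable borel" "A \<in> borel_measurable borel" "a \<in> borel_measurable borel"
    and bh: "\<And>x. norm (h x) \<le> C * min 1 (norm x)"
    and bA: "\<And>t. 0 < t \<Longrightarrow> norm (A t) \<le> C * min 1 t * radial_density DIM('a) t"
    and eq: "\<And>t. 0 < t \<Longrightarrow> (LINT x|lborel. indicator {..t} (norm x) *\<^sub>R h x) = (LINT s|lborel. indicator {0..t} s *\<^sub>R A s)"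
    and inth: "\<And>t. integrable lborel (\<lambda>x. indicator {..t} (norm x) *\<^sub>R h x)"
    and intA: "\<And>t. 0 < t \<Longrightarrow> integrable lborel (\<lambda>s. indicator {0..t} s *\<^sub>R A s)"
    and a: "\<And>t. 0 \<le> a t" and int: "integrable lborel (\<lambda>x::'a. a (norm x) * min 1 (norm x))"
  shows "(LINT x|lborel. a (norm x) *\<^sub>R h x) = (LINT t|lborel. indicator {0<..} t *\<^sub>R (a t *\<^sub>R A t))"
proof -
  have re: "\<bar>Re (h x)\<bar> \<le> C * min 1 (norm x)" "\<bar>Im (h x)\<bar> \<le> C * min 1 (norm x)" for x
    using abs_Re_le_cmod[of "h x"] abs_Im_le_cmod[of "h x"] bh[of x] by linarith+
  have rA: "\<bar>Re (A t)\<bar> \<le> C * min 1 t * radial_density DIM('a) t" "\<bar>Im (A t)\<bar> \<le> C * min 1 t * radial_density DIM('a) t"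
    if "0 < t" for t
    using abs_Re_le_cmod[of "A t"] abs_Im_le_cmod[of "A t"] bA[OF that] by linarith+
  have e: "(LINT x|lborel. indicator {..t} (norm x) * Re (h x)) = (LINT s|lborel. indicator {0..t} s * Re (A s))"
    "(LINT x|lborel. indicator {..t} (norm x) * Im (h x)) = (LINT s|lborel. indicator {0..t} s * Im (A s))" if "0 < t" for t
    using eq[OF that, THEN arg_cong[where f=Re]] eq[OF that, THEN arg_cong[where f=Im]]
      integral_Re[OF inth[of t]] integral_Im[OF inth[of t]] integral_Re[OF intA[OF that]] integral_Im[OF intA[OF that]] by simp_all
  note R = radial_weight_transfer[OF _ _ _ re(1) rA(1) e(1) a int]
  note I = radial_weight_transfer[OF _ _ _ re(2) rA(2) e(2) a int]
  have R': "integrable lborel (\<lambda>x. a (norm x) * Re (h x))" "integrable lborel (\<lambda>t. indicator {0<..} t * (a t * Re (A t)))"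
    "(LINT x|lborel. a (norm x) * Re (h x)) = (LINT t|lborel. indicator {0<..} t * (a t * Re (A t)))"
    by (rule R; simp)+
  have I': "integrable lborel (\<lambda>x. a (norm x) * Im (h x))" "integrable lborel (\<lambda>t. indicator {0<..} t * (a t * Im (A t)))"
    "(LINT x|lborel. a (norm x) * Im (h x)) = (LINT t|lborel. indicator {0<..} t * (a t * Im (A t)))"
    by (rule I; simp)+
  have "integrable lborel (\<lambda>x. a (norm x) *\<^sub>R h x)" "integrable lborel (\<lambda>t. indicator {0<..} t *\<^sub>R (a t *\<^sub>R A t))"
    using R' I' by (auto intro!: integrable_complexI simp: mult.assoc)
  then show ?thesis
    by (intro complex_eqI) (use R' I' in \<open>auto simp: mult.assoc simp flip: integral_Re integral_Im\<close>)
qed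

text \<open>A kernel that is Borel, nonnegative and radial at every point, so that Fubini and sign
  arguments involve no exceptional sets. The given kernel agrees with it almost everywhere.\<close>

locale radial_kernel =
  fixes b :: "real \<Rightarrow> real" and r :: "real^'n \<Rightarrow> real"
  assumes r_eq: "r x = b (norm x)"
    and b_measurable [measurable]: "b \<in> borel_measurable borel"
    and b_nonneg: "0 \<le> b t"
    and r_int: "integrable lborel (\<lambda>x. min 1 (1 / norm x) * r x)"
begin

lemma r_measurable [measurable]: "r \<in> borel_measurable borel"
  unfolding r_eq[abs_def] by measurable

lemma r_nonneg: "0 \<le> r x" by (simp add: r_eq b_nonneg)

lemma r_minus: "r (- x) = r x" by (simp add: r_eq)

text \<open>Off the origin this is min(1, 1/|z|) times the kernel, exactly the weight in the
  integrability hypothesis. In the present form it pairs with the bounds by min(1,|z|) for sines and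
  for differences of characters.\<close>

definition wt :: "real^'n \<Rightarrow> real" where "wt z = min 1 (norm z) * (r z / norm z)"

lemma wt_nonneg: "0 \<le> wt z" by (simp add: wt_def r_nonneg)

lemma wt_measurable [measurable]: "wt \<in> borel_measurable borel" unfolding wt_def by measurable

lemma wt_integrable: "integrable lborel wt"
proof (rule integrable_real_bound[OF r_int])
  fix z :: "real^'n"
  show "norm (wt z) \<le> min 1 (1 / norm z) * r z"
    using r_nonneg[of z] by (cases "z = 0") (auto simp: wt_def min_def divide_simps abs_mult)
qed measurable

text \<open>The kernel shared by the nonlocal gradient and the nonlocal divergence. It is odd and
  need not be integrable near the origin, so it is always paired with something that vanishes there
  to first order.\<close>

definition kern :: "'n \<Rightarrow> real^'n \<Rightarrow> real" where
  "kern j z = z $ j / norm z * (r z / norm z)"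

lemma kern_measurable [measurable]: "kern j \<in> borel_measurable borel"
  unfolding kern_def by measurable

lemma kern_minus: "kern j (- z) = - kern j z" by (simp add: kern_def r_minus)

lemma kern_abs_le: "\<bar>kern j z\<bar> \<le> r z / norm z"
proof -
  have "\<bar>z $ j / norm z\<bar> \<le> 1"
    using component_le_norm_cart[of z j] by (cases "z = 0") (auto simp: abs_divide divide_simps)
  then have "\<bar>z $ j / norm z\<bar> * (r z / norm z) \<le> 1 * (r z / norm z)"
    by (rule mult_right_mono) (simp add: r_nonneg)
  then show ?thesis using r_nonneg[of z] by (simp add: kern_def abs_mult)
qed

lemma kern_mult_bound: "\<bar>c\<bar> \<le> B * min 1 (norm z) \<Longrightarrow> \<bar>c\<bar> * \<bar>kern j z\<bar> \<le> B * wt z"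
proof -
  assume c: "\<bar>c\<bar> \<le> B * min 1 (norm z)"
  have "\<bar>c\<bar> * \<bar>kern j z\<bar> \<le> (B * min 1 (norm z)) * (r z / norm z)"
    using c kern_abs_le by (intro mult_mono) auto
  then show ?thesis by (simp add: wt_def mult.assoc)
qed

lemma integrable_kern_mult:
  fixes f :: "real^'n \<Rightarrow> 'b::{banach, second_countable_topology}"
  assumes [measurable]: "f \<in> borel_measurable borel" and f: "\<And>z. norm (f z) \<le> B * min 1 (norm z)"
  shows "integrable lborel (\<lambda>z. kern j z *\<^sub>R f z)"
proof (rule integrable_real_bound[OF integrable_mult_right[OF wt_integrable, of B]])
  show "norm (kern j z *\<^sub>R f z) \<le> B * wt z" for z
    using kern_mult_bound[of "norm (f z)" B z j] f[of z] by (simp add: mult.commute)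
qed measurable

definition sym :: "'n \<Rightarrow> real^'n \<Rightarrow> real" where
  "sym j \<xi> = (LINT z|lborel. kern j z * sin (2 * pi * (z \<bullet> \<xi>)))"

definition wt_mass :: real where "wt_mass = (LINT z|lborel. wt z)"

lemma wt_mass_nonneg: "0 \<le> wt_mass" unfolding wt_mass_def by (simp add: wt_nonneg)

lemma integrable_kern_sin: "integrable lborel (\<lambda>z. kern j z * sin (2 * pi * (z \<bullet> \<xi>)))"
  using integrable_kern_mult[of "\<lambda>z. sin (2 * pi * (z \<bullet> \<xi>))" "1 + 2 * pi * norm \<xi>" j] abs_sin_le_min[of _ \<xi>] by simp

lemma kern_sin_bound: "\<bar>kern j z * sin (2 * pi * (z \<bullet> \<xi>))\<bar> \<le> (1 + 2 * pi * norm \<xi>) * wt z"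
  using kern_mult_bound[OF abs_sin_le_min[of z \<xi>], of j] by (simp add: abs_mult mult.commute)

lemma sym_bound: "\<bar>sym j \<xi>\<bar> \<le> (1 + 2 * pi * norm \<xi>) * wt_mass"
proof -
  have "\<bar>sym j \<xi>\<bar> \<le> (LINT z|lborel. \<bar>kern j z * sin (2 * pi * (z \<bullet> \<xi>))\<bar>)"
    unfolding sym_def using integral_norm_bound[of lborel "\<lambda>z. kern j z * sin (2 * pi * (z \<bullet> \<xi>))"] by simp
  also have "\<dots> \<le> (LINT z|lborel. (1 + 2 * pi * norm \<xi>) * wt z)"
    by (intro integral_mono kern_sin_bound integrable_abs integrable_kern_sin integrable_mult_right wt_integrable)
  finally show ?thesis by (simp add: wt_mass_def)
qed

lemma sym_minus: "sym j (- \<xi>) = - sym j \<xi>"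
  unfolding sym_def by simp

lemma sym_0 [simp]: "sym j 0 = 0" by (simp add: sym_def)

lemma sym_continuous: "continuous_on UNIV (sym j)"
proof -
  have "(\<lambda>m. sym j (X m)) \<longlonglongrightarrow> sym j \<xi>" if X: "X \<longlonglongrightarrow> \<xi>" for X \<xi>
  proof -
    from X have "Bseq X" by (intro convergent_imp_Bseq) (auto simp: convergent_def)
    then obtain B where B: "\<And>m. norm (X m) \<le> B" by (auto simp: Bseq_def)
    show ?thesis unfolding sym_def
    proof (rule integral_dominated_convergence[where w="\<lambda>z. (1 + 2 * pi * B) * wt z"])
      show "AE z in lborel. norm (kern j z * sin (2 * pi * (z \<bullet> X m))) \<le> (1 + 2 * pi * B) * wt z" for m
      proof (rule AE_I2)
        fix z
        have "(1 + 2 * pi * norm (X m)) * wt z \<le> (1 + 2 * pi * B) * wt z"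
          using B[of m] by (intro mult_right_mono) (auto simp: wt_nonneg)
        then show "norm (kern j z * sin (2 * pi * (z \<bullet> X m))) \<le> (1 + 2 * pi * B) * wt z"
          using kern_sin_bound[of j z "X m"] by simp
      qed
    qed (auto intro!: tendsto_intros that integrable_mult_right wt_integrable)
  qed
  then show ?thesis
    by (auto simp: continuous_on_eq_continuous_at continuous_at_sequentially o_def)
qed

lemma sym_measurable [measurable]: "sym j \<in> borel_measurable borel"
  by (intro borel_measurable_continuous_onI sym_continuous)

text \<open>This says that \<open>sym\<close> is o(|\<xi>|). With d = \<open>X m\<close>, the
  integrand d sin(2 pi z.\<zeta>/d) \<open>kern j z\<close> is at most d |\<open>kern j z\<close>|,
  hence tends to 0 pointwise. The bound by \<open>wt\<close> has the factor d (1 + 2 pi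
  |\<zeta>|/d), which stays below 1 + 2 pi |\<zeta>| because d <= 1.\<close>

lemma sym_scaled_tendsto_0:
  assumes X: "X \<longlonglongrightarrow> 0" "\<And>m. 0 < X m" "\<And>m. X m \<le> 1"
  shows "(\<lambda>m. X m * sym j (\<zeta> /\<^sub>R X m)) \<longlonglongrightarrow> 0"
    and "\<bar>X m * sym j (\<zeta> /\<^sub>R X m)\<bar> \<le> (1 + 2 * pi * norm \<zeta>) * wt_mass"
proof -
  have le: "\<bar>X m\<bar> * (1 + 2 * pi * norm (\<zeta> /\<^sub>R X m)) \<le> 1 + 2 * pi * norm \<zeta>" for m
  proof -
    have "X m * norm (\<zeta> /\<^sub>R X m) = norm \<zeta>" using X(2)[of m] by simp
    then have "\<bar>X m\<bar> * (1 + 2 * pi * norm (\<zeta> /\<^sub>R X m)) = X m + 2 * pi * norm \<zeta>"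
      using X(2)[of m] by (simp only: distrib_left mult.left_commute[of "X m"] abs_of_pos mult_1_right mult.assoc)
    then show ?thesis using X(3)[of m] by simp
  qed
  have "(\<lambda>m. LINT z|lborel. X m * (kern j z * sin (2 * pi * (z \<bullet> (\<zeta> /\<^sub>R X m))))) \<longlonglongrightarrow> (LINT z|(lborel :: (real^'n) measure). 0)"
  proof (rule integral_dominated_convergence[where w="\<lambda>z. (1 + 2 * pi * norm \<zeta>) * wt z"])
    show "AE z in lborel. (\<lambda>m. X m * (kern j z * sin (2 * pi * (z \<bullet> (\<zeta> /\<^sub>R X m))))) \<longlonglongrightarrow> 0"
    proof (rule AE_I2, rule Lim_null_comparison)
      fix z
      show "\<forall>\<^sub>F m in sequentially. norm (X m * (kern j z * sin (2 * pi * (z \<bullet> (\<zeta> /\<^sub>R X m))))) \<le> X m * \<bar>kern j z\<bar>"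
        using X(2) by (intro always_eventually) (auto simp: abs_mult less_imp_le intro!: mult_left_mono mult_left_le)
      show "(\<lambda>m. X m * \<bar>kern j z\<bar>) \<longlonglongrightarrow> 0" using tendsto_mult_right[OF X(1), of "\<bar>kern j z\<bar>"] by simp
    qed
    show "AE z in lborel. norm (X m * (kern j z * sin (2 * pi * (z \<bullet> (\<zeta> /\<^sub>R X m))))) \<le> (1 + 2 * pi * norm \<zeta>) * wt z" for m
    proof (rule AE_I2)
      fix z
      have "norm (X m * (kern j z * sin (2 * pi * (z \<bullet> (\<zeta> /\<^sub>R X m))))) \<le> \<bar>X m\<bar> * ((1 + 2 * pi * norm (\<zeta> /\<^sub>R X m)) * wt z)"
        unfolding real_norm_def abs_mult[of "X m"] by (intro mult_left_mono kern_sin_bound abs_ge_zero)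
      also have "\<dots> \<le> (1 + 2 * pi * norm \<zeta>) * wt z"
        unfolding mult.assoc[symmetric] by (intro mult_right_mono le wt_nonneg)
      finally show "norm (X m * (kern j z * sin (2 * pi * (z \<bullet> (\<zeta> /\<^sub>R X m))))) \<le> (1 + 2 * pi * norm \<zeta>) * wt z" .
    qed
  qed (auto intro!: integrable_mult_right wt_integrable)
  then show "(\<lambda>m. X m * sym j (\<zeta> /\<^sub>R X m)) \<longlonglongrightarrow> 0" by (simp add: sym_def)
  have "\<bar>X m * sym j (\<zeta> /\<^sub>R X m)\<bar> \<le> \<bar>X m\<bar> * ((1 + 2 * pi * norm (\<zeta> /\<^sub>R X m)) * wt_mass)"
    unfolding abs_mult by (intro mult_left_mono sym_bound) simp
  also have "\<dots> \<le> (1 + 2 * pi * norm \<zeta>) * wt_mass"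
    unfolding mult.assoc[symmetric] by (intro mult_right_mono le wt_mass_nonneg)
  finally show "\<bar>X m * sym j (\<zeta> /\<^sub>R X m)\<bar> \<le> (1 + 2 * pi * norm \<zeta>) * wt_mass" .
qed

definition psi :: "real^'n \<Rightarrow> real" where "psi \<xi> = (\<Sum>j\<in>UNIV. (sym j \<xi>)\<^sup>2)"

lemma psi_nonneg: "0 \<le> psi \<xi>" unfolding psi_def by (intro sum_nonneg) simp

lemma psi_0 [simp]: "psi 0 = 0" by (simp add: psi_def)

lemma psi_minus [simp]: "psi (- \<xi>) = psi \<xi>" by (simp add: psi_def sym_minus)

lemma psi_continuous: "continuous_on UNIV psi"
  unfolding psi_def by (intro continuous_intros sym_continuous)

lemma psi_measurable [measurable]: "psi \<in> borel_measurable borel"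
  by (intro borel_measurable_continuous_onI psi_continuous)

lemma one_plus_two_pi_le: "1 + 2 * pi * norm \<xi> \<le> 2 * pi * (1 + norm \<xi>)"
  using pi_ge_two by (simp add: algebra_simps)

text \<open>Stated for an arbitrary family because \<open>sym\<close> and its rescalings d
  \<open>sym\<close>(\<zeta>/d) obey the same bound; it yields the growth of \<open>psi\<close> and
  the majorant for the rescaled \<open>psi\<close> at once.\<close>

lemma sum_squares_bound:
  assumes "\<And>j. \<bar>f j\<bar> \<le> (1 + 2 * pi * norm \<xi>) * wt_mass"
  shows "(\<Sum>j\<in>(UNIV::'n set). (f j)\<^sup>2) \<le> real CARD('n) * (2 * pi * wt_mass)\<^sup>2 * (1 + norm \<xi>)\<^sup>2"
proof -
  have "(f j)\<^sup>2 \<le> (2 * pi * wt_mass)\<^sup>2 * (1 + norm \<xi>)\<^sup>2" for j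
  proof -
    have "(1 + 2 * pi * norm \<xi>) * wt_mass \<le> 2 * pi * (1 + norm \<xi>) * wt_mass"
      by (intro mult_right_mono one_plus_two_pi_le wt_mass_nonneg)
    then have "\<bar>f j\<bar> \<le> 2 * pi * wt_mass * (1 + norm \<xi>)" using assms[of j] by (simp add: ac_simps)
    then have "\<bar>f j\<bar>\<^sup>2 \<le> (2 * pi * wt_mass * (1 + norm \<xi>))\<^sup>2" by (rule power_mono) simp
    then show ?thesis by (simp add: power_mult_distrib)
  qed
  then have "(\<Sum>j\<in>(UNIV::'n set). (f j)\<^sup>2) \<le> real CARD('n) * ((2 * pi * wt_mass)\<^sup>2 * (1 + norm \<xi>)\<^sup>2)"
    by (intro sum_bounded_above[of UNIV, simplified])
  then show ?thesis by (simp add: mult.assoc)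
qed

definition psi_const :: real where "psi_const = real CARD('n) * (2 * pi * wt_mass)\<^sup>2"

lemma psi_const_nonneg: "0 \<le> psi_const" by (simp add: psi_const_def)

lemma psi_bound: "psi \<xi> \<le> psi_const * (1 + norm \<xi>)\<^sup>2"
  unfolding psi_def psi_const_def by (rule sum_squares_bound[OF sym_bound])

lemma psi_scaled_tendsto_0:
  assumes X: "X \<longlonglongrightarrow> 0" "\<And>m. 0 < X m" "\<And>m. X m \<le> 1"
  shows "(\<lambda>m. (X m)\<^sup>2 * psi (\<zeta> /\<^sub>R X m)) \<longlonglongrightarrow> 0"
    and "(X m)\<^sup>2 * psi (\<zeta> /\<^sub>R X m) \<le> psi_const * (1 + norm \<zeta>)\<^sup>2"
proof -
  have e: "(X m)\<^sup>2 * psi (\<zeta> /\<^sub>R X m) = (\<Sum>j\<in>UNIV. (X m * sym j (\<zeta> /\<^sub>R X m))\<^sup>2)" for m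
    by (simp add: psi_def sum_distrib_left power_mult_distrib)
  have "(\<lambda>m. \<Sum>j\<in>UNIV. (X m * sym j (\<zeta> /\<^sub>R X m))\<^sup>2) \<longlonglongrightarrow> (\<Sum>j\<in>(UNIV::'n set). 0\<^sup>2)"
    by (intro tendsto_intros sym_scaled_tendsto_0 X)
  then show "(\<lambda>m. (X m)\<^sup>2 * psi (\<zeta> /\<^sub>R X m)) \<longlonglongrightarrow> 0" by (simp add: e)
  show "(X m)\<^sup>2 * psi (\<zeta> /\<^sub>R X m) \<le> psi_const * (1 + norm \<zeta>)\<^sup>2"
    unfolding e psi_const_def by (rule sum_squares_bound) (rule sym_scaled_tendsto_0(2)[OF X])
qed

text \<open>A nonlocal difference acts on a superposition of characters as multiplication by
  \<open>\<i> * sym j\<close>; the cosine part drops out because \<open>kern j\<close> is odd.\<close>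

lemma kern_difference_integral:
  fixes a :: "real^'n \<Rightarrow> complex"
  assumes a: "integrable lborel a" and xa: "integrable lborel (\<lambda>\<xi>. norm \<xi> * norm (a \<xi>))"
  shows "integrable lborel (\<lambda>z. kern j z *\<^sub>R (ft a (- x) - ft a (- (x - z))))"
    and "(LINT z|lborel. kern j z *\<^sub>R (ft a (- x) - ft a (- (x - z)))) = ft (\<lambda>\<xi>. \<i> * of_real (sym j \<xi>) * a \<xi>) (- x)"
proof -
  have [measurable]: "a \<in> borel_measurable borel" using a by auto
  define F where "F z \<xi> = kern j z *\<^sub>R (a \<xi> * cis (2 * pi * (\<xi> \<bullet> x)) * (1 - cis (- (2 * pi * (z \<bullet> \<xi>)))))" for z \<xi>
  have diff: "kern j z *\<^sub>R (ft a (- x) - ft a (- (x - z))) = (LINT \<xi>|lborel. F z \<xi>)" for z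
  proof -
    have "ft a (- x) - ft a (- (x - z)) = (LINT \<xi>|lborel. a \<xi> * cis (- (2 * pi * (\<xi> \<bullet> - x))) - a \<xi> * cis (- (2 * pi * (\<xi> \<bullet> - (x - z)))))"
      unfolding ft_def using a by (simp only: Bochner_Integration.integral_diff[OF integrable_ft[OF a] integrable_ft[OF a]])
    also have "\<dots> = (LINT \<xi>|lborel. a \<xi> * cis (2 * pi * (\<xi> \<bullet> x)) * (1 - cis (- (2 * pi * (z \<bullet> \<xi>)))))"
    proof (rule Bochner_Integration.integral_cong[OF refl])
      fix \<xi>
      have "cis (- (2 * pi * (\<xi> \<bullet> - (x - z)))) = cis (2 * pi * (\<xi> \<bullet> x)) * cis (- (2 * pi * (z \<bullet> \<xi>)))"
        unfolding cis_mult by (simp add: inner_diff_right inner_commute algebra_simps)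
      then show "a \<xi> * cis (- (2 * pi * (\<xi> \<bullet> - x))) - a \<xi> * cis (- (2 * pi * (\<xi> \<bullet> - (x - z))))
          = a \<xi> * cis (2 * pi * (\<xi> \<bullet> x)) * (1 - cis (- (2 * pi * (z \<bullet> \<xi>))))"
        by (simp add: algebra_simps)
    qed
    finally show ?thesis unfolding F_def by simp
  qed
  have FI: "integrable (lborel \<Otimes>\<^sub>M lborel) (\<lambda>(z, \<xi>). F z \<xi>)"
  proof (rule integrable_pair_bound[where g=wt and h="\<lambda>\<xi>. 2 * norm (a \<xi>) + 2 * pi * (norm \<xi> * norm (a \<xi>))"])
    show "(\<lambda>(z, \<xi>). F z \<xi>) \<in> borel_measurable (lborel \<Otimes>\<^sub>M lborel)" unfolding F_def by measurable
    show "integrable lborel (\<lambda>\<xi>. 2 * norm (a \<xi>) + 2 * pi * (norm \<xi> * norm (a \<xi>)))" using a xa by simp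
    fix z \<xi>
    have "norm (F z \<xi>) = norm (a \<xi>) * (\<bar>norm (1 - cis (- (2 * pi * (z \<bullet> \<xi>))))\<bar> * \<bar>kern j z\<bar>)"
      by (simp add: F_def norm_mult)
    also have "\<dots> \<le> norm (a \<xi>) * ((2 + 2 * pi * norm \<xi>) * wt z)"
      using norm_1_minus_cis_le_min[of z \<xi>] by (intro mult_left_mono kern_mult_bound) auto
    finally show "norm (case (z, \<xi>) of (z, \<xi>) \<Rightarrow> F z \<xi>) \<le> wt z * (2 * norm (a \<xi>) + 2 * pi * (norm \<xi> * norm (a \<xi>)))"
      by (simp add: algebra_simps)
  qed (rule wt_integrable)
  show "integrable lborel (\<lambda>z. kern j z *\<^sub>R (ft a (- x) - ft a (- (x - z))))"
    unfolding diff using lborel_pair.integrable_fst'[OF FI] by simp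
  have inner: "(LINT z|lborel. F z \<xi>) = \<i> * of_real (sym j \<xi>) * a \<xi> * cis (- (2 * pi * (\<xi> \<bullet> - x)))" for \<xi>
  proof -
    define D where "D z = kern j z *\<^sub>R (1 - cis (- (2 * pi * (z \<bullet> \<xi>))))" for z
    have [measurable]: "D \<in> borel_measurable borel" unfolding D_def by measurable
    have DI: "integrable lborel D" unfolding D_def by (rule integrable_kern_mult[OF _ norm_1_minus_cis_le_min]) simp
    have "(LINT z|lborel. D z) = (LINT z|lborel. D (- z))" by (rule lborel_integral_minus(2)[symmetric]) simp
    then have "2 * (LINT z|lborel. D z) = (LINT z|lborel. D z + D (- z))"
      using DI lborel_integrable_minus(2)[of D] by simp
    also have "\<dots> = (LINT z|lborel. (2 * \<i>) * of_real (kern j z * sin (2 * pi * (z \<bullet> \<xi>))))"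
    proof (rule Bochner_Integration.integral_cong[OF refl])
      show "D z + D (- z) = (2 * \<i>) * of_real (kern j z * sin (2 * pi * (z \<bullet> \<xi>)))" for z
        by (simp add: D_def kern_minus complex_eq_iff algebra_simps)
    qed
    also have "\<dots> = 2 * (\<i> * of_real (sym j \<xi>))"
      by (simp only: integral_mult_right_zero integral_complex_of_real sym_def mult.assoc)
    finally have "(LINT z|lborel. D z) = \<i> * of_real (sym j \<xi>)" by simp
    moreover have "(LINT z|lborel. F z \<xi>) = (LINT z|lborel. a \<xi> * cis (2 * pi * (\<xi> \<bullet> x)) * D z)"
      by (simp add: F_def D_def)
    ultimately show ?thesis by (simp add: ac_simps)
  qed
  have "(LINT z|lborel. kern j z *\<^sub>R (ft a (- x) - ft a (- (x - z)))) = (LINT \<xi>|lborel. LINT z|lborel. F z \<xi>)"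
    unfolding diff by (rule lborel_pair.Fubini_integral[symmetric, OF FI])
  then show "(LINT z|lborel. kern j z *\<^sub>R (ft a (- x) - ft a (- (x - z)))) = ft (\<lambda>\<xi>. \<i> * of_real (sym j \<xi>) * a \<xi>) (- x)"
    unfolding inner ft_def .
qed

end



section \<open>Pairing the potential with Fourier transforms\<close>

context radial_kernel
begin

definition Qb :: "real \<Rightarrow> real" where
  "Qb s = (LINT t|lborel. indicator {s<..} t * (b t / t))"

lemma ft_odd_part:
  fixes g :: "real^'n \<Rightarrow> complex"
  assumes "integrable lborel g"
  shows "(ft g x - ft g (- x)) / 2 = - \<i> * (LINT \<xi>|lborel. g \<xi> * of_real (sin (2 * pi * (x \<bullet> \<xi>))))"
proof -
  have "ft g x - ft g (- x) = (LINT \<xi>|lborel. g \<xi> * cis (- (2 * pi * (\<xi> \<bullet> x))) - g \<xi> * cis (- (2 * pi * (\<xi> \<bullet> - x))))"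
    unfolding ft_def by (rule Bochner_Integration.integral_diff[symmetric]) (intro integrable_ft assms)+
  also have "\<dots> = (LINT \<xi>|lborel. (- (2 * \<i>)) * (g \<xi> * of_real (sin (2 * pi * (x \<bullet> \<xi>)))))"
    by (rule Bochner_Integration.integral_cong[OF refl])
      (simp add: complex_eq_iff inner_commute algebra_simps)
  also have "\<dots> = (- (2 * \<i>)) * (LINT \<xi>|lborel. g \<xi> * of_real (sin (2 * pi * (x \<bullet> \<xi>))))"
    by (rule integral_mult_right_zero)
  finally show ?thesis by simp
qed

text \<open>The odd kernel sees only the odd part of \<open>ft g\<close>. That part is a sine
  integral and vanishes to first order at the origin, which makes the pairing absolutely convergent
  even where \<open>kern\<close> is not integrable.\<close>

lemma kern_ft_odd_part:
  fixes g :: "real^'n \<Rightarrow> complex"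
  assumes g: "integrable lborel g" and xg: "integrable lborel (\<lambda>\<xi>. norm \<xi> * norm (g \<xi>))"
  shows "integrable lborel (\<lambda>x. kern j x *\<^sub>R ((ft g x - ft g (- x)) / 2))"
    and "(LINT x|lborel. kern j x *\<^sub>R ((ft g x - ft g (- x)) / 2)) = - \<i> * (LINT \<xi>|lborel. g \<xi> * of_real (sym j \<xi>))"
    and "norm ((ft g x - ft g (- x)) / 2) \<le> (LINT \<xi>|lborel. norm (g \<xi>) + 2 * pi * (norm \<xi> * norm (g \<xi>))) * min 1 (norm x)"
proof -
  have [measurable]: "g \<in> borel_measurable borel" using g by auto
  let ?W = "\<lambda>\<xi>. norm (g \<xi>) + 2 * pi * (norm \<xi> * norm (g \<xi>))"
  have WI: "integrable lborel ?W" using g xg by simp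
  have FI: "integrable (lborel \<Otimes>\<^sub>M lborel) (\<lambda>(x, \<xi>). kern j x *\<^sub>R (g \<xi> * of_real (sin (2 * pi * (x \<bullet> \<xi>)))))"
  proof (rule integrable_pair_bound[where g=wt and h="?W"])
    fix x \<xi>
    have "norm (g \<xi>) * \<bar>kern j x * sin (2 * pi * (x \<bullet> \<xi>))\<bar> \<le> norm (g \<xi>) * ((1 + 2 * pi * norm \<xi>) * wt x)"
      by (intro mult_left_mono kern_sin_bound) simp
    then show "norm (case (x, \<xi>) of (x, \<xi>) \<Rightarrow> kern j x *\<^sub>R (g \<xi> * of_real (sin (2 * pi * (x \<bullet> \<xi>))))) \<le> wt x * ?W \<xi>"
      by (simp add: norm_mult abs_mult algebra_simps)
  qed (use wt_integrable WI in auto)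
  have odd: "kern j x *\<^sub>R ((ft g x - ft g (- x)) / 2) = - \<i> * (LINT \<xi>|lborel. kern j x *\<^sub>R (g \<xi> * of_real (sin (2 * pi * (x \<bullet> \<xi>)))))" for x
    unfolding ft_odd_part[OF g] by simp
  show "integrable lborel (\<lambda>x. kern j x *\<^sub>R ((ft g x - ft g (- x)) / 2))"
    unfolding odd using lborel_pair.integrable_fst'[OF FI] by (intro integrable_mult_right) simp
  have "(LINT x|lborel. kern j x *\<^sub>R ((ft g x - ft g (- x)) / 2))
      = - \<i> * (LINT x|lborel. LINT \<xi>|lborel. kern j x *\<^sub>R (g \<xi> * of_real (sin (2 * pi * (x \<bullet> \<xi>)))))"
    unfolding odd by (rule integral_mult_right_zero)
  also have "\<dots> = - \<i> * (LINT \<xi>|lborel. LINT x|lborel. kern j x *\<^sub>R (g \<xi> * of_real (sin (2 * pi * (x \<bullet> \<xi>)))))"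
    by (rule arg_cong[where f="\<lambda>t. - \<i> * t"], rule lborel_pair.Fubini_integral[symmetric, OF FI])
  also have "\<dots> = - \<i> * (LINT \<xi>|lborel. g \<xi> * of_real (sym j \<xi>))"
  proof (intro arg_cong[where f="\<lambda>t. - \<i> * t"] Bochner_Integration.integral_cong refl)
    fix \<xi>
    have "(LINT x|lborel. kern j x *\<^sub>R (g \<xi> * of_real (sin (2 * pi * (x \<bullet> \<xi>))))) = (LINT x|lborel. g \<xi> * of_real (kern j x * sin (2 * pi * (x \<bullet> \<xi>))))"
      by (simp add: scaleR_conv_of_real ac_simps)
    also have "\<dots> = g \<xi> * of_real (sym j \<xi>)"
      by (simp only: integral_mult_right_zero integral_complex_of_real sym_def)
    finally show "(LINT x|lborel. kern j x *\<^sub>R (g \<xi> * of_real (sin (2 * pi * (x \<bullet> \<xi>))))) = g \<xi> * of_real (sym j \<xi>)" .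
  qed
  finally show "(LINT x|lborel. kern j x *\<^sub>R ((ft g x - ft g (- x)) / 2)) = - \<i> * (LINT \<xi>|lborel. g \<xi> * of_real (sym j \<xi>))" .
  have "norm ((ft g x - ft g (- x)) / 2) = norm (LINT \<xi>|lborel. g \<xi> * of_real (sin (2 * pi * (x \<bullet> \<xi>))))"
    unfolding ft_odd_part[OF g] by (simp add: norm_mult)
  also have "\<dots> \<le> (LINT \<xi>|lborel. norm (g \<xi> * of_real (sin (2 * pi * (x \<bullet> \<xi>)))))" by (rule integral_norm_bound)
  also have "\<dots> \<le> (LINT \<xi>|lborel. ?W \<xi> * min 1 (norm x))"
  proof (rule integral_mono)
    show le: "norm (g \<xi> * of_real (sin (2 * pi * (x \<bullet> \<xi>)))) \<le> ?W \<xi> * min 1 (norm x)" for \<xi>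
    proof -
      have "norm (g \<xi>) * \<bar>sin (2 * pi * (x \<bullet> \<xi>))\<bar> \<le> norm (g \<xi>) * ((1 + 2 * pi * norm \<xi>) * min 1 (norm x))"
        by (intro mult_left_mono abs_sin_le_min) simp
      then show ?thesis by (simp add: norm_mult algebra_simps)
    qed
    show "integrable lborel (\<lambda>\<xi>. ?W \<xi> * min 1 (norm x))" using WI by (rule integrable_mult_left)
    then show "integrable lborel (\<lambda>\<xi>. norm (g \<xi> * of_real (sin (2 * pi * (x \<bullet> \<xi>)))))"
      by (rule integrable_real_bound) (use le in auto)
  qed
  also have "\<dots> = (LINT \<xi>|lborel. ?W \<xi>) * min 1 (norm x)" by (rule integral_mult_left_zero)
  finally show "norm ((ft g x - ft g (- x)) / 2) \<le> (LINT \<xi>|lborel. ?W \<xi>) * min 1 (norm x)" .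
qed

text \<open>The absolute value changes nothing here; it is present because the profile of the
  weight, b t / |t|, has to be nonnegative for every real t in
  \<open>radial_weight_transfer\<close>.\<close>

lemma integrable_radial_weight: "integrable lborel (\<lambda>x::real^'n. b (norm x) / \<bar>norm x\<bar> * min 1 (norm x))"
  using wt_integrable by (simp add: wt_def[abs_def] r_eq mult.commute)

text \<open>For t <= 1 the supremum M times the volume of the ball gives M/n times t times the area
  of the sphere. For t > 1 the full L1 norm suffices, since \<open>t ^ (CARD('n) - 1)\<close> is
  then at least 1. This is the shape of bound required of the radial side in
  \<open>radial_weight_transfer\<close>.\<close>

lemma ball_integral_bound:
  fixes \<Phi> :: "real^'n \<Rightarrow> complex"
  assumes \<Phi>: "integrable lborel \<Phi>" and M: "\<And>x. norm (\<Phi> x) \<le> M"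
  shows "\<exists>C\<ge>0. \<forall>t>0. (LINT x|lborel. indicator {..t} (norm x) * norm (\<Phi> x)) \<le> C * min 1 t * radial_density CARD('n) t"
proof -
  define n where "n = real CARD('n)"
  define \<omega> where "\<omega> = unit_ball_vol (real CARD('n))"
  define L where "L = (LINT x|lborel. norm (\<Phi> x))"
  have [measurable]: "\<Phi> \<in> borel_measurable borel" using \<Phi> by auto
  have pos: "0 < n" "0 < \<omega>" by (auto simp: n_def \<omega>_def)
  have M0: "0 \<le> M" using order_trans[OF norm_ge_zero M] by auto
  have L0: "0 \<le> L" by (simp add: L_def)
  have I: "integrable lborel (\<lambda>x. indicator {..t} (norm x) * norm (\<Phi> x))" for t
    by (rule integrable_real_bound[OF integrable_norm[OF \<Phi>]]) (auto split: split_indicator)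
  have rd: "radial_density CARD('n) t = n * \<omega> * t ^ (CARD('n) - 1)" if "0 < t" for t
    using that by (simp add: radial_density_def n_def \<omega>_def)
  have "(LINT x|lborel. indicator {..t} (norm x) * norm (\<Phi> x)) \<le> (M / n + L / (n * \<omega>)) * min 1 t * radial_density CARD('n) t"
    if t: "0 < t" for t
  proof (cases "t \<le> 1")
    case True
    have "(LINT x|lborel. indicator {..t} (norm x) * norm (\<Phi> x)) \<le> (LINT x|lborel. M * indicator (cball (0::real^'n) t) x)"
    proof (rule integral_mono[OF I])
      show "integrable lborel (\<lambda>x. M * indicator (cball (0::real^'n) t) x)"
        by (intro integrable_mult_right integrable_real_indicator) (auto simp: emeasure_lborel_cball_finite[unfolded infinity_ennreal_def])
      show "indicator {..t} (norm x) * norm (\<Phi> x) \<le> M * indicator (cball 0 t) x" for x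
        using M[of x] by (auto split: split_indicator)
    qed
    also have "\<dots> = M * (\<omega> * t ^ CARD('n))" using t by (simp add: content_cball \<omega>_def)
    also have "\<dots> = M / n * t * radial_density CARD('n) t"
      using pos unfolding rd[OF t] by (simp add: power_eq_if[of t "CARD('n)"])
    also have "\<dots> \<le> (M / n + L / (n * \<omega>)) * t * radial_density CARD('n) t"
      using pos L0 t by (intro mult_right_mono) auto
    finally show ?thesis using True by simp
  next
    case False
    have "(LINT x|lborel. indicator {..t} (norm x) * norm (\<Phi> x)) \<le> L"
      unfolding L_def by (intro integral_mono[OF I integrable_norm[OF \<Phi>]]) (auto split: split_indicator)
    also have "\<dots> = L / (n * \<omega>) * (n * \<omega> * 1)" using pos by simp
    also have "\<dots> \<le> L / (n * \<omega>) * (n * \<omega> * t ^ (CARD('n) - 1))"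
      using False pos L0 by (intro mult_left_mono one_le_power) auto
    also have "\<dots> \<le> (M / n + L / (n * \<omega>)) * radial_density CARD('n) t"
      unfolding rd[OF t] using pos M0 t by (intro mult_right_mono) auto
    finally show ?thesis using False by simp
  qed
  moreover have "0 \<le> M / n + L / (n * \<omega>)" using pos M0 L0 by simp
  ultimately show ?thesis by blast
qed

text \<open>The potential at x is the integral of b(t)/t over the radii t of the balls around the
  origin containing x, so Fubini turns the pairing into integrals over balls. In polar coordinates
  the hypothesis on the kernel is integrability of min(1,t) b(t)/t against
  \<open>radial_density\<close>; \<open>bnd\<close> makes this the majorant.\<close>

lemma Qb_pairing_ball:
  fixes \<Phi> :: "real^'n \<Rightarrow> complex"
  assumes \<Phi>: "integrable lborel \<Phi>" and C: "0 \<le> C"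
    and bnd: "\<And>t. 0 < t \<Longrightarrow> (LINT x|lborel. indicator {..t} (norm x) * norm (\<Phi> x)) \<le> C * min 1 t * radial_density CARD('n) t"
  shows "(LINT x|lborel. of_real (Qb (norm x)) * \<Phi> x)
    = (LINT t|lborel. indicator {0<..} t *\<^sub>R ((b t / \<bar>t\<bar>) *\<^sub>R (LINT x|lborel. indicator {..t} (norm x) *\<^sub>R \<Phi> x)))"
proof -
  have [measurable]: "\<Phi> \<in> borel_measurable borel" using \<Phi> by auto
  let ?a = "\<lambda>t. indicator {0<..} t * (b t / \<bar>t\<bar>) :: real"
  have I: "integrable lborel (\<lambda>x. indicator {..t} (norm x) *\<^sub>R \<Phi> x)" for t
    by (rule integrable_real_bound[OF integrable_norm[OF \<Phi>]]) (auto split: split_indicator)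
  have J: "integrable lborel (\<lambda>t. radial_density CARD('n) t *\<^sub>R (b t / \<bar>t\<bar> * min 1 t))"
    using integrable_radial_weight integral_norm_lborel(2)[where 'a="real^'n", of "\<lambda>t. b t / \<bar>t\<bar> * min 1 t"] by simp
  have FI: "integrable (lborel \<Otimes>\<^sub>M lborel) (\<lambda>(t, x). ?a t *\<^sub>R (indicator {..t} (norm x) *\<^sub>R \<Phi> x))"
  proof (rule lborel_pair.Fubini_integrable)
    show "(\<lambda>(t, x). ?a t *\<^sub>R (indicator {..t} (norm x) *\<^sub>R \<Phi> x)) \<in> borel_measurable (lborel \<Otimes>\<^sub>M lborel)"
      unfolding indicator_def atMost_iff by measurable
    show "AE t in lborel. integrable lborel (\<lambda>x. case (t, x) of (t, x) \<Rightarrow> ?a t *\<^sub>R (indicator {..t} (norm x) *\<^sub>R \<Phi> x))"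
      unfolding prod.case by (intro AE_I2 integrable_scaleR_right I)
    show "integrable lborel (\<lambda>t. LINT x|lborel. norm (case (t, x) of (t, x) \<Rightarrow> ?a t *\<^sub>R (indicator {..t} (norm x) *\<^sub>R \<Phi> x)))"
    proof (rule integrable_real_bound[OF integrable_mult_right[OF J, of C]])
      fix t
      have a0: "0 \<le> ?a t" using b_nonneg[of t] by simp
      have "norm (case (t, x) of (t, x) \<Rightarrow> ?a t *\<^sub>R (indicator {..t} (norm x) *\<^sub>R \<Phi> x)) = ?a t * (indicator {..t} (norm x) * norm (\<Phi> x))" for x
        using a0 by (simp only: prod.case norm_scaleR abs_of_nonneg indicator_pos_le)
      then have "(LINT x|lborel. norm (case (t, x) of (t, x) \<Rightarrow> ?a t *\<^sub>R (indicator {..t} (norm x) *\<^sub>R \<Phi> x)))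
          = (LINT x|lborel. ?a t * (indicator {..t} (norm x) * norm (\<Phi> x)))" by (simp only:)
      also have "\<dots> = ?a t * (LINT x|lborel. indicator {..t} (norm x) * norm (\<Phi> x))" by (rule integral_mult_right_zero)
      finally have e: "(LINT x|lborel. norm (case (t, x) of (t, x) \<Rightarrow> ?a t *\<^sub>R (indicator {..t} (norm x) *\<^sub>R \<Phi> x)))
          = ?a t * (LINT x|lborel. indicator {..t} (norm x) * norm (\<Phi> x))" .
      have "?a t * (LINT x|lborel. indicator {..t} (norm x) * norm (\<Phi> x)) \<le> C * (radial_density CARD('n) t *\<^sub>R (b t / \<bar>t\<bar> * min 1 t))"
      proof (cases "0 < t")
        case True
        have "b t / \<bar>t\<bar> * (LINT x|lborel. indicator {..t} (norm x) * norm (\<Phi> x)) \<le> b t / \<bar>t\<bar> * (C * min 1 t * radial_density CARD('n) t)"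
          by (intro mult_left_mono bnd True) (simp add: b_nonneg)
        then show ?thesis using True by (simp add: ac_simps)
      next
        case False
        have "0 \<le> C * (radial_density CARD('n) t *\<^sub>R (b t / \<bar>t\<bar> * min 1 t))"
          using False C by (cases "t = 0") (auto simp: radial_density_def)
        then show ?thesis using False by simp
      qed
      moreover have "0 \<le> ?a t * (LINT x|lborel. indicator {..t} (norm x) * norm (\<Phi> x))"
        by (rule mult_nonneg_nonneg[OF a0 Bochner_Integration.integral_nonneg]) auto
      ultimately show "norm (LINT x|lborel. norm (case (t, x) of (t, x) \<Rightarrow> ?a t *\<^sub>R (indicator {..t} (norm x) *\<^sub>R \<Phi> x)))
          \<le> C * (radial_density CARD('n) t *\<^sub>R (b t / \<bar>t\<bar> * min 1 t))"
        unfolding e real_norm_def by (simp only: abs_of_nonneg)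
    qed (unfold indicator_def atMost_iff, measurable)
  qed
  have "(LINT x|lborel. of_real (Qb (norm x)) * \<Phi> x) = (LINT x|lborel. LINT t|lborel. ?a t *\<^sub>R (indicator {..t} (norm x) *\<^sub>R \<Phi> x))"
  proof (rule integral_cong_AE)
    show "AE x in lborel. of_real (Qb (norm x)) * \<Phi> x = (LINT t|lborel. ?a t *\<^sub>R (indicator {..t} (norm x) *\<^sub>R \<Phi> x))"
      using AE_lborel_singleton[of 0]
    proof eventually_elim
      case (elim x)
      have "(LINT t|lborel. ?a t *\<^sub>R (indicator {..t} (norm x) *\<^sub>R \<Phi> x)) = (LINT t|lborel. ?a t * indicator {..t} (norm x)) *\<^sub>R \<Phi> x"
      proof -
        have "(LINT t|lborel. ?a t *\<^sub>R (indicator {..t} (norm x) *\<^sub>R \<Phi> x)) = (LINT t|lborel. of_real (?a t * indicator {..t} (norm x)) * \<Phi> x)"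
          by (simp add: scaleR_conv_of_real mult.assoc)
        also have "\<dots> = of_real (LINT t|lborel. ?a t * indicator {..t} (norm x)) * \<Phi> x"
          by (simp only: integral_mult_left_zero integral_complex_of_real)
        finally show ?thesis by (simp only: scaleR_conv_of_real)
      qed
      \<comment> \<open>The conditions |x| <= t and |x| < t differ at the single radius t =
        |x|.\<close>
      also have "(LINT t|lborel. ?a t * indicator {..t} (norm x)) = Qb (norm x)"
        unfolding Qb_def
      proof (rule integral_cong_AE)
        show "AE t in lborel. ?a t * indicator {..t} (norm x) = indicator {norm x<..} t * (b t / t)"
          using AE_lborel_singleton[of "norm x"]
        proof eventually_elim
          case (elim t)
          then show ?case using \<open>x \<noteq> 0\<close> zero_less_norm_iff[of x] by (auto split: split_indicator simp del: zero_less_norm_iff)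
        qed
      qed (unfold indicator_def atMost_iff, measurable)
      finally show ?case by (simp add: scaleR_conv_of_real)
    qed
    show "(\<lambda>x. of_real (Qb (norm x)) * \<Phi> x) \<in> borel_measurable lborel"
      unfolding Qb_def indicator_def greaterThan_iff by measurable
  qed (unfold indicator_def atMost_iff, measurable)
  also have "\<dots> = (LINT t|lborel. LINT x|lborel. ?a t *\<^sub>R (indicator {..t} (norm x) *\<^sub>R \<Phi> x))"
    by (rule lborel_pair.Fubini_integral[OF FI])
  also have "\<dots> = (LINT t|lborel. indicator {0<..} t *\<^sub>R ((b t / \<bar>t\<bar>) *\<^sub>R (LINT x|lborel. indicator {..t} (norm x) *\<^sub>R \<Phi> x)))"
    by (intro Bochner_Integration.integral_cong refl) (simp only: integral_scaleR_right scaleR_scaleR[symmetric])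
  finally show ?thesis .
qed

text \<open>Up to the factor -2 pi i, \<open>\<Phi>\<close> is the divergence of the field of
  transforms \<open>ft (g j)\<close>. On every ball, integration by parts trades this divergence for
  the radial component of the field, and the weight b(t)/t turns the radial component into a pairing
  with \<open>kern\<close>. A whole family \<open>g\<close> is allowed because both a single
  component and the family \<xi>_j \<phi> / |\<xi>|^2 are needed.\<close>

lemma Qb_pairing:
  fixes g :: "'n \<Rightarrow> real^'n \<Rightarrow> complex"
  assumes g: "\<And>j. integrable lborel (g j)" and xg: "\<And>j. integrable lborel (\<lambda>\<xi>. norm \<xi> * norm (g j \<xi>))"
  defines "\<Phi> \<equiv> ft (\<lambda>\<xi>. \<Sum>j\<in>UNIV. of_real (\<xi> $ j) * g j \<xi>)"
  assumes \<Phi>: "integrable lborel \<Phi>"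
  shows "(LINT x|lborel. of_real (Qb (norm x)) * \<Phi> x) = (\<Sum>j\<in>UNIV. LINT \<xi>|lborel. g j \<xi> * of_real (sym j \<xi>)) / (2 * of_real pi)"
proof -
  have [measurable]: "g j \<in> borel_measurable borel" for j using g by auto
  have ball: "integrable lborel (\<lambda>x. indicator {..t} (norm x) *\<^sub>R f x)" 
    if [measurable]: "f \<in> borel_measurable borel" and "\<And>x. norm (f x) \<le> B" for f :: "real^'n \<Rightarrow> complex" and B t
  proof (rule integrable_real_bound[of _ "\<lambda>x. B * indicator (cball 0 t) x"])
    show "integrable lborel (\<lambda>x. B * indicator (cball (0::real^'n) t) x)"
      by (intro integrable_mult_right integrable_real_indicator) (auto simp: emeasure_lborel_cball_finite[unfolded infinity_ennreal_def])
  qed (use that in \<open>auto split: split_indicator\<close>)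
  define G where "G j = ft (g j)" for j
  define D where "D j = ft (\<lambda>\<xi>. - (2 * pi * (\<xi> \<bullet> axis j 1)) *\<^sub>R (\<i> * g j \<xi>))" for j
  have gj: "integrable lborel (\<lambda>\<xi>. of_real (\<xi> $ j) * g j \<xi>)" for j
    by (rule integrable_real_bound[OF xg[of j]]) (auto simp: norm_mult intro!: mult_right_mono component_le_norm_cart)
  have dg: "integrable lborel (\<lambda>\<xi>. - (2 * pi * (\<xi> \<bullet> axis j 1)) *\<^sub>R (\<i> * g j \<xi>))" for j
  proof -
    have "integrable lborel (\<lambda>\<xi>. (- (2 * of_real pi * \<i>)) * (of_real (\<xi> $ j) * g j \<xi>))"
      by (intro integrable_mult_right gj)
    then show ?thesis by (simp add: inner_axis scaleR_conv_of_real mult_ac)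
  qed
  have [measurable]: "G j \<in> borel_measurable borel" "D j \<in> borel_measurable borel" for j
    unfolding G_def D_def by (intro ft_measurable g dg)+
  define C where "C j = (LINT x|lborel. norm (g j x)) + (LINT \<xi>|lborel. norm (- (2 * pi * (\<xi> \<bullet> axis j 1)) *\<^sub>R (\<i> * g j \<xi>)))" for j
  have GC: "norm (G j x) \<le> C j" and DC: "norm (D j x) \<le> C j" for j x
  proof -
    have "0 \<le> (LINT x|lborel. norm (g j x))" "0 \<le> (LINT \<xi>|lborel. norm (- (2 * pi * (\<xi> \<bullet> axis j 1)) *\<^sub>R (\<i> * g j \<xi>)))"
      by simp_all
    then show "norm (G j x) \<le> C j" "norm (D j x) \<le> C j"
      using norm_ft_le[of "g j" x] norm_ft_le[of "\<lambda>\<xi>. - (2 * pi * (\<xi> \<bullet> axis j 1)) *\<^sub>R (\<i> * g j \<xi>)" x]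
      unfolding C_def G_def D_def by linarith+
  qed
  have dG: "((\<lambda>\<tau>. G j (x + \<tau> *\<^sub>R axis j 1)) has_vector_derivative D j x) (at 0)" for j x
    unfolding G_def D_def by (rule ft_has_vector_derivative[OF g xg])
  have D_sum: "(\<Sum>j\<in>UNIV. D j x) = (- (2 * of_real pi * \<i>)) * \<Phi> x" for x
  proof -
    have "(\<Sum>j\<in>UNIV. D j x) = ft (\<lambda>\<xi>. \<Sum>j\<in>UNIV. - (2 * pi * (\<xi> \<bullet> axis j 1)) *\<^sub>R (\<i> * g j \<xi>)) x"
      unfolding D_def by (rule ft_sum[symmetric]) (rule dg)
    also have "\<dots> = ft (\<lambda>\<xi>. (- (2 * of_real pi * \<i>)) * (\<Sum>j\<in>UNIV. of_real (\<xi> $ j) * g j \<xi>)) x"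
      by (simp add: sum_distrib_left inner_axis scaleR_conv_of_real mult_ac)
    finally show ?thesis unfolding ft_cmult \<Phi>_def .
  qed
  \<comment> \<open>On a ball the odd factor x_j/|x| sees only the odd part of \<open>G j\<close>.
    Passing to the odd part supplies the bound by min(1,|x|) that the transfer to the weight b(t)/t
    requires.\<close>
  define U where "U j x = (G j x - G j (- x)) / 2" for j x
  have [measurable]: "U j \<in> borel_measurable borel" for j unfolding U_def by measurable
  define H where "H x = (\<Sum>j\<in>UNIV. (x $ j / norm x) *\<^sub>R U j x)" for x
  have [measurable]: "H \<in> borel_measurable borel" unfolding H_def by measurable
  define A where "A t = (- (2 * of_real pi * \<i>)) * (LINT x|lborel. indicator {..t} (norm x) *\<^sub>R \<Phi> x)" for t
  have [measurable]: "\<Phi> \<in> borel_measurable borel" using \<Phi> by auto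
  have [measurable]: "A \<in> borel_measurable borel"
    unfolding A_def indicator_def atMost_iff by measurable
  have ratio: "\<bar>x $ j / norm x\<bar> \<le> 1" for x :: "real^'n" and j
    using component_le_norm_cart[of x j] by (cases "x = 0") (auto simp: abs_divide divide_simps)
  define CU where "CU j = (LINT \<xi>|lborel. norm (g j \<xi>) + 2 * pi * (norm \<xi> * norm (g j \<xi>)))" for j
  have UC: "norm (U j x) \<le> CU j * min 1 (norm x)" for j x
    unfolding U_def G_def CU_def by (rule kern_ft_odd_part(3)[OF g xg])
  have CU0: "0 \<le> CU j" for j unfolding CU_def by (intro Bochner_Integration.integral_nonneg) auto
  have HC: "norm (H x) \<le> (\<Sum>j\<in>UNIV. CU j) * min 1 (norm x)" for x
  proof -
    have "norm ((x $ j / norm x) *\<^sub>R U j x) \<le> 1 * (CU j * min 1 (norm x))" for j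
      unfolding norm_scaleR by (intro mult_mono ratio UC) auto
    then have "norm (H x) \<le> (\<Sum>j\<in>UNIV. CU j * min 1 (norm x))"
      unfolding H_def by (intro order_trans[OF norm_sum sum_mono]) simp
    then show ?thesis by (simp add: sum_distrib_right)
  qed
  define M where "M = (LINT \<xi>|lborel. norm (\<Sum>j\<in>UNIV. of_real (\<xi> $ j) * g j \<xi>))"
  have "norm (\<Phi> x) \<le> M" for x unfolding \<Phi>_def M_def by (rule norm_ft_le)
  from ball_integral_bound[OF \<Phi> this] obtain C0 where C0: "0 \<le> C0"
    and C0b: "\<And>t. 0 < t \<Longrightarrow> (LINT x|lborel. indicator {..t} (norm x) * norm (\<Phi> x)) \<le> C0 * min 1 t * radial_density CARD('n) t"
    by blast
  define CC where "CC = (\<Sum>j\<in>UNIV. CU j) + 2 * pi * C0"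
  have eq: "(LINT x|lborel. indicator {..t} (norm x) *\<^sub>R H x) = (LINT s|lborel. indicator {0..t} s *\<^sub>R A s)" if t: "0 < t" for t
  proof -
    define V where "V j x = indicator {..t} (norm x) *\<^sub>R ((x $ j / norm x) *\<^sub>R G j x)" for j x
    have VI: "integrable lborel (V j)" for j
      unfolding V_def
    proof (rule ball[where B="C j"])
      show "norm ((x $ j / norm x) *\<^sub>R G j x) \<le> C j" for x
        using mult_mono[OF ratio[of x j] GC[of j x]] by simp
    qed measurable
    have [measurable]: "V j \<in> borel_measurable borel" for j using VI[of j] by auto
    have VU: "indicator {..t} (norm x) *\<^sub>R ((x $ j / norm x) *\<^sub>R U j x) = (V j x + V j (- x)) / 2" for j x
      by (simp add: V_def U_def scaleR_diff_right diff_divide_distrib add_divide_distrib) (simp add: scaleR_conv_of_real)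
    have VmI: "integrable lborel (\<lambda>x. V j (- x))" for j using VI[of j] by (subst lborel_integrable_minus) auto
    have UI: "integrable lborel (\<lambda>x. indicator {..t} (norm x) *\<^sub>R ((x $ j / norm x) *\<^sub>R U j x))" for j
      unfolding VU using VI[of j] VmI[of j] by simp
    have ib: "(LINT x|lborel. V j x) = (LINT s|lborel. indicator {0..t} s *\<^sub>R (LINT x|lborel. indicator {..s} (norm x) *\<^sub>R D j x))" for j
      using integral_ball_directional_derivative[OF dG _ _ GC DC t, of j]
      unfolding V_def by (simp add: inner_axis)
    have "(LINT x|lborel. indicator {..t} (norm x) *\<^sub>R H x) = (LINT x|lborel. (\<Sum>j\<in>UNIV. indicator {..t} (norm x) *\<^sub>R ((x $ j / norm x) *\<^sub>R U j x)))"
      unfolding H_def by (simp only: scaleR_sum_right)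
    also have "\<dots> = (\<Sum>j\<in>UNIV. LINT x|lborel. indicator {..t} (norm x) *\<^sub>R ((x $ j / norm x) *\<^sub>R U j x))"
      by (rule Bochner_Integration.integral_sum) (rule UI)
    also have "\<dots> = (\<Sum>j\<in>UNIV. LINT x|lborel. V j x)"
      unfolding VU using VI VmI by (simp add: lborel_integral_minus(2))
    also have "\<dots> = (LINT s|lborel. (\<Sum>j\<in>UNIV. indicator {0..t} s *\<^sub>R (LINT x|lborel. indicator {..s} (norm x) *\<^sub>R D j x)))"
      unfolding ib
    proof (rule Bochner_Integration.integral_sum[symmetric])
      fix j
      show "integrable lborel (\<lambda>s. indicator {0..t} s *\<^sub>R (LINT x|lborel. indicator {..s} (norm x) *\<^sub>R D j x))"
      proof (rule integrable_real_bound[of _ "\<lambda>s. (C j * measure lborel (cball (0::real^'n) t)) * indicator {0..t} s"])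
        show "integrable lborel (\<lambda>s. (C j * measure lborel (cball (0::real^'n) t)) * indicator {0..t} s)"
          using t by (intro integrable_mult_right integrable_real_indicator) auto
        show "(\<lambda>s. indicator {0..t} s *\<^sub>R (LINT x|lborel. indicator {..s} (norm x) *\<^sub>R D j x)) \<in> borel_measurable lborel"
          unfolding indicator_def[of "{..s}" for s] atMost_iff by measurable
        fix s
        have "norm (LINT x|lborel. indicator {..s} (norm x) *\<^sub>R D j x) \<le> C j * measure lborel (cball (0::real^'n) t)" if "s \<le> t"
        proof -
          have "norm (LINT x|lborel. indicator {..s} (norm x) *\<^sub>R D j x) \<le> (LINT x|lborel. norm (indicator {..s} (norm x) *\<^sub>R D j x))"
            by (rule integral_norm_bound)
          also have "\<dots> \<le> (LINT x|lborel. C j * indicator (cball (0::real^'n) t) x)"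
          proof (rule integral_mono)
            show "integrable lborel (\<lambda>x. norm (indicator {..s} (norm x) *\<^sub>R D j x))"
              by (intro integrable_norm ball[where B="C j"] DC) measurable
            show "integrable lborel (\<lambda>x. C j * indicator (cball (0::real^'n) t) x)"
              by (intro integrable_mult_right integrable_real_indicator) (auto simp: emeasure_lborel_cball_finite[unfolded infinity_ennreal_def])
            show "norm (indicator {..s} (norm x) *\<^sub>R D j x) \<le> C j * indicator (cball 0 t) x" for x
              using DC[of j x] order_trans[OF norm_ge_zero DC] that by (auto split: split_indicator)
          qed
          finally show ?thesis by simp
        qed
        then show "norm (indicator {0..t} s *\<^sub>R (LINT x|lborel. indicator {..s} (norm x) *\<^sub>R D j x)) \<le> C j * measure lborel (cball (0::real^'n) t) * indicator {0..t} s"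
          by (auto split: split_indicator)
      qed
    qed
    also have "\<dots> = (LINT s|lborel. indicator {0..t} s *\<^sub>R A s)"
    proof (rule Bochner_Integration.integral_cong[OF refl])
      fix s
      have "(\<Sum>j\<in>UNIV. LINT x|lborel. indicator {..s} (norm x) *\<^sub>R D j x) = (LINT x|lborel. (\<Sum>j\<in>UNIV. indicator {..s} (norm x) *\<^sub>R D j x))"
        by (rule Bochner_Integration.integral_sum[symmetric], rule ball[OF _ DC]) measurable
      also have "\<dots> = (LINT x|lborel. (- (2 * of_real pi * \<i>)) * (indicator {..s} (norm x) *\<^sub>R \<Phi> x))"
        by (simp only: scaleR_sum_right[symmetric] D_sum mult_scaleR_right)
      also have "\<dots> = A s" unfolding A_def by (rule integral_mult_right_zero)
      finally show "(\<Sum>j\<in>UNIV. indicator {0..t} s *\<^sub>R (LINT x|lborel. indicator {..s} (norm x) *\<^sub>R D j x)) = indicator {0..t} s *\<^sub>R A s"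
        by (simp add: scaleR_sum_right[symmetric])
    qed
    finally show ?thesis .
  qed
  have nA: "norm (A t) \<le> 2 * pi * (C0 * min 1 t * radial_density CARD('n) t)" if "0 < t" for t
  proof -
    have "norm (LINT x|lborel. indicator {..t} (norm x) *\<^sub>R \<Phi> x) \<le> (LINT x|lborel. norm (indicator {..t} (norm x) *\<^sub>R \<Phi> x))"
      by (rule integral_norm_bound)
    also have "\<dots> \<le> C0 * min 1 t * radial_density CARD('n) t" using C0b[OF that] by simp
    finally show ?thesis unfolding A_def by (simp add: norm_mult)
  qed
  have transfer: "(LINT x|lborel. (b (norm x) / \<bar>norm x\<bar>) *\<^sub>R H x) = (LINT t|lborel. indicator {0<..} t *\<^sub>R ((b t / \<bar>t\<bar>) *\<^sub>R A t))"
  proof (rule radial_weight_transfer_complex[where C=CC, OF _ _ _ _ _ eq])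
    have S0: "0 \<le> (\<Sum>j\<in>UNIV. CU j)" by (intro sum_nonneg CU0)
    show "norm (H x) \<le> CC * min 1 (norm x)" for x
    proof -
      have "(\<Sum>j\<in>UNIV. CU j) * min 1 (norm x) \<le> CC * min 1 (norm x)"
        unfolding CC_def using C0 by (intro mult_right_mono) auto
      then show ?thesis using HC[of x] by linarith
    qed
    show "norm (A t) \<le> CC * min 1 t * radial_density DIM(real^'n) t" if "0 < t" for t
    proof -
      have "2 * pi * (C0 * min 1 t * radial_density CARD('n) t) = 2 * pi * C0 * (min 1 t * radial_density CARD('n) t)" by simp
      also have "\<dots> \<le> CC * (min 1 t * radial_density CARD('n) t)"
        unfolding CC_def using S0 that by (intro mult_right_mono) auto
      finally show ?thesis using nA[OF that] by (simp add: mult.assoc)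
    qed
    show "integrable lborel (\<lambda>x. indicator {..t} (norm x) *\<^sub>R H x)" for t
    proof (rule ball[where B="\<Sum>j\<in>UNIV. CU j"])
      show "norm (H x) \<le> (\<Sum>j\<in>UNIV. CU j)" for x
        using HC[of x] mult_left_le[OF _ S0, of "min 1 (norm x)"] by linarith
    qed measurable
    show "integrable lborel (\<lambda>s. indicator {0..t} s *\<^sub>R A s)" if "0 < t" for t
    \<comment> \<open>The bound on A holds for s > 0 only; the indicator of {0} covers the
      endpoint.\<close>
    proof (rule integrable_real_bound[of _ "\<lambda>s. (2 * pi * C0) * (radial_density CARD('n) t * indicator {0..t} s) + norm (A 0) * indicator {0} s"])
      show "integrable lborel (\<lambda>s. (2 * pi * C0) * (radial_density CARD('n) t * indicator {0..t} s) + norm (A 0) * indicator {0} s)"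
        using that by (intro Bochner_Integration.integrable_add integrable_mult_right integrable_real_indicator) auto
      fix s
      have "norm (A s) \<le> (2 * pi * C0) * radial_density CARD('n) t" if s: "0 < s" "s \<le> t"
      proof -
        have "min 1 s * radial_density CARD('n) s \<le> 1 * radial_density CARD('n) t"
          using s by (intro mult_mono) (auto simp: radial_density_def intro!: mult_left_mono power_mono)
        then have "(2 * pi * C0) * (min 1 s * radial_density CARD('n) s) \<le> (2 * pi * C0) * (1 * radial_density CARD('n) t)"
          using C0 by (intro mult_left_mono) auto
        moreover have "norm (A s) \<le> (2 * pi * C0) * (min 1 s * radial_density CARD('n) s)"
          using nA[OF s(1)] by (simp only: mult.assoc)
        ultimately show ?thesis unfolding mult_1_left by (rule order_trans[rotated])
      qed
      moreover have "0 \<le> (2 * pi * C0) * radial_density CARD('n) t" using C0 by simp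
      ultimately show "norm (indicator {0..t} s *\<^sub>R A s) \<le> (2 * pi * C0) * (radial_density CARD('n) t * indicator {0..t} s) + norm (A 0) * indicator {0} s"
        by (cases "s = 0") (auto split: split_indicator)
    qed measurable
  qed (use integrable_radial_weight b_nonneg in auto)
  have "(LINT x|lborel. (b (norm x) / \<bar>norm x\<bar>) *\<^sub>R H x) = (LINT x|lborel. (\<Sum>j\<in>UNIV. kern j x *\<^sub>R U j x))"
    by (simp add: H_def kern_def r_eq scaleR_sum_right mult.commute)
  also have "\<dots> = (\<Sum>j\<in>UNIV. LINT x|lborel. kern j x *\<^sub>R U j x)"
    unfolding U_def G_def by (rule Bochner_Integration.integral_sum, rule kern_ft_odd_part(1)[OF g xg])
  also have "\<dots> = (\<Sum>j\<in>UNIV. - \<i> * (LINT \<xi>|lborel. g j \<xi> * of_real (sym j \<xi>)))"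
    unfolding U_def G_def kern_ft_odd_part(2)[OF g xg] ..
  also have "\<dots> = - \<i> * (\<Sum>j\<in>UNIV. LINT \<xi>|lborel. g j \<xi> * of_real (sym j \<xi>))" by (simp only: sum_distrib_left)
  finally have L: "(LINT x|lborel. (b (norm x) / \<bar>norm x\<bar>) *\<^sub>R H x) = - \<i> * (\<Sum>j\<in>UNIV. LINT \<xi>|lborel. g j \<xi> * of_real (sym j \<xi>))" .
  have "(LINT t|lborel. indicator {0<..} t *\<^sub>R ((b t / \<bar>t\<bar>) *\<^sub>R A t))
      = (LINT t|lborel. (- (2 * of_real pi * \<i>)) * (indicator {0<..} t *\<^sub>R ((b t / \<bar>t\<bar>) *\<^sub>R (LINT x|lborel. indicator {..t} (norm x) *\<^sub>R \<Phi> x))))"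
    unfolding A_def by (simp only: mult_scaleR_right)
  also have "\<dots> = (- (2 * of_real pi * \<i>)) * (LINT t|lborel. indicator {0<..} t *\<^sub>R ((b t / \<bar>t\<bar>) *\<^sub>R (LINT x|lborel. indicator {..t} (norm x) *\<^sub>R \<Phi> x)))"
    by (rule integral_mult_right_zero)
  also have "(LINT t|lborel. indicator {0<..} t *\<^sub>R ((b t / \<bar>t\<bar>) *\<^sub>R (LINT x|lborel. indicator {..t} (norm x) *\<^sub>R \<Phi> x)))
      = (LINT x|lborel. of_real (Qb (norm x)) * \<Phi> x)"
    by (rule Qb_pairing_ball[symmetric, OF \<Phi> C0 C0b])
  finally have "(- (2 * of_real pi * \<i>)) * (LINT x|lborel. of_real (Qb (norm x)) * \<Phi> x) = - \<i> * (\<Sum>j\<in>UNIV. LINT \<xi>|lborel. g j \<xi> * of_real (sym j \<xi>))"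
    using transfer L by simp
  then show ?thesis by (simp add: field_simps)
qed

end



section \<open>The Fourier transform of the kernel potential\<close>

text \<open>The predicate need not be measurable. A Borel exceptional set can be transported under
  push-forwards and used with Fubini.\<close>

lemma AE_lborel_null_set:
  fixes P :: "'a::euclidean_space \<Rightarrow> bool"
  assumes "AE x in lborel. P x"
  obtains N where "N \<in> sets borel" "AE x in lborel. x \<notin> N" "\<And>x. x \<notin> N \<Longrightarrow> P x"
proof -
  from assms obtain N where N: "N \<in> null_sets lborel" "{x \<in> space lborel. \<not> P x} \<subseteq> N"
    unfolding eventually_ae_filter by blast
  show thesis
  proof (rule that[of N])
    show "N \<in> sets borel" using N(1) by auto
    then show "AE x in lborel. x \<notin> N" using N(1) by (subst AE_iff_null_sets[symmetric]) auto
    show "P x" if "x \<notin> N" for x using N(2) that by auto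
  qed
qed

lemma AE_affine:
  fixes t :: "'a::euclidean_space"
  assumes ae: "AE x in lborel. P x" and c: "c \<noteq> 0"
  shows "AE x in lborel. P (t + c *\<^sub>R x)"
proof -
  obtain N where [measurable]: "N \<in> sets borel" and "AE x in lborel. x \<notin> N" and N: "\<And>x. x \<notin> N \<Longrightarrow> P x"
    using AE_lborel_null_set[OF ae] by blast
  then have "AE x in density (distr lborel borel (\<lambda>x. t + c *\<^sub>R x)) (\<lambda>_. \<bar>c\<bar>^DIM('a)). x \<notin> N"
    unfolding lborel_affine[OF c, of t, symmetric] by simp
  then have "AE x in lborel. t + c *\<^sub>R x \<notin> N"
    using c by (simp add: AE_density AE_distr_iff)
  then show ?thesis by eventually_elim (rule N)
qed

lemma AE_reflect: "AE x in lborel. P x \<Longrightarrow> AE x in lborel. P (t - x)" for t :: "'a::euclidean_space"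
  using AE_affine[of P "-1" t] by simp

text \<open>A null set of radii pulls back to a null set of points because the push-forward of
  Lebesgue measure under the norm has a density.\<close>

lemma AE_norm:
  assumes "AE t in lborel. P t"
  shows "AE x in (lborel :: 'a::euclidean_space measure). P (norm x)"
proof -
  obtain N where [measurable]: "N \<in> sets borel" and "AE x in lborel. x \<notin> N" and N: "\<And>x. x \<notin> N \<Longrightarrow> P x"
    using AE_lborel_null_set[OF assms] by blast
  then have "AE x in distr lborel borel (norm :: 'a \<Rightarrow> real). x \<notin> N"
    unfolding distr_norm_lborel by (subst AE_density) (auto elim: eventually_mono)
  then have "AE x in (lborel :: 'a measure). norm x \<notin> N" by (simp add: AE_distr_iff)
  then show ?thesis by eventually_elim (rule N)
qed

text \<open>The bridge from the completed measure to Borel representatives. No measurability of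
  \<open>f\<close> is assumed, since it agrees with \<open>g\<close> off a null set.\<close>

lemma integral_lebesgue_cong_AE:
  fixes f g :: "'a::euclidean_space \<Rightarrow> 'b::euclidean_space"
  assumes g: "g \<in> borel_measurable borel" and ae: "AE x in lborel. f x = g x"
  shows "integral\<^sup>L lebesgue f = integral\<^sup>L lborel g" "integrable lebesgue f \<longleftrightarrow> integrable lborel g"
    "f \<in> borel_measurable lebesgue"
proof -
  have gl: "g \<in> borel_measurable lebesgue" using g by (simp add: measurable_completion)
  have ae': "AE x in lebesgue. g x = f x" using AE_completion[OF ae] by (auto elim: eventually_mono)
  show fl: "f \<in> borel_measurable lebesgue" by (rule borel_measurable_AE[OF gl ae'])
  have ae2: "AE x in lebesgue. f x = g x" by (rule AE_completion[OF ae])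
  show "integral\<^sup>L lebesgue f = integral\<^sup>L lborel g"
    using integral_cong_AE[OF fl gl ae2] g by (simp add: integral_completion)
  show "integrable lebesgue f \<longleftrightarrow> integrable lborel g"
    using integrable_cong_AE[OF fl gl ae2] g by (simp add: integrable_completion)
qed

lemma radial_rep_norm: "radial \<rho> \<Longrightarrow> x \<noteq> 0 \<Longrightarrow> radial_rep \<rho> (norm x) = \<rho> x"
  unfolding radial_rep_def
proof (rule the_equality)
  assume *: "radial \<rho>" "x \<noteq> 0"
  then show "\<forall>y. norm y = norm x \<longrightarrow> \<rho> y = \<rho> x" unfolding radial_def by (metis norm_eq_zero)
  show "c = \<rho> x" if "\<forall>y. norm y = norm x \<longrightarrow> \<rho> y = c" for c using that by auto
qed

text \<open>A Borel representative of the radial profile is read off along a ray that meets a null set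
  in a null set; almost every ray does.\<close>

lemma radial_borel_rep:
  fixes \<rho> :: "real^'n \<Rightarrow> real"
  assumes rad: "radial \<rho>" and nonneg: "\<And>x. x \<noteq> 0 \<Longrightarrow> 0 \<le> \<rho> x" and meas: "\<rho> \<in> borel_measurable lebesgue"
  obtains b where "b \<in> borel_measurable borel" "\<forall>t. 0 \<le> b t"
    "AE t in lborel. 0 < t \<longrightarrow> radial_rep \<rho> t = b t" "AE x in lborel. \<rho> x = b (norm x)"
proof -
  obtain \<rho>' where [measurable]: "\<rho>' \<in> borel_measurable borel" and ae\<rho>: "AE x in lborel. \<rho> x = \<rho>' x"
    using completion_ex_borel_measurable_real[OF meas] by auto
  obtain N where [measurable]: "N \<in> sets borel" and aeN: "AE x in lborel. x \<notin> N" and N: "\<And>x. x \<notin> N \<Longrightarrow> \<rho> x = \<rho>' x"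
    using AE_lborel_null_set[OF ae\<rho>] by blast
  have "AE s in lborel. AE x in lborel. 0 < s \<longrightarrow> s *\<^sub>R x \<notin> N"
  proof (rule AE_I2)
    fix s :: real
    show "AE x in lborel. 0 < s \<longrightarrow> s *\<^sub>R x \<notin> N"
      using AE_affine[OF aeN, of s 0] by (cases "0 < s") auto
  qed
  then have "AE x in lborel. AE s in lborel. 0 < s \<longrightarrow> s *\<^sub>R x \<notin> N"
    by (subst lborel_pair.AE_commute) measurable
  with AE_lborel_singleton[of "0 :: real^'n"] have "AE x in lborel. x \<noteq> 0 \<and> (AE s in lborel. 0 < s \<longrightarrow> s *\<^sub>R x \<notin> N)"
    by eventually_elim auto
  then obtain e where e: "e \<noteq> 0" and ae: "AE s in lborel. 0 < s \<longrightarrow> s *\<^sub>R e \<notin> N"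
  proof -
    assume *: "AE x in lborel. x \<noteq> (0 :: real^'n) \<and> (AE s in lborel. 0 < s \<longrightarrow> s *\<^sub>R x \<notin> N)"
    have "ae_filter (lborel :: (real^'n) measure) \<noteq> bot"
      by (simp add: ae_filter_eq_bot_iff)
    from eventually_happens'[OF this *] that show thesis by auto
  qed
  \<comment> \<open>\<open>\<rho>'\<close> may be negative on the null set where it differs from
    \<open>\<rho>\<close>, and b is wanted nonnegative everywhere.\<close>
  define b where "b t = (if 0 < t then max 0 (\<rho>' ((t / norm e) *\<^sub>R e)) else 0)" for t
  have [measurable]: "b \<in> borel_measurable borel" unfolding b_def by measurable
  have "AE t in lborel. 0 < t / norm e \<longrightarrow> (t / norm e) *\<^sub>R e \<notin> N"
    using AE_affine[OF ae, of "1 / norm e" 0] e by simp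
  then have rep: "AE t in lborel. 0 < t \<longrightarrow> radial_rep \<rho> t = b t"
  proof eventually_elim
    case (elim t)
    show ?case
    proof
      assume t: "0 < t"
      define y where "y = (t / norm e) *\<^sub>R e"
      have y: "norm y = t" "y \<noteq> 0" using t e by (auto simp: y_def)
      have "y \<notin> N" using elim t e by (simp add: y_def)
      then have "\<rho> y = \<rho>' y" by (rule N)
      moreover have "radial_rep \<rho> t = \<rho> y" using radial_rep_norm[OF rad y(2)] y(1) by simp
      ultimately show "radial_rep \<rho> t = b t" using nonneg[OF y(2)] t by (simp add: b_def y_def)
    qed
  qed
  have "AE x in lborel. \<rho> x = b (norm x)"
    using AE_norm[OF rep, where 'a="real^'n"] AE_lborel_singleton[of "0 :: real^'n"]
    by eventually_elim (use radial_rep_norm[OF rad] in auto)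
  then show thesis using rep by (intro that[of b]) (auto simp: b_def)
qed

text \<open>The potential depends on the radial profile as a function on the line, the nonlocal
  operators on the values of the kernel in space. The Borel representative is therefore tied to
  \<open>\<rho>\<close> in both forms.\<close>

locale represented_kernel = radial_kernel b r for b :: "real \<Rightarrow> real" and r :: "real^'n \<Rightarrow> real" +
  fixes \<rho> :: "real^'n \<Rightarrow> real"
  assumes rep_eq: "AE t in lborel. 0 < t \<longrightarrow> radial_rep \<rho> t = b t"
    and \<rho>_eq: "AE x in lborel. \<rho> x = r x"
begin

lemma Q_kernel_eq: "Q_kernel \<rho> x = Qb (norm x)"
  unfolding Q_kernel_def Qb_def set_lebesgue_integral_def
proof (rule integral_lebesgue_cong_AE)
  show "AE t in lborel. indicator {norm x<..} t *\<^sub>R (radial_rep \<rho> t / t) = indicator {norm x<..} t * (b t / t)"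
    using rep_eq
  proof eventually_elim
    case (elim t)
    then show ?case using norm_ge_zero[of x] by (auto split: split_indicator simp del: norm_ge_zero)
  qed
qed measurable

lemma fourier_Q_eq:
  assumes \<phi>: "schwartz \<phi>"
  shows "fourier_dist (regular_dist (\<lambda>x. of_real (Q_kernel \<rho> x))) \<phi> = (LINT x|lborel. of_real (Qb (norm x)) * ft \<phi> x)"
proof -
  have [measurable]: "\<phi> \<in> borel_measurable borel" "ft \<phi> \<in> borel_measurable borel"
    using schwartz_measurable[OF \<phi>] ft_measurable[OF schwartz_integrable[OF \<phi>]] by auto
  have "(\<lambda>x. of_real (Qb (norm x)) * ft \<phi> x) \<in> borel_measurable borel"
    unfolding Qb_def indicator_def greaterThan_iff by measurable
  then show ?thesis
    unfolding fourier_dist_def regular_dist_def Q_kernel_eq fourier_eq_ft(1)[OF schwartz_measurable[OF \<phi>]]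
    by (simp add: integral_completion)
qed

lemma ft_schwartz_integrable:
  assumes "schwartz (f :: real^'n \<Rightarrow> complex)"
  shows "integrable lborel (ft f)"
  using schwartz_ft_integrable_weight[OF assms, of "\<lambda>_. 1" 1 0] by simp

section \<open>Identification of the symbol\<close>

lemma Q_pairing_coordinate:
  assumes \<phi>: "test_fun_off_zero \<phi>"
  shows "fourier_dist (regular_dist (\<lambda>x. of_real (Q_kernel \<rho> x))) (\<lambda>\<xi>. of_real (\<xi> $ j) * \<phi> \<xi>)
    = (LINT \<xi>|lborel. \<phi> \<xi> * of_real (sym j \<xi>)) / (2 * of_real pi)"
proof -
  define g where "g i \<xi> = (if i = j then \<phi> \<xi> else 0)" for i \<xi>
  have s: "schwartz \<phi>" by (rule test_fun_schwartz[OF \<phi>])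
  have sj: "schwartz (\<lambda>\<xi>. of_real (\<xi> $ j) * \<phi> \<xi>)" for j by (rule test_fun_schwartz[OF test_fun_coordinate_mult[OF \<phi>]])
  have [measurable]: "\<phi> \<in> borel_measurable borel" by (rule schwartz_measurable[OF s])
  have sum: "(\<Sum>i\<in>UNIV. of_real (\<xi> $ i) * g i \<xi>) = of_real (\<xi> $ j) * \<phi> \<xi>" for \<xi>
    by (simp add: g_def if_distrib[of "\<lambda>t. _ * t"] sum.delta cong: if_cong)
  have xI: "integrable lborel (\<lambda>\<xi>. norm \<xi> * norm (\<phi> \<xi>))"
  proof (rule integrable_real_bound[of _ "\<lambda>\<xi>. \<Sum>i\<in>UNIV. norm (of_real (\<xi> $ i) * \<phi> \<xi>)"])
    show "integrable lborel (\<lambda>\<xi>. \<Sum>i\<in>UNIV. norm (of_real (\<xi> $ i) * \<phi> \<xi>))"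
      by (intro Bochner_Integration.integrable_sum integrable_norm schwartz_integrable sj)
    show "norm (norm \<xi> * norm (\<phi> \<xi>)) \<le> (\<Sum>i\<in>UNIV. norm (of_real (\<xi> $ i) * \<phi> \<xi>))" for \<xi>
      using mult_right_mono[OF norm_le_l1_cart[of \<xi>], of "norm (\<phi> \<xi>)"] by (simp add: norm_mult sum_distrib_right)
  qed measurable
  have "(LINT x|lborel. of_real (Qb (norm x)) * ft (\<lambda>\<xi>. \<Sum>i\<in>UNIV. of_real (\<xi> $ i) * g i \<xi>) x)
      = (\<Sum>i\<in>UNIV. LINT \<xi>|lborel. g i \<xi> * of_real (sym i \<xi>)) / (2 * of_real pi)"
  proof (rule Qb_pairing)
    show "integrable lborel (g i)" for i using schwartz_integrable[OF s] by (cases "i = j") (auto simp: g_def[abs_def])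
    show "integrable lborel (\<lambda>\<xi>. norm \<xi> * norm (g i \<xi>))" for i using xI by (cases "i = j") (auto simp: g_def[abs_def])
    show "integrable lborel (ft (\<lambda>\<xi>. \<Sum>i\<in>UNIV. of_real (\<xi> $ i) * g i \<xi>))"
      unfolding sum by (rule ft_schwartz_integrable[OF sj])
  qed
  moreover have "(\<Sum>i\<in>UNIV. LINT \<xi>|lborel. g i \<xi> * of_real (sym i \<xi>)) = (\<Sum>i\<in>UNIV. if i = j then LINT \<xi>|lborel. \<phi> \<xi> * of_real (sym j \<xi>) else 0)"
    by (intro sum.cong refl) (auto simp: g_def)
  ultimately show ?thesis unfolding fourier_Q_eq[OF sj] sum by simp
qed

text \<open>If 2 pi \<open>\<xi> $ j\<close> q = \<open>sym j\<close> is to hold for every j,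
  multiplying by \<open>\<xi> $ j\<close> and summing forces the candidate q = (\<xi>.s) / (2 pi
  |\<xi>|^2), where s is the vector of the \<open>sym j\<close>. It represents the distribution by
  \<open>Qb_pairing\<close>, without knowing that s is parallel to \<open>\<xi>\<close>.\<close>

lemma ex_Q_hat:
  "\<exists>q. continuous_on (- {0}) q \<and>
     given_off_zero_by (fourier_dist (regular_dist (\<lambda>x. of_real (Q_kernel \<rho> x)))) q"
proof -
  define q0 where "q0 \<xi> = (\<Sum>j\<in>UNIV. of_real (\<xi> $ j / (norm \<xi>)\<^sup>2) * complex_of_real (sym j \<xi>)) / (2 * of_real pi)" for \<xi>
  have cont: "continuous_on (- {0}) q0"
    unfolding q0_def
    by (intro continuous_intros continuous_on_subset[OF sym_continuous] continuous_on_component) auto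
  have "given_off_zero_by (fourier_dist (regular_dist (\<lambda>x. of_real (Q_kernel \<rho> x)))) q0"
    unfolding given_off_zero_by_def
  proof (intro conjI allI impI)
    fix S :: "(real^'n) set" assume S: "compact S \<and> 0 \<notin> S"
    then have "continuous_on S q0" by (intro continuous_on_subset[OF cont]) auto
    then have "integrable lborel (\<lambda>x. indicator S x *\<^sub>R q0 x)" using S by (intro borel_integrable_compact) auto
    then show "set_integrable lebesgue S q0"
      unfolding set_integrable_def by (subst integrable_completion) auto
  next
    fix \<phi> :: "real^'n \<Rightarrow> complex" assume \<phi>: "test_fun_off_zero \<phi>"
    have s: "schwartz \<phi>" by (rule test_fun_schwartz[OF \<phi>])
    have [measurable]: "\<phi> \<in> borel_measurable borel" by (rule schwartz_measurable[OF s])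
    obtain \<delta> where \<delta>: "0 < \<delta>" "\<And>x. norm x < \<delta> \<Longrightarrow> \<phi> x = 0" using test_fun_zero_near[OF \<phi>] by auto
    \<comment> \<open>A decomposition of \<open>\<phi>\<close> as the sum of the
      \<open>\<xi> $ j\<close> times \<open>g j \<xi>\<close>. It is harmless because
      \<open>\<phi>\<close> vanishes near the origin.\<close>
    define g where "g j \<xi> = of_real (\<xi> $ j / (norm \<xi>)\<^sup>2) * \<phi> \<xi>" for j \<xi>
    have [measurable]: "g j \<in> borel_measurable borel" for j unfolding g_def by measurable
    have gle: "norm \<xi> * norm (g j \<xi>) \<le> norm (\<phi> \<xi>)" for j \<xi>
    proof (cases "\<xi> = 0")
      case False
      have "norm \<xi> * (\<bar>\<xi> $ j\<bar> / (norm \<xi>)\<^sup>2) \<le> 1"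
        using component_le_norm_cart[of \<xi> j] False by (simp add: power2_eq_square divide_simps)
      then have "norm \<xi> * (\<bar>\<xi> $ j\<bar> / (norm \<xi>)\<^sup>2) * norm (\<phi> \<xi>) \<le> 1 * norm (\<phi> \<xi>)" by (rule mult_right_mono) simp
      then show ?thesis by (simp add: g_def norm_mult norm_divide norm_power)
    qed simp
    have xg: "integrable lborel (\<lambda>\<xi>. norm \<xi> * norm (g j \<xi>))" for j
      by (rule integrable_real_bound[OF integrable_norm[OF schwartz_integrable[OF s]]]) (use gle in auto)
    have gI: "integrable lborel (g j)" for j
    proof (rule integrable_real_bound[OF integrable_mult_right[OF integrable_norm[OF schwartz_integrable[OF s]], of "1 / \<delta>"]])
      fix \<xi>
      show "norm (g j \<xi>) \<le> 1 / \<delta> * norm (\<phi> \<xi>)"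
      proof (cases "norm \<xi> < \<delta>")
        case False
        have "\<delta> * norm (g j \<xi>) \<le> norm \<xi> * norm (g j \<xi>)" using False by (intro mult_right_mono) auto
        then show ?thesis using gle[of \<xi> j] \<delta>(1) by (simp add: field_simps)
      qed (use \<delta> in \<open>simp add: g_def\<close>)
    qed simp
    have sum: "(\<Sum>j\<in>UNIV. of_real (\<xi> $ j) * g j \<xi>) = \<phi> \<xi>" for \<xi>
    proof (cases "\<xi> = 0")
      case True
      then show ?thesis using \<delta> by (simp add: g_def)
    next
      case False
      have e: "(norm \<xi>)\<^sup>2 = (\<Sum>j\<in>UNIV. \<xi> $ j * \<xi> $ j)" by (simp add: power2_norm_eq_inner inner_vec_def)
      have "(\<Sum>j\<in>UNIV. \<xi> $ j * (\<xi> $ j / (norm \<xi>)\<^sup>2)) = (\<Sum>j\<in>UNIV. \<xi> $ j * \<xi> $ j) / (norm \<xi>)\<^sup>2"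
        by (simp add: sum_divide_distrib)
      also have "\<dots> = 1" unfolding e[symmetric] using False by simp
      finally have "(\<Sum>j\<in>UNIV. \<xi> $ j * (\<xi> $ j / (norm \<xi>)\<^sup>2)) = 1" .
      then have "complex_of_real (\<Sum>j\<in>UNIV. \<xi> $ j * (\<xi> $ j / (norm \<xi>)\<^sup>2)) * \<phi> \<xi> = \<phi> \<xi>" by simp
      then show ?thesis by (simp only: of_real_sum of_real_mult sum_distrib_right g_def mult.assoc)
    qed
    have "fourier_dist (regular_dist (\<lambda>x. of_real (Q_kernel \<rho> x))) \<phi> = (\<Sum>j\<in>UNIV. LINT \<xi>|lborel. g j \<xi> * of_real (sym j \<xi>)) / (2 * of_real pi)"
      unfolding fourier_Q_eq[OF s] by (rule Qb_pairing[where g=g, OF gI xg, unfolded sum]) (rule ft_schwartz_integrable[OF s])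
    also have "(\<Sum>j\<in>UNIV. LINT \<xi>|lborel. g j \<xi> * of_real (sym j \<xi>)) = (LINT \<xi>|lborel. (\<Sum>j\<in>UNIV. g j \<xi> * of_real (sym j \<xi>)))"
    proof (rule Bochner_Integration.integral_sum[symmetric])
      fix j
      show "integrable lborel (\<lambda>\<xi>. g j \<xi> * of_real (sym j \<xi>))"
      proof (rule integrable_real_bound[of _ "\<lambda>\<xi>. wt_mass * norm (g j \<xi>) + (2 * pi * wt_mass) * (norm \<xi> * norm (g j \<xi>))"])
        show "integrable lborel (\<lambda>\<xi>. wt_mass * norm (g j \<xi>) + (2 * pi * wt_mass) * (norm \<xi> * norm (g j \<xi>)))"
          by (intro Bochner_Integration.integrable_add integrable_mult_right xg integrable_norm gI)
        show "norm (g j \<xi> * of_real (sym j \<xi>)) \<le> wt_mass * norm (g j \<xi>) + (2 * pi * wt_mass) * (norm \<xi> * norm (g j \<xi>))" for \<xi>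
          using mult_left_mono[OF sym_bound[of j \<xi>], of "norm (g j \<xi>)"] by (simp add: norm_mult algebra_simps)
      qed measurable
    qed
    also have "\<dots> / (2 * of_real pi) = (LINT \<xi>|lborel. (\<Sum>j\<in>UNIV. g j \<xi> * of_real (sym j \<xi>)) / (2 * of_real pi))"
      by simp
    also have "\<dots> = (LINT \<xi>|lborel. q0 \<xi> * \<phi> \<xi>)"
    proof (rule Bochner_Integration.integral_cong[OF refl])
      fix \<xi>
      have "(\<Sum>j\<in>UNIV. g j \<xi> * of_real (sym j \<xi>)) = (\<Sum>j\<in>UNIV. of_real (\<xi> $ j / (norm \<xi>)\<^sup>2) * complex_of_real (sym j \<xi>)) * \<phi> \<xi>"
        unfolding sum_distrib_right by (intro sum.cong refl) (simp only: g_def ac_simps)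
      then show "(\<Sum>j\<in>UNIV. g j \<xi> * of_real (sym j \<xi>)) / (2 * of_real pi) = q0 \<xi> * \<phi> \<xi>"
        unfolding q0_def by simp
    qed
    also have "\<dots> = regular_dist q0 \<phi>"
      unfolding regular_dist_def by (rule integral_completion[symmetric]) (unfold q0_def, measurable)
    finally show "fourier_dist (regular_dist (\<lambda>x. of_real (Q_kernel \<rho> x))) \<phi> = regular_dist q0 \<phi>" .
  qed
  with cont show ?thesis by blast
qed

text \<open>Testing with \<open>\<xi> $ j\<close> times mollifiers compares two continuous functions
  off the origin, for each j separately. As a consequence the vector of the \<open>sym j\<close> is
  parallel to \<open>\<xi>\<close>, with no rotation argument.\<close>

lemma Q_hat_eq:
  assumes "\<xi> \<noteq> 0"
  shows "of_real (\<xi> $ j) * Q_hat \<rho> \<xi> = of_real (sym j \<xi> / (2 * pi))"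
proof -
  let ?q = "Q_hat \<rho>"
  have q: "continuous_on (- {0}) ?q"
    and given: "given_off_zero_by (fourier_dist (regular_dist (\<lambda>x. of_real (Q_kernel \<rho> x)))) ?q"
    using someI_ex[OF ex_Q_hat] unfolding Q_hat_def by auto
  define f where "f y = of_real (y $ j) * ?q y - of_real (sym j y / (2 * pi))" for y
  have c1: "continuous_on (- {0}) (\<lambda>y. of_real (y $ j) * ?q y)" by (intro continuous_intros q)
  have c2: "continuous_on (- {0}) (\<lambda>y. complex_of_real (sym j y / (2 * pi)))"
    by (intro continuous_intros continuous_on_subset[OF sym_continuous]) auto
  have I: "integrable lborel (\<lambda>y. F y * of_real (moll d (h - y)))"
    if F: "continuous_on (- {0}) F" and d: "0 < d" "d < norm h" for F :: "real^'n \<Rightarrow> complex" and d h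
  proof -
    have 0: "cball h d \<subseteq> - {0}" using d by auto
    have m: "continuous_on UNIV (\<lambda>y. complex_of_real (moll d (h - y)))"
      by (rule smooth_fun_continuous[OF smooth_fun_moll])
    have "integrable lborel (\<lambda>y. indicator (cball h d) y *\<^sub>R (F y * of_real (moll d (h - y))))"
      by (intro borel_integrable_compact continuous_on_mult continuous_on_subset[OF F 0] continuous_on_subset[OF m]) auto
    moreover have "indicator (cball h d) y *\<^sub>R (F y * of_real (moll d (h - y))) = F y * of_real (moll d (h - y))" for y
      using moll_zero[OF d(1), of "h - y"] by (auto simp: dist_norm split: split_indicator)
    ultimately show ?thesis by (simp only:)
  qed
  have "f \<xi> = 0"
  proof (rule continuous_off_zero_eq_0[OF _ _ assms])
    show "continuous_on (- {0}) f" unfolding f_def by (intro continuous_on_diff c1 c2)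
    fix d :: real and h :: "real^'n" assume d: "0 < d" "d < norm h"
    let ?\<phi> = "\<lambda>y. complex_of_real (moll d (h - y))"
    have \<phi>: "test_fun_off_zero ?\<phi>" by (rule test_fun_moll[OF d])
    have "regular_dist ?q (\<lambda>\<xi>. of_real (\<xi> $ j) * ?\<phi> \<xi>) = (LINT \<xi>|lborel. ?\<phi> \<xi> * of_real (sym j \<xi>)) / (2 * of_real pi)"
      unfolding Q_pairing_coordinate[OF \<phi>, of j, symmetric]
      using given test_fun_coordinate_mult[OF \<phi>, of j] unfolding given_off_zero_by_def by simp
    moreover have "regular_dist ?q (\<lambda>\<xi>. of_real (\<xi> $ j) * ?\<phi> \<xi>) = (LINT y|lborel. of_real (y $ j) * ?q y * ?\<phi> y)"
    proof -
      have [measurable]: "?q \<in> borel_measurable borel"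
        by (rule borel_measurable_continuous_countable_exceptions[OF _ q]) simp
      show ?thesis unfolding regular_dist_def by (subst integral_completion) (auto simp: mult_ac)
    qed
    moreover have "(LINT \<xi>|lborel. ?\<phi> \<xi> * of_real (sym j \<xi>)) / (2 * of_real pi) = (LINT y|lborel. of_real (sym j y / (2 * pi)) * ?\<phi> y)"
      unfolding integral_divide_zero[symmetric] by (simp add: mult_ac)
    ultimately show "(LINT y|lborel. f y * ?\<phi> y) = 0"
      using I[OF c1 d] I[OF c2 d] by (simp add: f_def left_diff_distrib)
  qed
  then show ?thesis by (simp add: f_def)
qed

lemma lambda_symbol_component: "lambda_symbol \<rho> \<xi> $ j = \<i> * of_real (sym j \<xi>)"
proof (cases "\<xi> = 0")
  case False
  have "lambda_symbol \<rho> \<xi> $ j = 2 * of_real pi * \<i> * (of_real (\<xi> $ j) * Q_hat \<rho> \<xi>)"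
    by (simp add: lambda_symbol_def mult.assoc)
  then show ?thesis unfolding Q_hat_eq[OF False] by simp
qed (simp add: lambda_symbol_def)

lemma norm_lambda_symbol: "(norm (lambda_symbol \<rho> \<xi>))\<^sup>2 = psi \<xi>"
  by (simp add: norm_vec_def L2_set_def sum_nonneg lambda_symbol_component psi_def norm_mult)

text \<open>Because \<open>psi\<close> is even, the inverse transform in the definition may be
  replaced by the forward one.\<close>

lemma K_dist_eq:
  assumes \<phi>: "schwartz \<phi>"
  shows "K_dist \<rho> \<phi> = - (LINT \<xi>|lborel. psi \<xi> *\<^sub>R ft \<phi> \<xi>)"
proof -
  have [measurable]: "ft \<phi> \<in> borel_measurable borel"
    using ft_measurable[OF schwartz_integrable[OF \<phi>]] by auto
  have "K_dist \<rho> \<phi> = (LINT \<xi>|lborel. - of_real (psi \<xi>) * ft \<phi> (- \<xi>))"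
    unfolding K_dist_def inverse_fourier_dist_def regular_dist_def norm_lambda_symbol
      fourier_eq_ft(2)[OF schwartz_measurable[OF \<phi>]]
    by (rule integral_completion) measurable
  also have "\<dots> = (LINT \<xi>|lborel. - of_real (psi (- \<xi>)) * ft \<phi> (- (- \<xi>)))"
    by (rule lborel_integral_minus(2)[symmetric]) measurable
  also have "\<dots> = (LINT \<xi>|lborel. - (psi \<xi> *\<^sub>R ft \<phi> \<xi>))" by (simp add: scaleR_conv_of_real)
  finally show ?thesis by simp
qed

section \<open>The nonlocal Laplacian in Fourier variables\<close>

text \<open>Components may be taken under the integral only for integrable vector functions, since
  the integral of a non-integrable function is 0 by default. This secures the components of the
  nonlocal gradient.\<close>

lemma integrable_vec:
  fixes f :: "'a \<Rightarrow> complex ^ 'm"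
  assumes "\<And>j. integrable M (\<lambda>x. f x $ j)"
  shows "integrable M f"
proof -
  have lin: "bounded_linear (axis j :: complex \<Rightarrow> complex ^ 'm)" for j
    by (rule linear_conv_bounded_linear[THEN iffD1]) (auto intro!: linearI simp: axis_def vec_eq_iff)
  have "integrable M (\<lambda>x. \<Sum>j\<in>UNIV. axis j (f x $ j))"
    by (intro Bochner_Integration.integrable_sum integrable_bounded_linear[OF lin] assms)
  moreover have "(\<Sum>j\<in>UNIV. axis j (v $ j)) = v" for v :: "complex ^ 'm"
    by (simp add: vec_eq_iff axis_def if_distrib sum.delta cong: if_cong)
  ultimately show ?thesis by simp
qed

lemma nonlocal_grad_component:
  fixes u :: "real^'n \<Rightarrow> complex"
  assumes u: "\<And>y. u y = ft a (- y)" and a: "integrable lborel a" and xa: "integrable lborel (\<lambda>\<xi>. norm \<xi> * norm (a \<xi>))"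
  shows "nonlocal_grad \<rho> u x $ j = ft (\<lambda>\<xi>. \<i> * of_real (sym j \<xi>) * a \<xi>) (- x)"
proof -
  have [measurable]: "u \<in> borel_measurable borel" unfolding u[abs_def] using ft_measurable[OF a] by measurable
  define W where "W y = (\<chi> j. kern j (x - y) *\<^sub>R (u x - u y))" for y
  have Wz: "W y $ j = (\<lambda>z. kern j z *\<^sub>R (ft a (- x) - ft a (- (x - z)))) (x - y)" for y j
    by (simp add: W_def u)
  have m: "(\<lambda>z. kern j z *\<^sub>R (ft a (- x) - ft a (- (x - z)))) \<in> borel_measurable borel" for j
    using ft_measurable[OF a] by measurable
  have Wj: "integrable lborel (\<lambda>y. W y $ j)" "(LINT y|lborel. W y $ j) = ft (\<lambda>\<xi>. \<i> * of_real (sym j \<xi>) * a \<xi>) (- x)" for j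
    unfolding Wz using kern_difference_integral[OF a xa, of j x]
    by (simp_all only: lborel_integrable_minus(1)[OF m[of j], of x] lborel_integral_minus(1)[OF m[of j], of x])
  have WI: "integrable lborel W" by (rule integrable_vec) (rule Wj(1))
  have "nonlocal_grad \<rho> u x = (LINT y|lborel. W y)"
    unfolding nonlocal_grad_def
  proof (rule integral_lebesgue_cong_AE)
    show "W \<in> borel_measurable borel" using WI by auto
    show "AE y in lborel. (\<chi> j. (u x - u y) / of_real (norm (x - y)) * of_real ((x - y) $ j / norm (x - y)) * of_real (\<rho> (x - y))) = W y"
      using AE_reflect[OF \<rho>_eq, of x]
      by eventually_elim (simp add: W_def kern_def vec_eq_iff scaleR_conv_of_real mult_ac)
  qed
  then show ?thesis using Wj(2)[of j] integral_bounded_linear[OF bounded_linear_vec_nth WI, of j] by simp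
qed

text \<open>The nonlocal gradient need not be a Schwartz function. Its components are transforms of
  the functions \<open>c j\<close>, which are integrable with a first moment, and this is enough to
  apply \<open>kern_difference_integral\<close> a second time. Each application costs one power of 1
  + |\<xi>|, paid for by the decay of \<open>ft u\<close>.\<close>

lemma nonlocal_laplacian_eq:
  fixes u :: "real^'n \<Rightarrow> complex"
  assumes s: "schwartz u"
  shows "nonlocal_laplacian \<rho> u x = - ft (\<lambda>\<xi>. psi \<xi> *\<^sub>R ft u \<xi>) (- x)"
    and "integrable lborel (\<lambda>\<xi>. psi \<xi> *\<^sub>R ft u \<xi>)"
    and "u y = ft (ft u) (- y)"
proof -
  define a where "a = ft u"
  have aI: "integrable lborel a" unfolding a_def by (rule ft_schwartz_integrable[OF s])
  have [measurable]: "a \<in> borel_measurable borel" using aI by auto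
  obtain C where C: "\<And>x. norm (iter_partial [] u x) \<le> C / (1 + norm x) ^ 0" using schwartz_decay[OF s, of "[]" 0] by blast
  have ua: "u y = ft a (- y)" for y
    unfolding a_def
  proof (rule ft_inversion[symmetric, where C=C])
    show "integrable lborel u" by (rule schwartz_integrable[OF s])
    show "integrable lborel (ft u)" using aI by (simp add: a_def)
    show "norm (u y) \<le> C" for y using C[of y] by simp
    show "isCont u y" using s smooth_fun_continuous by (auto simp: schwartz_def continuous_on_eq_continuous_at)
  qed
  then show "u y = ft (ft u) (- y)" by (simp add: a_def)
  have w: "integrable lborel (\<lambda>\<xi>. (1 + norm \<xi>) ^ N *\<^sub>R a \<xi>)" for N
    unfolding a_def by (rule schwartz_ft_integrable_weight[OF s, of _ 1 N]) auto
  have w': "integrable lborel f" if [measurable]: "f \<in> borel_measurable borel" and "\<And>\<xi>. norm (f \<xi>) \<le> A * (1 + norm \<xi>) ^ N * norm (a \<xi>)"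
    for f :: "real^'n \<Rightarrow> 'b::{banach, second_countable_topology}" and A N
    by (rule integrable_real_bound[OF integrable_mult_right[OF integrable_norm[OF w], of A N]]) (use that in \<open>auto simp: mult.assoc\<close>)
  have symle: "\<bar>sym j \<xi>\<bar> \<le> 2 * pi * wt_mass * (1 + norm \<xi>)" for j \<xi>
    using sym_bound[of j \<xi>] mult_right_mono[OF one_plus_two_pi_le[of \<xi>] wt_mass_nonneg] by (simp add: ac_simps)
  have xa: "integrable lborel (\<lambda>\<xi>. norm \<xi> * norm (a \<xi>))"
    by (rule w'[of _ 1 1]) (auto intro!: mult_right_mono)
  define c where "c j \<xi> = \<i> * of_real (sym j \<xi>) * a \<xi>" for j \<xi>
  have [measurable]: "c j \<in> borel_measurable borel" for j unfolding c_def by measurable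
  have cle: "norm (c j \<xi>) \<le> 2 * pi * wt_mass * (1 + norm \<xi>) * norm (a \<xi>)" for j \<xi>
    unfolding c_def using mult_right_mono[OF symle[of j \<xi>], of "norm (a \<xi>)"] by (simp add: norm_mult)
  have cI: "integrable lborel (c j)" for j by (rule w'[of _ "2 * pi * wt_mass" 1]) (use cle in auto)
  have xc: "integrable lborel (\<lambda>\<xi>. norm \<xi> * norm (c j \<xi>))" for j
  proof (rule w'[of _ "2 * pi * wt_mass" 2])
    fix \<xi>
    have "norm \<xi> * norm (c j \<xi>) \<le> (1 + norm \<xi>) * (2 * pi * wt_mass * (1 + norm \<xi>) * norm (a \<xi>))"
      by (intro mult_mono cle) auto
    then show "norm (norm \<xi> * norm (c j \<xi>)) \<le> 2 * pi * wt_mass * (1 + norm \<xi>) ^ 2 * norm (a \<xi>)"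
      by (simp add: power2_eq_square ac_simps)
  qed measurable
  define V where "V = nonlocal_grad \<rho> u"
  have V: "V y $ j = ft (c j) (- y)" for y j
    unfolding V_def c_def by (rule nonlocal_grad_component[OF ua aI xa])
  have [measurable]: "(\<lambda>y. V y $ j) \<in> borel_measurable borel" for j
    unfolding V using ft_measurable[OF cI] by measurable
  define W where "W y = (\<Sum>j\<in>UNIV. kern j (x - y) *\<^sub>R (V x $ j - V y $ j))" for y
  have Wz: "kern j (x - y) *\<^sub>R (V x $ j - V y $ j) = (\<lambda>z. kern j z *\<^sub>R (ft (c j) (- x) - ft (c j) (- (x - z)))) (x - y)" for y j
    by (simp add: V)
  have m: "(\<lambda>z. kern j z *\<^sub>R (ft (c j) (- x) - ft (c j) (- (x - z)))) \<in> borel_measurable borel" for j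
    using ft_measurable[OF cI[of j]] by measurable
  have Wj: "integrable lborel (\<lambda>y. kern j (x - y) *\<^sub>R (V x $ j - V y $ j))"
    "(LINT y|lborel. kern j (x - y) *\<^sub>R (V x $ j - V y $ j)) = ft (\<lambda>\<xi>. \<i> * of_real (sym j \<xi>) * c j \<xi>) (- x)" for j
    unfolding Wz using kern_difference_integral[OF cI[of j] xc[of j], of j x]
    by (simp_all only: lborel_integrable_minus(1)[OF m[of j], of x] lborel_integral_minus(1)[OF m[of j], of x])
  have cc: "integrable lborel (\<lambda>\<xi>. \<i> * of_real (sym j \<xi>) * c j \<xi>)" for j
  proof (rule w'[of _ "(2 * pi * wt_mass)\<^sup>2" 2])
    fix \<xi>
    have "\<bar>sym j \<xi>\<bar> * norm (c j \<xi>) \<le> (2 * pi * wt_mass * (1 + norm \<xi>)) * (2 * pi * wt_mass * (1 + norm \<xi>) * norm (a \<xi>))"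
      using wt_mass_nonneg by (intro mult_mono cle symle) auto
    also have "\<dots> = (2 * pi * wt_mass)\<^sup>2 * (1 + norm \<xi>) ^ 2 * norm (a \<xi>)"
      by (simp only: power2_eq_square ac_simps)
    finally show "norm (\<i> * of_real (sym j \<xi>) * c j \<xi>) \<le> (2 * pi * wt_mass)\<^sup>2 * (1 + norm \<xi>) ^ 2 * norm (a \<xi>)"
      by (simp add: norm_mult)
  qed measurable
  have sumc: "(\<Sum>j\<in>UNIV. \<i> * of_real (sym j \<xi>) * c j \<xi>) = - 1 * (psi \<xi> *\<^sub>R a \<xi>)" for \<xi>
  proof -
    have "\<i> * of_real (sym j \<xi>) * c j \<xi> = - (of_real ((sym j \<xi>)\<^sup>2) * a \<xi>)" for j
      by (simp add: c_def power2_eq_square complex_eq_iff algebra_simps)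
    then show ?thesis by (simp add: psi_def scaleR_conv_of_real sum_negf sum_distrib_right)
  qed
  show "integrable lborel (\<lambda>\<xi>. psi \<xi> *\<^sub>R ft u \<xi>)"
  proof -
    have "integrable lborel (\<lambda>\<xi>. \<Sum>j\<in>UNIV. \<i> * of_real (sym j \<xi>) * c j \<xi>)"
      by (intro Bochner_Integration.integrable_sum cc)
    then show ?thesis unfolding sumc by (simp add: a_def)
  qed
  have "nonlocal_laplacian \<rho> u x = (LINT y|lborel. W y)"
    unfolding nonlocal_laplacian_def nonlocal_div_def V_def[symmetric]
  proof (rule integral_lebesgue_cong_AE)
    show "W \<in> borel_measurable borel" unfolding W_def by measurable
    show "AE y in lborel. (\<Sum>j\<in>UNIV. (V x $ j - V y $ j) / of_real (norm (x - y)) * of_real ((x - y) $ j / norm (x - y))) * of_real (\<rho> (x - y)) = W y"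
      using AE_reflect[OF \<rho>_eq, of x]
    proof eventually_elim
      case (elim y)
      show ?case unfolding W_def sum_distrib_right elim
        by (intro sum.cong refl) (simp add: kern_def scaleR_conv_of_real mult_ac)
    qed
  qed
  also have "\<dots> = (\<Sum>j\<in>UNIV. ft (\<lambda>\<xi>. \<i> * of_real (sym j \<xi>) * c j \<xi>) (- x))"
    unfolding W_def using Wj by simp
  also have "\<dots> = ft (\<lambda>\<xi>. \<Sum>j\<in>UNIV. \<i> * of_real (sym j \<xi>) * c j \<xi>) (- x)"
    by (rule ft_sum[symmetric]) (rule cc)
  also have "\<dots> = - ft (\<lambda>\<xi>. psi \<xi> *\<^sub>R ft u \<xi>) (- x)"
    unfolding sumc ft_cmult by (simp add: a_def)
  finally show "nonlocal_laplacian \<rho> u x = - ft (\<lambda>\<xi>. psi \<xi> *\<^sub>R ft u \<xi>) (- x)" .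
qed

end



section \<open>The Levy-Khintchine representation of the symbol\<close>

text \<open>Fatou's lemma as a source of integrability: it is used once for the mollified kernels
  and once for the Levy measure.\<close>

lemma integrable_fatou:
  fixes f :: "nat \<Rightarrow> 'a \<Rightarrow> real"
  assumes f: "\<And>m. integrable M (f m)" and f0: "\<And>m x. 0 \<le> f m x" and B: "\<And>m. integral\<^sup>L M (f m) \<le> B"
    and lim: "AE x in M. (\<lambda>m. f m x) \<longlonglongrightarrow> F x" and [measurable]: "F \<in> borel_measurable M" and F0: "\<And>x. 0 \<le> F x"
  shows "integrable M F"
proof (rule integrableI_nonneg)
  have "(\<integral>\<^sup>+x. ennreal (F x) \<partial>M) = (\<integral>\<^sup>+x. liminf (\<lambda>m. ennreal (f m x)) \<partial>M)"
  proof (rule nn_integral_cong_AE)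
    show "AE x in M. ennreal (F x) = liminf (\<lambda>m. ennreal (f m x))"
      using lim
    proof eventually_elim
      case (elim x)
      then have "(\<lambda>m. ennreal (f m x)) \<longlonglongrightarrow> ennreal (F x)" by (rule tendsto_ennrealI)
      then show ?case by (simp add: lim_imp_Liminf)
    qed
  qed
  also have "\<dots> \<le> liminf (\<lambda>m. \<integral>\<^sup>+x. ennreal (f m x) \<partial>M)"
    by (rule nn_integral_liminf) (use f in auto)
  also have "\<dots> = liminf (\<lambda>m. ennreal (integral\<^sup>L M (f m)))"
    using f f0 by (simp add: nn_integral_eq_integral)
  also have "\<dots> \<le> liminf (\<lambda>m::nat. ennreal B)"
    by (intro Liminf_mono always_eventually allI ennreal_leI B)
  also have "\<dots> = ennreal B" by (simp add: Liminf_const)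
  finally show "(\<integral>\<^sup>+x. ennreal (F x) \<partial>M) < \<infinity>" by (simp add: order_le_less_trans[OF _ ennreal_less_top])
qed (use F0 in auto)

lemma integrable_indicator_cball:
  fixes f :: "'a::euclidean_space \<Rightarrow> 'b::{banach, second_countable_topology}"
  assumes [measurable]: "f \<in> borel_measurable borel" and B: "\<And>x. norm (f x) \<le> B"
  shows "integrable lborel (\<lambda>x. indicator {..t} (norm x) *\<^sub>R f x)"
proof (rule integrable_real_bound[of _ "\<lambda>x. B * indicator (cball 0 t) x"])
  show "integrable lborel (\<lambda>x. B * indicator (cball (0::'a) t) x)"
    by (intro integrable_mult_right integrable_real_indicator) (auto simp: emeasure_lborel_cball_finite[unfolded infinity_ennreal_def])
qed (use B in \<open>auto split: split_indicator\<close>)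

text \<open>\<open>K_test\<close> speaks only of test functions off the origin and
  \<open>kb_loc\<close> only of compact sets avoiding it. What happens at the origin, including the
  integrability of \<open>kb\<close> against |h|^2 there, has to be deduced.\<close>

locale levy_kernel = represented_kernel b r \<rho> for b :: "real \<Rightarrow> real" and r \<rho> :: "real^'n \<Rightarrow> real" +
  fixes kb :: "real^'n \<Rightarrow> real"
  assumes kb_measurable [measurable]: "kb \<in> borel_measurable borel"
    and kb_nonneg: "0 \<le> kb y"
    and kb_loc: "compact S \<Longrightarrow> 0 \<notin> S \<Longrightarrow> integrable lborel (\<lambda>y. indicator S y *\<^sub>R kb y)"
    and K_test: "test_fun_off_zero \<phi> \<Longrightarrow> K_dist \<rho> \<phi> = (LINT y|lborel. of_real (kb y) * \<phi> y)"
begin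

section \<open>The mollified kernel\<close>

definition ghat :: "real^'n \<Rightarrow> complex" where "ghat = ft (\<lambda>x. of_real (bump x))"

lemma ghat_continuous: "continuous_on UNIV ghat"
  unfolding ghat_def by (intro ft_continuous integrable_of_real integrable_bump)

lemma ghat_measurable [measurable]: "ghat \<in> borel_measurable borel"
  by (intro borel_measurable_continuous_onI ghat_continuous)

lemma ghat_le: "norm (ghat \<xi>) \<le> 1"
  unfolding ghat_def using norm_ft_le[of "\<lambda>x. complex_of_real (bump x)" \<xi>] by (simp add: integral_bump)

lemma ghat_0: "ghat 0 = 1"
  unfolding ghat_def ft_def by (simp add: integral_bump)

lemma ghat_minus: "ghat (- \<xi>) = ghat \<xi>"
  unfolding ghat_def using ft_reflect[of "\<lambda>x. complex_of_real (bump x)" \<xi>] by simp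

text \<open>\<open>K d\<close> is the mollification at scale \<open>d\<close> of the distribution \<open>K\<^sub>\<rho>\<close>.\<close>

definition A :: "real \<Rightarrow> real^'n \<Rightarrow> complex" where "A d \<xi> = psi \<xi> *\<^sub>R ghat (d *\<^sub>R \<xi>)"

definition K :: "real \<Rightarrow> real^'n \<Rightarrow> complex" where "K d h = - ft (A d) h"

definition Kr :: "real \<Rightarrow> real^'n \<Rightarrow> real" where "Kr d h = (LINT y|lborel. kb y * moll d (h - y))"

lemma A_measurable [measurable]: "A d \<in> borel_measurable borel"
  unfolding A_def by measurable

lemma A_minus: "A d (- \<xi>) = A d \<xi>" by (simp add: A_def ghat_minus)

lemma A_0: "A d 0 = 0" by (simp add: A_def)

lemma A_continuous: "continuous_on UNIV (A d)"
  unfolding A_def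
  by (intro continuous_intros psi_continuous continuous_on_compose2[OF ghat_continuous]) auto

lemma A_integrable: "0 < d \<Longrightarrow> integrable lborel (A d)"
proof -
  assume d: "0 < d"
  \<comment> \<open>After rescaling to \<open>\<eta>\<close>, the dilation by 1/d sits in the
    quadratically growing \<open>psi\<close>, while \<open>ghat\<close> is the transform of a fixed
    Schwartz function. The factor 1 + 1/d comes from 1 + |\<eta>|/d <= (1 + 1/d)(1 +
    |\<eta>|).\<close>
  have "\<bar>psi (\<eta> /\<^sub>R d)\<bar> \<le> (psi_const * (1 + 1 / d)\<^sup>2) * (1 + norm \<eta>) ^ 2" for \<eta>
  proof -
    have "1 + norm (\<eta> /\<^sub>R d) \<le> (1 + 1 / d) * (1 + norm \<eta>)"
      using d by (simp add: field_simps)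
    then have "(1 + norm (\<eta> /\<^sub>R d))\<^sup>2 \<le> ((1 + 1 / d) * (1 + norm \<eta>))\<^sup>2" by (rule power_mono) simp
    then have "psi_const * (1 + norm (\<eta> /\<^sub>R d))\<^sup>2 \<le> psi_const * ((1 + 1 / d) * (1 + norm \<eta>))\<^sup>2"
      by (rule mult_left_mono) (rule psi_const_nonneg)
    also have "\<dots> = (psi_const * (1 + 1 / d)\<^sup>2) * (1 + norm \<eta>) ^ 2" by (simp only: power_mult_distrib mult.assoc)
    finally show ?thesis using psi_bound[of "\<eta> /\<^sub>R d"] psi_nonneg[of "\<eta> /\<^sub>R d"] by linarith
  qed
  then have I: "integrable lborel (\<lambda>\<eta>. psi (\<eta> /\<^sub>R d) *\<^sub>R ghat \<eta>)"
    unfolding ghat_def by (intro schwartz_ft_integrable_weight[OF schwartz_bump]) auto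
  have "integrable lborel (\<lambda>\<xi>. (\<lambda>\<eta>. psi (\<eta> /\<^sub>R d) *\<^sub>R ghat \<eta>) (0 + d *\<^sub>R \<xi>))"
    by (subst lborel_integrable_affine) (use d I in auto)
  then show ?thesis using d by (simp add: A_def[abs_def])
qed

lemma A_bounded: "0 < d \<Longrightarrow> \<exists>B. \<forall>\<xi>. norm (A d \<xi>) \<le> B"
proof -
  assume d: "0 < d"
  obtain C where C: "0 \<le> C" "\<And>\<xi>. norm (ghat \<xi>) \<le> C / (1 + norm \<xi>) ^ 2"
    unfolding ghat_def using ft_schwartz_decay[OF schwartz_bump, of 2] by blast
  have "norm (A d \<xi>) \<le> psi_const * (1 + 1 / d)\<^sup>2 * C" for \<xi>
  proof -
    have p: "0 < (1 + norm (d *\<^sub>R \<xi>)) ^ 2" by (intro zero_less_power add_pos_nonneg) auto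
    have "1 + norm \<xi> \<le> (1 + 1 / d) * (1 + norm (d *\<^sub>R \<xi>))"
      using d by (simp add: field_simps)
    then have "(1 + norm \<xi>)\<^sup>2 \<le> ((1 + 1 / d) * (1 + norm (d *\<^sub>R \<xi>)))\<^sup>2" by (rule power_mono) simp
    then have "psi_const * (1 + norm \<xi>)\<^sup>2 \<le> psi_const * ((1 + 1 / d) * (1 + norm (d *\<^sub>R \<xi>)))\<^sup>2"
      by (rule mult_left_mono) (rule psi_const_nonneg)
    then have "psi \<xi> \<le> psi_const * (1 + 1 / d)\<^sup>2 * (1 + norm (d *\<^sub>R \<xi>))\<^sup>2"
      using psi_bound[of \<xi>] by (simp only: power_mult_distrib mult.assoc)
    then have "psi \<xi> * norm (ghat (d *\<^sub>R \<xi>)) \<le> (psi_const * (1 + 1 / d)\<^sup>2 * (1 + norm (d *\<^sub>R \<xi>))\<^sup>2) * (C / (1 + norm (d *\<^sub>R \<xi>)) ^ 2)"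
      using psi_const_nonneg by (intro mult_mono C(2)) auto
    also have "\<dots> = psi_const * (1 + 1 / d)\<^sup>2 * C" using p by simp
    finally show ?thesis using psi_nonneg[of \<xi>] by (simp add: A_def)
  qed
  then show ?thesis by blast
qed

lemma K_measurable: "0 < d \<Longrightarrow> K d \<in> borel_measurable borel"
  unfolding K_def[abs_def] using ft_measurable[OF A_integrable] by measurable

lemma K_minus: "K d (- h) = K d h"
  unfolding K_def using ft_reflect[of "A d" h] by (simp add: A_minus)

lemma K_le: "norm (K d h) \<le> (LINT \<xi>|lborel. norm (A d \<xi>))"
  unfolding K_def using norm_ft_le[of "A d" h] by simp

lemma Kr_integrable: 
  assumes d: "0 < d" "d < norm h"
  shows "integrable lborel (\<lambda>y. kb y * moll d (h - y))"
proof -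
  have "integrable lborel (\<lambda>y. indicator (cball h d) y *\<^sub>R kb y)" by (rule kb_loc) (use d in auto)
  moreover have "continuous_on UNIV (\<lambda>y. complex_of_real (moll d (h - y)))"
    by (rule smooth_fun_continuous[OF smooth_fun_moll])
  then have "bounded ((\<lambda>y. complex_of_real (moll d (h - y))) ` cball h d)"
    by (intro compact_imp_bounded compact_continuous_image) (auto intro: continuous_on_subset)
  then obtain B where "\<And>y. y \<in> cball h d \<Longrightarrow> norm (complex_of_real (moll d (h - y))) \<le> B" unfolding bounded_iff by blast
  then have B: "moll d (h - y) \<le> B" if "y \<in> cball h d" for y
    using that abs_ge_self[of "moll d (h - y)"] unfolding norm_of_real by (metis order_trans)
  show ?thesis
  proof (rule integrable_real_bound[OF integrable_mult_right[OF calculation, of B]])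
    show "norm (kb y * moll d (h - y)) \<le> B * (indicator (cball h d) y *\<^sub>R kb y)" for y
    proof (cases "y \<in> cball h d")
      case True
      have "moll d (h - y) * kb y \<le> B * kb y" using B[OF True] kb_nonneg by (intro mult_right_mono) auto
      then show ?thesis using True d kb_nonneg[of y] by (simp add: abs_mult mult.commute)
    next
      case False
      then show ?thesis using moll_zero[OF d(1), of "h - y"] by (simp add: dist_norm)
    qed
  qed measurable
qed

lemma Kr_nonneg: "0 < d \<Longrightarrow> 0 \<le> Kr d h"
  unfolding Kr_def by (intro Bochner_Integration.integral_nonneg mult_nonneg_nonneg kb_nonneg moll_nonneg)

text \<open>For d < |h| the mollifier centred at h vanishes near the origin and so is admissible in
  \<open>K_test\<close>. This is the only point where the distribution and the function
  \<open>kb\<close> meet.\<close>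

lemma K_eq_Kr:
  assumes d: "0 < d" "d < norm h"
  shows "K d h = of_real (Kr d h)"
proof -
  let ?\<phi> = "\<lambda>y. complex_of_real (moll d (h - y))"
  have \<phi>: "test_fun_off_zero ?\<phi>" by (rule test_fun_moll[OF d])
  have e: "?\<phi> = (\<lambda>y. (\<lambda>y. complex_of_real (moll d y)) (y + (- h)))"
    using moll_minus[of d "y - h" for y] by (simp add: fun_eq_iff)
  have "ft ?\<phi> \<xi> = cis (- (2 * pi * (h \<bullet> \<xi>))) * ghat (d *\<^sub>R \<xi>)" for \<xi>
    unfolding e by (subst ft_translate) (auto simp: ft_moll[OF d(1)] ghat_def)
  then have "K_dist \<rho> ?\<phi> = - (LINT \<xi>|lborel. A d \<xi> * cis (- (2 * pi * (\<xi> \<bullet> h))))"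
    unfolding K_dist_eq[OF test_fun_schwartz[OF \<phi>]] by (simp add: A_def inner_commute mult.commute)
  then have "K d h = K_dist \<rho> ?\<phi>" by (simp add: K_def ft_def)
  also have "\<dots> = (LINT y|lborel. of_real (kb y * moll d (h - y)))" unfolding K_test[OF \<phi>] by simp
  also have "\<dots> = of_real (Kr d h)" unfolding Kr_def by (rule integral_complex_of_real)
  finally show ?thesis .
qed

text \<open>One sequence serves both as the mollification scale and as the dilation of the
  Gaussians. The \<open>Suc\<close> makes it positive and at most 1, as the majorant for the
  rescaled \<open>psi\<close> requires.\<close>

definition ds :: "nat \<Rightarrow> real" where "ds m = 1 / real (Suc m)"

lemma ds: "ds \<longlonglongrightarrow> 0" "0 < ds m" "ds m \<le> 1"
  unfolding ds_def using LIMSEQ_Suc[OF lim_1_over_n] by (auto simp: divide_le_eq)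

text \<open>By the multiplication formula, pairing with a wide Gaussian is minus an average of
  \<open>A d\<close> against a narrow one at the origin, and \<open>A d\<close> is continuous with
  value 0 there. No integrability of \<open>K d\<close> is available yet; the Gaussian provides
  it.\<close>

lemma K_gauss_tendsto:
  assumes d: "0 < d"
  shows "(\<lambda>m. LINT h|lborel. K d h * of_real (gauss (ds m *\<^sub>R h))) \<longlonglongrightarrow> 0"
    and "integrable lborel (\<lambda>h. K d h * complex_of_real (gauss (ds m *\<^sub>R h)))"
proof -
  have gI: "integrable lborel (\<lambda>h::real^'n. complex_of_real (gauss (ds m *\<^sub>R h)))" for m
    using ds(2)[of m] by (intro integrable_gauss_scale) auto
  have [measurable]: "K d \<in> borel_measurable borel" by (rule K_measurable[OF d])
  show "integrable lborel (\<lambda>h. K d h * complex_of_real (gauss (ds m *\<^sub>R h)))" for m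
  proof (rule integrable_real_bound[OF integrable_mult_right[OF integrable_norm[OF gI[of m]], of "LINT \<xi>|lborel. norm (A d \<xi>)"]])
    show "norm (K d h * complex_of_real (gauss (ds m *\<^sub>R h))) \<le> (LINT \<xi>|lborel. norm (A d \<xi>)) * norm (complex_of_real (gauss (ds m *\<^sub>R h)))" for h
      unfolding norm_mult by (intro mult_right_mono K_le) simp
  qed measurable
  have "(LINT h|lborel. K d h * of_real (gauss (ds m *\<^sub>R h))) = - (LINT z|lborel. of_real (gauss z) * A d (0 + ds m *\<^sub>R z))" for m
  proof -
    have "(LINT h|lborel. K d h * of_real (gauss (ds m *\<^sub>R h))) = - (LINT h|lborel. ft (A d) h * of_real (gauss (ds m *\<^sub>R h)))"
      unfolding K_def by simp
    also have "(LINT h|lborel. ft (A d) h * of_real (gauss (ds m *\<^sub>R h))) = (LINT \<xi>|lborel. A d \<xi> * of_real (gauss (\<xi> /\<^sub>R ds m) / \<bar>ds m\<bar> ^ DIM(real^'n)))"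
      unfolding ft_swap[OF A_integrable[OF d] gI] using ds(2)[of m] by (simp add: ft_gauss_scale)
    also have "\<dots> = \<bar>ds m\<bar> ^ DIM(real^'n) *\<^sub>R (LINT z|lborel. A d (0 + ds m *\<^sub>R z) * of_real (gauss ((0 + ds m *\<^sub>R z) /\<^sub>R ds m) / \<bar>ds m\<bar> ^ DIM(real^'n)))"
      by (rule lborel_integral_affine) (use ds(2)[of m] in auto)
    also have "\<dots> = (LINT z|lborel. of_real (gauss z) * A d (0 + ds m *\<^sub>R z))"
      unfolding integral_scaleR_right[symmetric]
    proof (rule Bochner_Integration.integral_cong[OF refl])
      fix z :: "real^'n"
      have "(0 + ds m *\<^sub>R z) /\<^sub>R ds m = z" using ds(2)[of m] by simp
      then show "\<bar>ds m\<bar> ^ DIM(real^'n) *\<^sub>R (A d (0 + ds m *\<^sub>R z) * of_real (gauss ((0 + ds m *\<^sub>R z) /\<^sub>R ds m) / \<bar>ds m\<bar> ^ DIM(real^'n)))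
          = of_real (gauss z) * A d (0 + ds m *\<^sub>R z)"
        using ds(2)[of m] by (simp only: scaleR_conv_of_real[where 'a=complex]) simp
    qed
    finally show ?thesis .
  qed
  moreover obtain B where B: "\<And>\<xi>. norm (A d \<xi>) \<le> B" using A_bounded[OF d] by blast
  have "(\<lambda>m. LINT z|lborel. of_real (gauss z) * A d (0 + ds m *\<^sub>R z)) \<longlonglongrightarrow> (LINT z|lborel. complex_of_real (gauss (z::real^'n))) * A d 0"
  proof (rule approximate_identity[OF _ _ B _ ds(1)])
    show "integrable lborel (\<lambda>z::real^'n. complex_of_real (gauss z))" by (rule integrable_of_real[OF integrable_gauss])
    show "isCont (A d) 0" using A_continuous by (simp add: continuous_on_eq_continuous_at)
  qed measurable
  from tendsto_minus[OF this] have "(\<lambda>m. - (LINT z|lborel. of_real (gauss z) * A d (0 + ds m *\<^sub>R z))) \<longlonglongrightarrow> 0"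
    by (simp add: A_0)
  ultimately show "(\<lambda>m. LINT h|lborel. K d h * of_real (gauss (ds m *\<^sub>R h))) \<longlonglongrightarrow> 0" by simp
qed

lemma gauss_ds_tendsto: "(\<lambda>m. gauss (ds m *\<^sub>R h)) \<longlonglongrightarrow> 1" for h :: "real^'n"
proof -
  have "(\<lambda>m. exp (- (pi * (norm (ds m *\<^sub>R h))\<^sup>2))) \<longlonglongrightarrow> exp (- (pi * (norm (0 *\<^sub>R h))\<^sup>2))"
    by (intro tendsto_intros ds)
  then show ?thesis by (simp add: gauss_def)
qed

lemma K_integrable:
  assumes d: "0 < d"
  shows "integrable lborel (K d)" "(LINT h|lborel. K d h) = 0"
proof -
  have [measurable]: "K d \<in> borel_measurable borel" by (rule K_measurable[OF d])
  let ?B = "LINT \<xi>|lborel. norm (A d \<xi>)"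
  let ?g = "\<lambda>m h. gauss (ds m *\<^sub>R (h::real^'n))"
  \<comment> \<open>The sign of \<open>K d\<close> is known only beyond radius d, so Fatou's lemma
    is applied to this part. The remainder is bounded with bounded support and converges by
    domination. Hence the Gaussian integrals of F are bounded, being differences of convergent
    sequences.\<close>
  define F where "F h = indicator {d<..} (norm h) * Re (K d h)" for h
  have F0: "0 \<le> F h" for h using K_eq_Kr[OF d, of h] Kr_nonneg[OF d] by (auto simp: F_def split: split_indicator)
  have [measurable]: "F \<in> borel_measurable borel" unfolding F_def by measurable
  have nearI: "integrable lborel (\<lambda>h. indicator {..d} (norm h) *\<^sub>R K d h)"
    by (rule integrable_indicator_cball[OF _ K_le]) measurable
  have nearG: "integrable lborel (\<lambda>h. indicator {..d} (norm h) *\<^sub>R (K d h * of_real (?g m h)))" for m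
    by (rule integrable_indicator_cball[of _ ?B]) (use mult_mono[OF K_le gauss_le_1] in \<open>auto simp: norm_mult intro!: order_trans[OF mult_left_le K_le]\<close>)
  have split: "K d h = indicator {..d} (norm h) *\<^sub>R K d h + of_real (F h)" for h
    using K_eq_Kr[OF d, of h] by (auto simp: F_def split: split_indicator)
  have GI: "integrable lborel (\<lambda>h. F h * ?g m h)" for m
    by (rule integrable_real_bound[OF integrable_norm[OF K_gauss_tendsto(2)[OF d, of m]]])
      (auto simp: F_def norm_mult abs_mult abs_Re_le_cmod split: split_indicator intro!: mult_right_mono)
  have e: "complex_of_real (LINT h|lborel. F h * ?g m h)
      = (LINT h|lborel. K d h * of_real (?g m h)) - (LINT h|lborel. indicator {..d} (norm h) *\<^sub>R (K d h * of_real (?g m h)))" for m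
  proof -
    have "K d h * of_real (?g m h) - indicator {..d} (norm h) *\<^sub>R (K d h * of_real (?g m h)) = of_real (F h * ?g m h)" for h
      using split[of h] by (auto simp: F_def split: split_indicator)
    then have "(LINT h|lborel. K d h * of_real (?g m h)) - (LINT h|lborel. indicator {..d} (norm h) *\<^sub>R (K d h * of_real (?g m h)))
        = (LINT h|lborel. complex_of_real (F h * ?g m h))"
      using K_gauss_tendsto(2)[OF d, of m] nearG[of m] by (simp flip: Bochner_Integration.integral_diff)
    then show ?thesis by (simp only: integral_complex_of_real)
  qed
  have nlim: "(\<lambda>m. LINT h|lborel. indicator {..d} (norm h) *\<^sub>R (K d h * of_real (?g m h))) \<longlonglongrightarrow> (LINT h|lborel. indicator {..d} (norm h) *\<^sub>R (K d h * 1))"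
  proof (rule integral_dominated_convergence[where w="\<lambda>h. norm (indicator {..d} (norm h) *\<^sub>R K d h)"])
    show "AE h in lborel. (\<lambda>m. indicator {..d} (norm h) *\<^sub>R (K d h * of_real (?g m h))) \<longlonglongrightarrow> indicator {..d} (norm h) *\<^sub>R (K d h * 1)"
    proof (rule AE_I2)
      fix h :: "real^'n"
      have "(\<lambda>m. complex_of_real (?g m h)) \<longlonglongrightarrow> 1" using tendsto_of_real[OF gauss_ds_tendsto[of h]] by simp
      then show "(\<lambda>m. indicator {..d} (norm h) *\<^sub>R (K d h * of_real (?g m h))) \<longlonglongrightarrow> indicator {..d} (norm h) *\<^sub>R (K d h * 1)"
        by (intro tendsto_intros)
    qed
  qed (use integrable_norm[OF nearI] in \<open>auto simp: norm_mult split: split_indicator intro!: mult_left_le\<close>)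
  have "convergent (\<lambda>m. complex_of_real (LINT h|lborel. F h * ?g m h))"
    unfolding e using tendsto_diff[OF K_gauss_tendsto(1)[OF d] nlim] by (auto simp: convergent_def)
  then have "Bseq (\<lambda>m. complex_of_real (LINT h|lborel. F h * ?g m h))" by (rule convergent_imp_Bseq)
  then obtain C where "\<And>m. norm (complex_of_real (LINT h|lborel. F h * ?g m h)) \<le> C" by (auto simp: Bseq_def)
  then have C: "(LINT h|lborel. F h * ?g m h) \<le> C" for m using abs_ge_self order_trans unfolding norm_of_real by blast
  have FI: "integrable lborel F"
  proof (rule integrable_fatou[OF GI _ C])
    show "AE h in lborel. (\<lambda>m. F h * ?g m h) \<longlonglongrightarrow> F h"
      using tendsto_mult_left[OF gauss_ds_tendsto] by (intro AE_I2) fastforce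
  qed (use F0 in auto)
  have "integrable lborel (\<lambda>h. indicator {..d} (norm h) *\<^sub>R K d h + complex_of_real (F h))"
    using nearI FI by (intro Bochner_Integration.integrable_add integrable_of_real)
  then show KI: "integrable lborel (K d)" by (simp flip: split)
  have "(\<lambda>m. LINT h|lborel. K d h * of_real (?g m h)) \<longlonglongrightarrow> (LINT h|lborel. K d h * 1)"
  proof (rule integral_dominated_convergence[where w="\<lambda>h. norm (K d h)"])
    show "AE h in lborel. (\<lambda>m. K d h * of_real (?g m h)) \<longlonglongrightarrow> K d h * 1"
    proof (rule AE_I2)
      fix h :: "real^'n"
      have "(\<lambda>m. complex_of_real (?g m h)) \<longlonglongrightarrow> 1" using tendsto_of_real[OF gauss_ds_tendsto[of h]] by simp
      then show "(\<lambda>m. K d h * of_real (?g m h)) \<longlonglongrightarrow> K d h * 1" by (intro tendsto_intros)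
    qed
  qed (use KI in \<open>auto simp: norm_mult intro!: mult_left_le\<close>)
  then show "(LINT h|lborel. K d h) = 0"
    using LIMSEQ_unique[OF K_gauss_tendsto(1)[OF d]] by simp
qed

text \<open>The zero total mass of \<open>K d\<close> removes the constant \<open>u x\<close>; what
  is left is the multiplication formula applied to a translate of u.\<close>

lemma K_difference:
  fixes u :: "real^'n \<Rightarrow> complex"
  assumes d: "0 < d" and u: "integrable lborel u" and C: "\<And>y. norm (u y) \<le> C"
  shows "integrable lborel (\<lambda>h. K d h * u (x + h))"
    and "(LINT h|lborel. K d h * (u x - u (x + h))) = (LINT \<xi>|lborel. A d \<xi> * (cis (2 * pi * (x \<bullet> \<xi>)) * ft u \<xi>))"
proof -
  have [measurable]: "u \<in> borel_measurable borel" using u by auto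
  have [measurable]: "K d \<in> borel_measurable borel" by (rule K_measurable[OF d])
  show I: "integrable lborel (\<lambda>h. K d h * u (x + h))"
    by (rule integrable_real_bound[OF integrable_mult_right[OF integrable_norm[OF K_integrable(1)[OF d]], of C]])
      (use C in \<open>auto simp: norm_mult mult.commute[of C] intro!: mult_left_mono\<close>)
  have ux: "integrable lborel (\<lambda>h. u (h + x))" using u by (subst lborel_integrable_translate) auto
  have "(LINT h|lborel. K d h * (u x - u (x + h))) = (LINT h|lborel. K d h) * u x - (LINT h|lborel. K d h * u (x + h))"
    using K_integrable(1)[OF d] I by (simp add: right_diff_distrib)
  also have "\<dots> = (LINT h|lborel. ft (A d) h * u (h + x))"
    unfolding K_integrable(2)[OF d] by (simp add: K_def add.commute)
  also have "\<dots> = (LINT \<xi>|lborel. A d \<xi> * ft (\<lambda>h. u (h + x)) \<xi>)"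
    by (rule ft_swap[OF A_integrable[OF d] ux])
  finally show "(LINT h|lborel. K d h * (u x - u (x + h))) = (LINT \<xi>|lborel. A d \<xi> * (cis (2 * pi * (x \<bullet> \<xi>)) * ft u \<xi>))"
    by (simp add: ft_translate)
qed

text \<open>The factor \<open>ghat (d *\<^sub>R \<xi>)\<close> tends to 1 and is bounded by 1, so
  \<open>psi\<close> times \<open>ft u\<close> dominates. The hypotheses on u are weak enough to
  admit the Gaussian without showing it to be a Schwartz function.\<close>

lemma K_difference_tendsto:
  fixes u :: "real^'n \<Rightarrow> complex"
  assumes u: "integrable lborel u" and C: "\<And>y. norm (u y) \<le> C"
    and pu: "integrable lborel (\<lambda>\<xi>. psi \<xi> *\<^sub>R ft u \<xi>)"
  shows "(\<lambda>m. LINT h|lborel. K (ds m) h * (u x - u (x + h))) \<longlonglongrightarrow> ft (\<lambda>\<xi>. psi \<xi> *\<^sub>R ft u \<xi>) (- x)"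
proof -
  have [measurable]: "ft u \<in> borel_measurable borel" using ft_measurable[OF u] .
  have "(\<lambda>m. LINT \<xi>|lborel. A (ds m) \<xi> * (cis (2 * pi * (x \<bullet> \<xi>)) * ft u \<xi>)) \<longlonglongrightarrow> (LINT \<xi>|lborel. (psi \<xi> *\<^sub>R 1) * (cis (2 * pi * (x \<bullet> \<xi>)) * ft u \<xi>))"
  proof (rule integral_dominated_convergence[where w="\<lambda>\<xi>. norm (psi \<xi> *\<^sub>R ft u \<xi>)"])
    show "AE \<xi> in lborel. (\<lambda>m. A (ds m) \<xi> * (cis (2 * pi * (x \<bullet> \<xi>)) * ft u \<xi>)) \<longlonglongrightarrow> (psi \<xi> *\<^sub>R 1) * (cis (2 * pi * (x \<bullet> \<xi>)) * ft u \<xi>)"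
    proof (rule AE_I2)
      fix \<xi> :: "real^'n"
      have "(\<lambda>m. ds m *\<^sub>R \<xi>) \<longlonglongrightarrow> 0 *\<^sub>R \<xi>" by (intro tendsto_intros ds)
      then have "(\<lambda>m. ghat (ds m *\<^sub>R \<xi>)) \<longlonglongrightarrow> ghat 0"
        using ghat_continuous by (intro isCont_tendsto_compose[of _ ghat]) (auto simp: continuous_on_eq_continuous_at)
      then show "(\<lambda>m. A (ds m) \<xi> * (cis (2 * pi * (x \<bullet> \<xi>)) * ft u \<xi>)) \<longlonglongrightarrow> (psi \<xi> *\<^sub>R 1) * (cis (2 * pi * (x \<bullet> \<xi>)) * ft u \<xi>)"
        unfolding A_def ghat_0 by (intro tendsto_intros)
    qed
    show "AE \<xi> in lborel. norm (A (ds m) \<xi> * (cis (2 * pi * (x \<bullet> \<xi>)) * ft u \<xi>)) \<le> norm (psi \<xi> *\<^sub>R ft u \<xi>)" for m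
    proof (rule AE_I2)
      fix \<xi> :: "real^'n"
      have "norm (ghat (ds m *\<^sub>R \<xi>)) * norm (psi \<xi> *\<^sub>R ft u \<xi>) \<le> 1 * norm (psi \<xi> *\<^sub>R ft u \<xi>)"
        by (intro mult_right_mono ghat_le) simp
      then show "norm (A (ds m) \<xi> * (cis (2 * pi * (x \<bullet> \<xi>)) * ft u \<xi>)) \<le> norm (psi \<xi> *\<^sub>R ft u \<xi>)"
        by (simp add: A_def norm_mult mult_ac)
    qed
  qed (use integrable_norm[OF pu] in auto)
  then show ?thesis
    unfolding K_difference(2)[OF ds(2) u C] by (simp add: ft_def inner_commute scaleR_conv_of_real mult_ac)
qed

text \<open>Near the origin \<open>f\<close> is quadratic, so after rescaling \<open>\<xi> = \<eta> / d\<close> the pairing is controlled by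
  \<open>d\<^sup>2 * psi (\<eta> / d)\<close>, which vanishes in the limit because \<open>psi\<close> is \<open>o(|\<xi>|\<^sup>2)\<close>.\<close>

lemma K_near_tendsto_0:
  fixes f :: "real^'n \<Rightarrow> complex"
  assumes [measurable]: "f \<in> borel_measurable borel" and f: "\<And>h. norm (f h) \<le> C * min 1 ((norm h)\<^sup>2)"
  shows "(\<lambda>m. LINT h|lborel. indicator {..2 * ds m} (norm h) *\<^sub>R (K (ds m) h * f h)) \<longlonglongrightarrow> 0"
proof -
  have C: "0 \<le> C" using order_trans[OF norm_ge_zero f[of "axis undefined 1"]] by simp
  \<comment> \<open>The supremum of \<open>K d\<close> is at most the L1 norm of \<open>A d\<close>.
    The 4 comes from |h|^2 <= (2d)^2 and the last factor from the volume of the ball of radius 2d.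
    The remaining d^2 and the n-th power of d rescale that norm to the one of
    \<open>d\<^sup>2 * psi (\<eta> /\<^sub>R d)\<close> times \<open>ghat\<close>.\<close>
  define c where "c = C * 4 * (unit_ball_vol (real CARD('n)) * 2 ^ CARD('n))"
  have c: "0 \<le> c" using C by (simp add: c_def)
  have bd: "norm (LINT h|lborel. indicator {..2 * ds m} (norm h) *\<^sub>R (K (ds m) h * f h)) \<le> c * (LINT \<eta>|lborel. norm (((ds m)\<^sup>2 * psi (\<eta> /\<^sub>R ds m)) *\<^sub>R ghat \<eta>))" for m
  proof -
    define d where "d = ds m"
    have d: "0 < d" using ds(2) by (simp add: d_def)
    have [measurable]: "K d \<in> borel_measurable borel" by (rule K_measurable[OF d])
    let ?B = "LINT \<xi>|lborel. norm (A d \<xi>)"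
    have B0: "0 \<le> ?B" by simp
    have "norm (LINT h|lborel. indicator {..2 * d} (norm h) *\<^sub>R (K d h * f h)) \<le> (LINT h|lborel. norm (indicator {..2 * d} (norm h) *\<^sub>R (K d h * f h)))"
      by (rule integral_norm_bound)
    also have "\<dots> \<le> (LINT h|lborel. (?B * (C * (2 * d)\<^sup>2)) * indicator (cball (0::real^'n) (2 * d)) h)"
    proof (rule integral_mono)
      show le: "norm (indicator {..2 * d} (norm h) *\<^sub>R (K d h * f h)) \<le> (?B * (C * (2 * d)\<^sup>2)) * indicator (cball 0 (2 * d)) h" for h
      proof (cases "norm h \<le> 2 * d")
        case True
        have "(norm h)\<^sup>2 \<le> (2 * d)\<^sup>2" using True by (rule power_mono) simp
        then have "C * min 1 ((norm h)\<^sup>2) \<le> C * (2 * d)\<^sup>2" using C by (intro mult_left_mono) auto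
        then have "norm (K d h) * norm (f h) \<le> ?B * (C * (2 * d)\<^sup>2)"
          using f[of h] by (intro mult_mono K_le) auto
        then show ?thesis using True by (simp add: norm_mult)
      qed simp
      show I: "integrable lborel (\<lambda>h. (?B * (C * (2 * d)\<^sup>2)) * indicator (cball (0::real^'n) (2 * d)) h)"
        by (intro integrable_mult_right integrable_real_indicator) (auto simp: emeasure_lborel_cball_finite[unfolded infinity_ennreal_def])
      show "integrable lborel (\<lambda>h. norm (indicator {..2 * d} (norm h) *\<^sub>R (K d h * f h)))"
        by (rule integrable_real_bound[OF I]) (use le in auto)
    qed
    also have "\<dots> = (?B * (C * (2 * d)\<^sup>2)) * (unit_ball_vol (real CARD('n)) * (2 * d) ^ CARD('n))"
      using d by (simp add: content_cball)
    also have "\<dots> = c * (d\<^sup>2 * (d ^ CARD('n) * ?B))"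
      by (simp add: c_def power_mult_distrib)
    also have "d ^ CARD('n) * (LINT \<xi>|lborel. norm (A d \<xi>)) = (LINT \<eta>|lborel. norm (psi (\<eta> /\<^sub>R d) *\<^sub>R ghat \<eta>))"
      using lborel_integral_affine[of "\<lambda>\<eta>. norm (psi (\<eta> /\<^sub>R d) *\<^sub>R ghat \<eta>)" d 0] d by (simp add: A_def)
    also have "d\<^sup>2 * \<dots> = (LINT \<eta>|lborel. norm ((d\<^sup>2 * psi (\<eta> /\<^sub>R d)) *\<^sub>R ghat \<eta>))"
      by (simp add: abs_mult mult.assoc)
    finally show ?thesis by (simp only: d_def)
  qed
  have "(\<lambda>m. LINT \<eta>|lborel. norm (((ds m)\<^sup>2 * psi (\<eta> /\<^sub>R ds m)) *\<^sub>R ghat \<eta>)) \<longlonglongrightarrow> (LINT \<eta>|(lborel :: (real^'n) measure). 0)"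
  proof (rule integral_dominated_convergence[where w="\<lambda>\<eta>. norm ((psi_const * (1 + norm \<eta>)\<^sup>2) *\<^sub>R ghat \<eta>)"])
    have "integrable lborel (\<lambda>\<eta>. (psi_const * (1 + norm \<eta>)\<^sup>2) *\<^sub>R ghat \<eta>)"
      unfolding ghat_def
      by (rule schwartz_ft_integrable_weight[OF schwartz_bump, of _ psi_const 2]) (auto simp: abs_mult psi_const_nonneg)
    then show "integrable lborel (\<lambda>\<eta>. norm ((psi_const * (1 + norm \<eta>)\<^sup>2) *\<^sub>R ghat \<eta>))" by (rule integrable_norm)
    show "AE \<eta> in lborel. (\<lambda>m. norm (((ds m)\<^sup>2 * psi (\<eta> /\<^sub>R ds m)) *\<^sub>R ghat \<eta>)) \<longlonglongrightarrow> 0"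
    proof (rule AE_I2)
      fix \<eta> :: "real^'n"
      have "(\<lambda>m. norm (((ds m)\<^sup>2 * psi (\<eta> /\<^sub>R ds m)) *\<^sub>R ghat \<eta>)) \<longlonglongrightarrow> norm (0 *\<^sub>R ghat \<eta>)"
        by (intro tendsto_intros psi_scaled_tendsto_0(1) ds)
      then show "(\<lambda>m. norm (((ds m)\<^sup>2 * psi (\<eta> /\<^sub>R ds m)) *\<^sub>R ghat \<eta>)) \<longlonglongrightarrow> 0" by simp
    qed
    show "AE \<eta> in lborel. norm (norm (((ds m)\<^sup>2 * psi (\<eta> /\<^sub>R ds m)) *\<^sub>R ghat \<eta>)) \<le> norm ((psi_const * (1 + norm \<eta>)\<^sup>2) *\<^sub>R ghat \<eta>)" for m
    proof (rule AE_I2)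
      fix \<eta> :: "real^'n"
      have "0 \<le> (ds m)\<^sup>2 * psi (\<eta> /\<^sub>R ds m)" by (simp add: psi_nonneg)
      then show "norm (norm (((ds m)\<^sup>2 * psi (\<eta> /\<^sub>R ds m)) *\<^sub>R ghat \<eta>)) \<le> norm ((psi_const * (1 + norm \<eta>)\<^sup>2) *\<^sub>R ghat \<eta>)"
        using psi_scaled_tendsto_0(2)[OF ds(1) ds(2) ds(3), of m \<eta>] unfolding norm_scaleR real_norm_def abs_mult abs_abs abs_norm_cancel
        by (intro mult_right_mono) (auto simp: psi_nonneg psi_const_nonneg abs_mult)
    qed
  qed measurable
  from tendsto_mult_left[OF this, of c]
  have "(\<lambda>m. c * (LINT \<eta>|lborel. norm (((ds m)\<^sup>2 * psi (\<eta> /\<^sub>R ds m)) *\<^sub>R ghat \<eta>))) \<longlonglongrightarrow> 0" by simp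
  then show ?thesis by (rule Lim_null_comparison[OF always_eventually, rotated]) (use bd in auto)
qed

text \<open>Fubini moves the mollification from \<open>K d\<close> to the function it is paired with: \<open>P d f\<close> is the
  mollification of \<open>f\<close> cut off at \<open>2 * d\<close>.\<close>

definition P :: "real \<Rightarrow> (real^'n \<Rightarrow> complex) \<Rightarrow> real^'n \<Rightarrow> complex" where
  "P d f y = (LINT h|lborel. (indicator {2 * d<..} (norm h) *\<^sub>R f h) * of_real (moll d (y - h)))"

lemma integral_moll: "0 < d \<Longrightarrow> (LINT h|lborel. moll d (y - h)) = 1"
  and integrable_moll_minus: "0 < d \<Longrightarrow> integrable lborel (\<lambda>h. moll d (y - h))" for y :: "real^'n"
proof -
  assume d: "0 < d"
  have "complex_of_real (LINT h|lborel. moll d (y - h)) = (LINT h|lborel. 1 * complex_of_real (moll d (y - h)))" by simp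
  also have "\<dots> = (LINT z|lborel. complex_of_real (bump (z :: real^'n)) * 1)" by (rule moll_convolution[OF d]) simp
  finally show "(LINT h|lborel. moll d (y - h)) = 1" by (simp add: integral_bump)
  show "integrable lborel (\<lambda>h. moll d (y - h))"
    using integrable_moll[OF d] by (subst lborel_integrable_minus) auto
qed

text \<open>Since \<open>kb\<close> and the mollifier are nonnegative, the inner integral of the
  absolute value is |f| times \<open>Kr d\<close>, which is \<open>K d\<close> beyond radius 2d. The
  integrability of \<open>K d\<close> thus justifies Fubini, while nothing is yet known about
  \<open>kb\<close> globally.\<close>

lemma K_far_swap:
  assumes d: "0 < d" and [measurable]: "f \<in> borel_measurable borel" and f: "\<And>h. norm (f h) \<le> C"
  shows "(LINT h|lborel. indicator {2 * d<..} (norm h) *\<^sub>R (K d h * f h)) = (LINT y|lborel. of_real (kb y) * P d f y)"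
    and "integrable lborel (\<lambda>y. of_real (kb y) * P d f y)"
proof -
  let ?i = "\<lambda>h::real^'n. indicator {2 * d<..} (norm h) :: real"
  define G where "G h y = (?i h * (kb y * moll d (h - y))) *\<^sub>R f h" for h y
  have [measurable]: "K d \<in> borel_measurable borel" by (rule K_measurable[OF d])
  have C: "0 \<le> C" using order_trans[OF norm_ge_zero f] by auto
  have I: "integrable lborel (\<lambda>y. ?i h * (kb y * moll d (h - y)))" for h
    using Kr_integrable[OF d, of h] d by (cases "2 * d < norm h") auto
  have inner: "(LINT y|lborel. G h y) = ?i h *\<^sub>R (K d h * f h)" for h
  proof -
    have "(LINT y|lborel. G h y) = (LINT y|lborel. ?i h * (kb y * moll d (h - y))) *\<^sub>R f h"
      unfolding G_def by (rule integral_scaleR_left) (rule I)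
    also have "\<dots> = (?i h * Kr d h) *\<^sub>R f h" by (simp add: Kr_def)
    also have "\<dots> = ?i h *\<^sub>R (K d h * f h)"
      using K_eq_Kr[OF d, of h] d by (cases "2 * d < norm h") (auto simp: scaleR_conv_of_real)
    finally show ?thesis .
  qed
  have FI: "integrable (lborel \<Otimes>\<^sub>M lborel) (\<lambda>(h, y). G h y)"
  proof (rule lborel_pair.Fubini_integrable)
    show "(\<lambda>(h, y). G h y) \<in> borel_measurable (lborel \<Otimes>\<^sub>M lborel)" unfolding G_def by measurable
    show "AE h in lborel. integrable lborel (\<lambda>y. case (h, y) of (h, y) \<Rightarrow> G h y)"
      unfolding prod.case G_def by (intro AE_I2 integrable_scaleR_left) (rule I)
    show "integrable lborel (\<lambda>h. LINT y|lborel. norm (case (h, y) of (h, y) \<Rightarrow> G h y))"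
    proof (rule integrable_real_bound[OF integrable_mult_right[OF integrable_norm[OF K_integrable(1)[OF d]], of C]])
      fix h :: "real^'n"
      have "norm (G h y) = (?i h * (kb y * moll d (h - y))) * norm (f h)" for y
        using kb_nonneg[of y] moll_nonneg[OF d, of "h - y"] by (simp add: G_def abs_mult)
      then have "(LINT y|lborel. norm (G h y)) = (?i h * Kr d h) * norm (f h)" by (simp add: Kr_def)
      also have "\<dots> \<le> norm (K d h) * C"
      proof (cases "2 * d < norm h")
        case True
        then have "norm (K d h) = Kr d h" using K_eq_Kr[OF d, of h] Kr_nonneg[OF d, of h] d by simp
        then show ?thesis using True f[of h] Kr_nonneg[OF d, of h] by (simp add: mult_left_mono)
      qed (use C in simp)
      finally have "(LINT y|lborel. norm (G h y)) \<le> C * norm (K d h)" by (simp add: mult.commute)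
      then show "norm (LINT y|lborel. norm (case (h, y) of (h, y) \<Rightarrow> G h y)) \<le> C * norm (K d h)" by simp
    qed (unfold G_def, measurable)
  qed
  have outer: "(LINT h|lborel. G h y) = of_real (kb y) * P d f y" for y
  proof -
    have "(LINT h|lborel. G h y) = (LINT h|lborel. of_real (kb y) * ((?i h *\<^sub>R f h) * of_real (moll d (y - h))))"
    proof (rule Bochner_Integration.integral_cong[OF refl])
      fix h
      have "moll d (h - y) = moll d (y - h)" using moll_minus[of d "y - h"] by simp
      then show "G h y = of_real (kb y) * ((?i h *\<^sub>R f h) * of_real (moll d (y - h)))"
        by (simp add: G_def scaleR_conv_of_real mult_ac)
    qed
    also have "\<dots> = of_real (kb y) * P d f y" unfolding P_def by (rule integral_mult_right_zero)
    finally show ?thesis .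
  qed
  have "(LINT h|lborel. LINT y|lborel. G h y) = (LINT y|lborel. LINT h|lborel. G h y)"
    by (rule lborel_pair.Fubini_integral[symmetric, OF FI])
  then show "(LINT h|lborel. ?i h *\<^sub>R (K d h * f h)) = (LINT y|lborel. of_real (kb y) * P d f y)"
    unfolding inner outer .
  have "integrable lborel (\<lambda>y. LINT h|lborel. G h y)"
    using lborel_pair.integrable_snd[OF FI] by simp
  then show "integrable lborel (\<lambda>y. of_real (kb y) * P d f y)" unfolding outer .
qed

text \<open>This is why the cutoff radius is twice the mollification radius: |h| > 2d and |y - h| <
  d force |h| <= 2|y|, so the quadratic bound survives mollification with the factor 4. A cutoff at
  d would not keep y away from the origin.\<close>

lemma P_bound:
  assumes d: "0 < d" and [measurable]: "f \<in> borel_measurable borel" and f: "\<And>h. norm (f h) \<le> C * min 1 ((norm h)\<^sup>2)"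
  shows "norm (P d f y) \<le> 4 * C * min 1 ((norm y)\<^sup>2)"
proof -
  have C: "0 \<le> C" using order_trans[OF norm_ge_zero f[of "axis undefined 1"]] by simp
  let ?G = "\<lambda>h. (indicator {2 * d<..} (norm h) *\<^sub>R f h) * of_real (moll d (y - h))"
  have le: "norm (?G h) \<le> 4 * C * min 1 ((norm y)\<^sup>2) * moll d (y - h)" for h
  proof (cases "2 * d < norm h \<and> norm (y - h) < d")
    case True
    then have "norm h \<le> 2 * norm y"
      using norm_triangle_ineq2[of h y] norm_minus_commute[of y h] by linarith
    then have "(norm h)\<^sup>2 \<le> (2 * norm y)\<^sup>2" by (rule power_mono) simp
    then have "min 1 ((norm h)\<^sup>2) \<le> 4 * min 1 ((norm y)\<^sup>2)" by (simp add: power_mult_distrib min_def)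
    then have "C * min 1 ((norm h)\<^sup>2) \<le> C * (4 * min 1 ((norm y)\<^sup>2))" using C by (rule mult_left_mono)
    then have "norm (f h) \<le> 4 * C * min 1 ((norm y)\<^sup>2)" using f[of h] by simp
    then have "norm (f h) * moll d (y - h) \<le> 4 * C * min 1 ((norm y)\<^sup>2) * moll d (y - h)"
      by (rule mult_right_mono) (rule moll_nonneg[OF d])
    then show ?thesis using True moll_nonneg[OF d, of "y - h"] by (simp add: norm_mult)
  next
    case False
    then have "?G h = 0" using moll_zero[OF d, of "y - h"] by (auto simp: not_less)
    moreover have "0 \<le> 4 * C * min 1 ((norm y)\<^sup>2) * moll d (y - h)"
      using C by (intro mult_nonneg_nonneg moll_nonneg[OF d]) auto
    ultimately show ?thesis by (simp only: norm_zero)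
  qed
  have I: "integrable lborel (\<lambda>h. 4 * C * min 1 ((norm y)\<^sup>2) * moll d (y - h))"
    by (intro integrable_mult_right integrable_moll_minus d)
  have "norm (P d f y) \<le> (LINT h|lborel. norm (?G h))" unfolding P_def by (rule integral_norm_bound)
  also have "\<dots> \<le> (LINT h|lborel. 4 * C * min 1 ((norm y)\<^sup>2) * moll d (y - h))"
  proof (rule integral_mono[OF _ I le])
    show "integrable lborel (\<lambda>h. norm (?G h))" by (rule integrable_real_bound[OF I]) (use le in auto)
  qed
  also have "\<dots> = 4 * C * min 1 ((norm y)\<^sup>2)" using integral_moll[OF d, of y] by simp
  finally show ?thesis .
qed

lemma P_tendsto:
  assumes [measurable]: "f \<in> borel_measurable borel" and f: "\<And>h. norm (f h) \<le> C" and y: "y \<noteq> 0" and cont: "isCont f y"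
  shows "(\<lambda>m. P (ds m) f y) \<longlonglongrightarrow> f y"
proof -
  have "(\<lambda>m. LINT h|lborel. f h * of_real (moll (ds m) (y - h))) \<longlonglongrightarrow> f y"
    by (rule mollifier_tendsto[OF _ f cont ds(1,2)]) simp
  moreover have "\<forall>\<^sub>F m in sequentially. (LINT h|lborel. f h * of_real (moll (ds m) (y - h))) = P (ds m) f y"
  proof -
    \<comment> \<open>For d < |y|/3 every h with |y - h| < d satisfies |h| > |y| - d > 2d, so the
      cutoff is not felt.\<close>
    have "\<forall>\<^sub>F m in sequentially. ds m < norm y / 3" using y by (intro order_tendstoD(2)[OF ds(1)]) simp
    then show ?thesis
    proof eventually_elim
      case (elim m)
      show ?case unfolding P_def
      proof (rule Bochner_Integration.integral_cong[OF refl])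
        fix h
        show "f h * of_real (moll (ds m) (y - h)) = (indicator {2 * ds m<..} (norm h) *\<^sub>R f h) * of_real (moll (ds m) (y - h))"
        proof (cases "norm (y - h) < ds m")
          case True
          then have "2 * ds m < norm h" using elim norm_triangle_ineq2[of y h] by linarith
          then show ?thesis by simp
        next
          case False
          then show ?thesis using moll_zero[OF ds(2), of m "y - h"] by simp
        qed
      qed
    qed
  qed
  ultimately show ?thesis by (rule Lim_transform_eventually)
qed

lemma K_pairing_split:
  assumes d: "0 < d" and [measurable]: "f \<in> borel_measurable borel" and f: "\<And>h. norm (f h) \<le> C"
  shows "(LINT h|lborel. K d h * f h) = (LINT h|lborel. indicator {..2 * d} (norm h) *\<^sub>R (K d h * f h)) + (LINT y|lborel. of_real (kb y) * P d f y)"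
proof -
  have [measurable]: "K d \<in> borel_measurable borel" by (rule K_measurable[OF d])
  have I: "integrable lborel (\<lambda>h. K d h * f h)"
    by (rule integrable_real_bound[OF integrable_mult_right[OF integrable_norm[OF K_integrable(1)[OF d]], of C]])
      (use f in \<open>auto simp: norm_mult mult.commute[of C] intro!: mult_left_mono\<close>)
  have I1: "integrable lborel (\<lambda>h. indicator {..2 * d} (norm h) *\<^sub>R (K d h * f h))"
    and I2: "integrable lborel (\<lambda>h. indicator {2 * d<..} (norm h) *\<^sub>R (K d h * f h))"
    by (rule integrable_real_bound[OF integrable_norm[OF I]]; auto split: split_indicator)+
  have "(LINT h|lborel. K d h * f h) = (LINT h|lborel. indicator {..2 * d} (norm h) *\<^sub>R (K d h * f h) + indicator {2 * d<..} (norm h) *\<^sub>R (K d h * f h))"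
    by (intro Bochner_Integration.integral_cong refl) (auto split: split_indicator)
  also have "\<dots> = (LINT h|lborel. indicator {..2 * d} (norm h) *\<^sub>R (K d h * f h)) + (LINT h|lborel. indicator {2 * d<..} (norm h) *\<^sub>R (K d h * f h))"
    by (rule Bochner_Integration.integral_add[OF I1 I2])
  finally show ?thesis unfolding K_far_swap(1)[OF d \<open>f \<in> borel_measurable borel\<close> f] .
qed

section \<open>Integrability of the Levy measure and passage to the limit\<close>

lemma bounded_of_min_bound: "(\<And>h. norm (f h) \<le> C * min 1 ((norm h)\<^sup>2)) \<Longrightarrow> norm (f h) \<le> C"
  for f :: "real^'n \<Rightarrow> complex"
proof -
  assume f: "\<And>h. norm (f h) \<le> C * min 1 ((norm h)\<^sup>2)"
  have "0 \<le> C" using order_trans[OF norm_ge_zero f[of "axis undefined 1"]] by simp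
  then show ?thesis using f[of h] mult_left_le[of "min 1 ((norm h)\<^sup>2)" C] by simp
qed

text \<open>With s = pi |h|^2, 1 - exp(-s) lies between s/(1+s) and s, so it is comparable to the
  Levy weight min(1,|h|^2). The 2 is enough on the unit ball because 1 + s <= 1 + pi <= 2 pi, and
  outside it because s >= 1.\<close>

lemma one_minus_gauss_bounds:
  "1 - gauss h \<le> pi * min 1 ((norm h)\<^sup>2)" "min 1 ((norm h)\<^sup>2) \<le> 2 * (1 - gauss h)" for h :: "real^'n"
proof -
  define s where "s = pi * (norm h)\<^sup>2"
  have s: "0 \<le> s" by (simp add: s_def)
  have g: "gauss h = exp (- s)" by (simp add: gauss_def s_def)
  have "1 - gauss h \<le> s" using exp_ge_add_one_self[of "- s"] by (simp add: g)
  moreover have "1 - gauss h \<le> pi" using pi_ge_two gauss_pos(2)[of h] by linarith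
  ultimately show "1 - gauss h \<le> pi * min 1 ((norm h)\<^sup>2)" by (auto simp: min_def s_def)
  have "exp (- s) \<le> 1 / (1 + s)"
    using exp_ge_add_one_self[of s] s by (simp add: exp_minus field_simps)
  then have *: "s / (1 + s) \<le> 1 - gauss h" using s unfolding g by (simp add: field_simps)
  show "min 1 ((norm h)\<^sup>2) \<le> 2 * (1 - gauss h)"
  proof (cases "(norm h)\<^sup>2 \<le> 1")
    case True
    have "(norm h)\<^sup>2 * (1 + s) \<le> (norm h)\<^sup>2 * (1 + pi)" using True by (intro mult_left_mono) (auto simp: s_def mult_left_le)
    also have "\<dots> \<le> (norm h)\<^sup>2 * (2 * pi)" using pi_ge_two by (intro mult_left_mono) auto
    finally have "(norm h)\<^sup>2 \<le> (norm h)\<^sup>2 * (2 * pi) / (1 + s)" using s by (subst pos_le_divide_eq) auto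
    also have "\<dots> = 2 * (s / (1 + s))" by (simp add: s_def)
    finally have "(norm h)\<^sup>2 \<le> 2 * (s / (1 + s))" .
    then show ?thesis using * True by simp
  next
    case False
    then have "pi * 1 \<le> s" unfolding s_def by (intro mult_left_mono) auto
    then have "1 \<le> s" using pi_ge_two by simp
    then have "1 \<le> 2 * (s / (1 + s))" by (simp add: field_simps)
    then show ?thesis using * False by simp
  qed
qed

lemma psi_gauss_integrable: "integrable lborel (\<lambda>\<xi>. psi \<xi> * gauss \<xi>)"
proof (rule integrable_real_bound[OF integrable_mult_right[OF integrable_inverse_power]])
  let ?N = "DIM(real^'n) + 1"
  fix \<xi> :: "real^'n"
  have "psi \<xi> * gauss \<xi> \<le> (psi_const * (1 + norm \<xi>)\<^sup>2) * (fact (2 + ?N) * exp 2 / (1 + norm \<xi>) ^ (2 + ?N))"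
    using psi_const_nonneg by (intro mult_mono psi_bound gauss_bound) auto
  also have "\<dots> = psi_const * fact (2 + ?N) * exp 2 * (1 / (1 + norm \<xi>) ^ ?N)"
  proof -
    have "(1 + norm \<xi>)\<^sup>2 \<noteq> 0" by (simp add: add_nonneg_eq_0_iff)
    then show ?thesis unfolding power_add[of _ 2] by (simp add: divide_simps)
  qed
  finally show "norm (psi \<xi> * gauss \<xi>) \<le> psi_const * fact (2 + ?N) * exp 2 * (1 / (1 + norm \<xi>) ^ ?N)"
    using psi_nonneg[of \<xi>] by simp
qed measurable

lemma kb_weight_integrable: "integrable lborel (\<lambda>y. kb y * min 1 ((norm y)\<^sup>2))"
proof -
  define f where "f h = complex_of_real (1 - gauss (h::real^'n))" for h
  have [measurable]: "f \<in> borel_measurable borel" unfolding f_def by measurable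
  have f: "norm (f h) \<le> pi * min 1 ((norm h)\<^sup>2)" for h
    unfolding f_def norm_of_real using one_minus_gauss_bounds(1)[of h] by simp
  have f': "norm (f h) \<le> pi" for h by (rule bounded_of_min_bound[OF f])
  have gI: "integrable lborel (\<lambda>y::real^'n. complex_of_real (gauss y))" by (rule integrable_of_real[OF integrable_gauss])
  have "integrable lborel (\<lambda>\<xi>. psi \<xi> *\<^sub>R ft (\<lambda>y. complex_of_real (gauss y)) \<xi>)"
    using integrable_of_real[OF psi_gauss_integrable, where 'a=complex] by (simp add: ft_gauss scaleR_conv_of_real)
  note lim = K_difference_tendsto[OF gI _ this, of 1 0]
  define L where "L = ft (\<lambda>\<xi>. psi \<xi> *\<^sub>R ft (\<lambda>y. complex_of_real (gauss y)) \<xi>) (0 :: real^'n)"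
  have L: "(\<lambda>m. LINT h|lborel. K (ds m) h * f h) \<longlonglongrightarrow> L" using lim by (simp add: f_def gauss_def L_def)
  have "(\<lambda>m. LINT y|lborel. of_real (kb y) * P (ds m) f y) \<longlonglongrightarrow> L - 0"
  proof -
    have "(LINT y|lborel. of_real (kb y) * P (ds m) f y)
        = (LINT h|lborel. K (ds m) h * f h) - (LINT h|lborel. indicator {..2 * ds m} (norm h) *\<^sub>R (K (ds m) h * f h))" for m
      using K_pairing_split[OF ds(2) \<open>f \<in> borel_measurable borel\<close> f', of m] by simp
    then show ?thesis using tendsto_diff[OF L K_near_tendsto_0[OF \<open>f \<in> borel_measurable borel\<close> f]] by simp
  qed
  then have "Bseq (\<lambda>m. LINT y|lborel. of_real (kb y) * P (ds m) f y)"
    by (intro convergent_imp_Bseq) (auto simp: convergent_def)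
  then obtain B where B: "\<And>m. norm (LINT y|lborel. of_real (kb y) * P (ds m) f y) \<le> B" by (auto simp: Bseq_def)
  \<comment> \<open>A real copy of \<open>P d f\<close>, because Fatou's lemma is applied to
    nonnegative real functions.\<close>
  define Pr where "Pr d y = (LINT h|lborel. indicator {2 * d<..} (norm h) * (1 - gauss h) * moll d (y - h))" for d and y :: "real^'n"
  have Pr: "P d f y = of_real (Pr d y)" for d y
    unfolding P_def Pr_def integral_complex_of_real[symmetric] by (simp add: f_def scaleR_conv_of_real)
  have Pr0: "0 \<le> Pr d y" if "0 < d" for d y
    unfolding Pr_def using that by (intro Bochner_Integration.integral_nonneg mult_nonneg_nonneg) auto
  have "integrable lborel (\<lambda>y. kb y * (1 - gauss y))"
  proof (rule integrable_fatou[where f="\<lambda>m y. kb y * Pr (ds m) y"])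
    show "integrable lborel (\<lambda>y. kb y * Pr (ds m) y)" for m
      using integrable_Re[OF K_far_swap(2)[OF ds(2)[of m] \<open>f \<in> borel_measurable borel\<close> f']] by (simp add: Pr)
    show "(LINT y|lborel. kb y * Pr (ds m) y) \<le> B" for m
    proof -
      have "(LINT y|lborel. of_real (kb y) * P (ds m) f y) = (LINT y|lborel. complex_of_real (kb y * Pr (ds m) y))" by (simp add: Pr)
      also have "\<dots> = of_real (LINT y|lborel. kb y * Pr (ds m) y)" by (rule integral_complex_of_real)
      finally show ?thesis using B[of m] by simp
    qed
    show "0 \<le> kb y * Pr (ds m) y" for m y using kb_nonneg Pr0[OF ds(2)] by simp
    show "0 \<le> kb y * (1 - gauss y)" for y using kb_nonneg by simp
    show "AE y in lborel. (\<lambda>m. kb y * Pr (ds m) y) \<longlonglongrightarrow> kb y * (1 - gauss y)"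
      using AE_lborel_singleton[of "0 :: real^'n"]
    proof eventually_elim
      case (elim y)
      have "isCont f y" unfolding f_def gauss_def by (intro continuous_intros)
      from P_tendsto[OF \<open>f \<in> borel_measurable borel\<close> f' elim this]
      have "(\<lambda>m. Re (P (ds m) f y)) \<longlonglongrightarrow> Re (f y)" by (rule tendsto_Re)
      then have "(\<lambda>m. Pr (ds m) y) \<longlonglongrightarrow> 1 - gauss y" by (simp add: Pr f_def)
      then show ?case by (rule tendsto_mult_left)
    qed
  qed measurable
  then show ?thesis
  proof (rule integrable_real_bound[OF integrable_mult_right[of 2]])
    show "norm (kb y * min 1 ((norm y)\<^sup>2)) \<le> 2 * (kb y * (1 - gauss y))" for y
      using mult_left_mono[OF one_minus_gauss_bounds(2)[of y] kb_nonneg[of y]] kb_nonneg[of y] by (simp add: abs_mult algebra_simps)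
  qed measurable
qed

lemma K_pairing_tendsto:
  assumes [measurable]: "f \<in> borel_measurable borel" and f: "\<And>h. norm (f h) \<le> C * min 1 ((norm h)\<^sup>2)"
    and cont: "AE y in lborel. isCont f y"
  shows "(\<lambda>m. LINT h|lborel. K (ds m) h * f h) \<longlonglongrightarrow> (LINT y|lborel. of_real (kb y) * f y)"
    and "integrable lborel (\<lambda>y. of_real (kb y) * f y)"
proof -
  have f': "norm (f h) \<le> C" for h by (rule bounded_of_min_bound[OF f])
  have W: "integrable lborel (\<lambda>y. c * (kb y * min 1 ((norm y)\<^sup>2)))" for c
    using kb_weight_integrable by (rule integrable_mult_right)
  show "integrable lborel (\<lambda>y. of_real (kb y) * f y)"
  proof (rule integrable_real_bound[OF W[of C]])
    show "norm (of_real (kb y) * f y) \<le> C * (kb y * min 1 ((norm y)\<^sup>2))" for y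
      using mult_left_mono[OF f[of y] kb_nonneg[of y]] kb_nonneg[of y] by (simp add: norm_mult mult_ac)
  qed measurable
  have "(\<lambda>m. LINT y|lborel. of_real (kb y) * P (ds m) f y) \<longlonglongrightarrow> (LINT y|lborel. of_real (kb y) * f y)"
  proof (rule integral_dominated_convergence[OF _ _ W[of "4 * C"]])
    show "AE y in lborel. (\<lambda>m. of_real (kb y) * P (ds m) f y) \<longlonglongrightarrow> of_real (kb y) * f y"
      using AE_lborel_singleton[of "0 :: real^'n"] cont
    proof eventually_elim
      case (elim y)
      show ?case by (intro tendsto_mult_left P_tendsto[OF _ f' elim]) simp
    qed
    show "AE y in lborel. norm (of_real (kb y) * P (ds m) f y) \<le> 4 * C * (kb y * min 1 ((norm y)\<^sup>2))" for m
    proof (rule AE_I2)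
      fix y
      show "norm (of_real (kb y) * P (ds m) f y) \<le> 4 * C * (kb y * min 1 ((norm y)\<^sup>2))"
        using mult_left_mono[OF P_bound[OF ds(2)[of m] \<open>f \<in> borel_measurable borel\<close> f, of y] kb_nonneg[of y]] kb_nonneg[of y]
        by (simp add: norm_mult mult_ac)
    qed
    show "(\<lambda>y. of_real (kb y) * P (ds m) f y) \<in> borel_measurable lborel" for m
      using K_far_swap(2)[OF ds(2)[of m] \<open>f \<in> borel_measurable borel\<close> f'] by auto
  qed measurable
  from tendsto_add[OF K_near_tendsto_0[OF \<open>f \<in> borel_measurable borel\<close> f] this]
  show "(\<lambda>m. LINT h|lborel. K (ds m) h * f h) \<longlonglongrightarrow> (LINT y|lborel. of_real (kb y) * f y)"
    by (simp add: K_pairing_split[OF ds(2) \<open>f \<in> borel_measurable borel\<close> f'])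
qed

end



context levy_kernel
begin

section \<open>The principal value formula\<close>

text \<open>By inversion the second difference is a superposition of characters with the factor 1 -
  cos(2 pi h.\<xi>) = 2 sin(pi h.\<xi>)^2. Squaring the bound for the sine gives the minimum of 1
  and |h|^2 in one stroke, with no Taylor expansion.\<close>

lemma second_difference_bound:
  fixes u :: "real^'n \<Rightarrow> complex"
  assumes s: "schwartz u"
  shows "\<exists>C. \<forall>h. norm (u x - (u (x + h) + u (x - h)) / 2) \<le> C * min 1 ((norm h)\<^sup>2)"
proof -
  define a where "a = ft u"
  have aI: "integrable lborel a" unfolding a_def by (rule ft_schwartz_integrable[OF s])
  have [measurable]: "a \<in> borel_measurable borel" using aI by auto
  have u: "u y = ft a (- y)" for y unfolding a_def by (rule nonlocal_laplacian_eq(3)[OF s])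
  \<comment> \<open>Twice the square of the bound 2 pi (1 + |\<xi>|) for the sine, hence the
    8.\<close>
  define W where "W \<xi> = (8 * pi\<^sup>2 * (1 + norm \<xi>) ^ 2) *\<^sub>R a \<xi>" for \<xi>
  have WI: "integrable lborel (\<lambda>\<xi>. norm (W \<xi>))"
    unfolding W_def a_def
    by (intro integrable_norm schwartz_ft_integrable_weight[OF s, of _ "8 * pi\<^sup>2" 2]) (auto simp: abs_mult)
  have "norm (u x - (u (x + h) + u (x - h)) / 2) \<le> (LINT \<xi>|lborel. norm (W \<xi>)) * min 1 ((norm h)\<^sup>2)" for h
  proof -
    let ?e = "\<lambda>y \<xi>. a \<xi> * cis (- (2 * pi * (\<xi> \<bullet> - y)))"
    have eI: "integrable lborel (?e y)" for y by (rule integrable_ft[OF aI])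
    have eq: "u x - (u (x + h) + u (x - h)) / 2 = (LINT \<xi>|lborel. ?e x \<xi> - (?e (x + h) \<xi> + ?e (x - h) \<xi>) / 2)"
    proof -
      have "(LINT \<xi>|lborel. ?e x \<xi> - (?e (x + h) \<xi> + ?e (x - h) \<xi>) / 2)
          = (LINT \<xi>|lborel. ?e x \<xi>) - (LINT \<xi>|lborel. (?e (x + h) \<xi> + ?e (x - h) \<xi>) / 2)"
        by (rule Bochner_Integration.integral_diff[OF eI integrable_divide[OF Bochner_Integration.integrable_add[OF eI eI]]])
      also have "\<dots> = (LINT \<xi>|lborel. ?e x \<xi>) - ((LINT \<xi>|lborel. ?e (x + h) \<xi>) + (LINT \<xi>|lborel. ?e (x - h) \<xi>)) / 2"
        unfolding integral_divide_zero Bochner_Integration.integral_add[OF eI eI] ..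
      finally show ?thesis unfolding u[of x] u[of "x + h"] u[of "x - h"] ft_def ..
    qed
    have "norm (u x - (u (x + h) + u (x - h)) / 2) \<le> (LINT \<xi>|lborel. norm (?e x \<xi> - (?e (x + h) \<xi> + ?e (x - h) \<xi>) / 2))"
      unfolding eq by (rule integral_norm_bound)
    also have "\<dots> \<le> (LINT \<xi>|lborel. norm (W \<xi>) * min 1 ((norm h)\<^sup>2))"
    proof (rule integral_mono)
      show "integrable lborel (\<lambda>\<xi>. norm (?e x \<xi> - (?e (x + h) \<xi> + ?e (x - h) \<xi>) / 2))"
        by (intro integrable_norm Bochner_Integration.integrable_diff Bochner_Integration.integrable_add integrable_divide eI)
      show "integrable lborel (\<lambda>\<xi>. norm (W \<xi>) * min 1 ((norm h)\<^sup>2))" using WI by (rule integrable_mult_left)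
      fix \<xi> :: "real^'n"
      define \<alpha> where "\<alpha> = 2 * pi * (\<xi> \<bullet> x)"
      define \<beta> where "\<beta> = 2 * pi * ((h /\<^sub>R 2) \<bullet> \<xi>)"
      have b: "2 * \<beta> = 2 * pi * (\<xi> \<bullet> h)" by (simp add: \<beta>_def inner_commute)
      have c: "- (2 * pi * (\<xi> \<bullet> - (x + h))) = \<alpha> + 2 * \<beta>" "- (2 * pi * (\<xi> \<bullet> - (x - h))) = \<alpha> + - (2 * \<beta>)" "- (2 * pi * (\<xi> \<bullet> - x)) = \<alpha>"
        unfolding b \<alpha>_def inner_minus_right inner_add_right inner_diff_right by algebra+
      have "?e (x + h) \<xi> = a \<xi> * (cis \<alpha> * cis (2 * \<beta>))" "?e (x - h) \<xi> = a \<xi> * (cis \<alpha> * cis (- (2 * \<beta>)))" "?e x \<xi> = a \<xi> * cis \<alpha>"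
        unfolding cis_mult c by (rule refl)+
      then have "?e x \<xi> - (?e (x + h) \<xi> + ?e (x - h) \<xi>) / 2 = a \<xi> * cis \<alpha> * (1 - (cis (2 * \<beta>) + cis (- (2 * \<beta>))) / 2)"
        by (simp only:) (simp add: field_simps)
      moreover have "1 - (cis (2 * \<beta>) + cis (- (2 * \<beta>))) / 2 = of_real (2 * (sin \<beta>)\<^sup>2)"
        unfolding complex_eq_iff using cos_double_sin[of \<beta>] by (simp add: field_simps)
      ultimately have eq: "?e x \<xi> - (?e (x + h) \<xi> + ?e (x - h) \<xi>) / 2 = a \<xi> * cis \<alpha> * of_real (2 * (sin \<beta>)\<^sup>2)"
        by (simp only:)
      have "norm (?e x \<xi> - (?e (x + h) \<xi> + ?e (x - h) \<xi>) / 2) = norm (a \<xi>) * (2 * (sin \<beta>)\<^sup>2)"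
        unfolding eq norm_mult norm_cis norm_of_real by simp
      also have "\<dots> \<le> norm (a \<xi>) * (2 * ((2 * pi)\<^sup>2 * (1 + norm \<xi>)\<^sup>2 * min 1 ((norm h)\<^sup>2)))"
      proof (intro mult_left_mono)
        have "\<bar>sin \<beta>\<bar> \<le> (1 + 2 * pi * norm \<xi>) * min 1 (norm (h /\<^sub>R 2))" unfolding \<beta>_def by (rule abs_sin_le_min)
        also have "\<dots> \<le> (2 * pi * (1 + norm \<xi>)) * min 1 (norm h)"
          by (intro mult_mono one_plus_two_pi_le) (auto simp: min_def)
        finally have "\<bar>sin \<beta>\<bar>\<^sup>2 \<le> (2 * pi * (1 + norm \<xi>) * min 1 (norm h))\<^sup>2" by (rule power_mono) simp
        moreover have "(min 1 (norm h))\<^sup>2 = min 1 ((norm h)\<^sup>2)"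
        proof (cases "norm h \<le> 1")
          case True
          then have "(norm h)\<^sup>2 \<le> 1" by (intro power_le_one) auto
          then show ?thesis using True by (simp only: min.absorb2)
        next
          case False
          then have "1 \<le> (norm h)\<^sup>2" by (intro one_le_power) auto
          then show ?thesis using False by simp
        qed
        ultimately show "(sin \<beta>)\<^sup>2 \<le> (2 * pi)\<^sup>2 * (1 + norm \<xi>)\<^sup>2 * min 1 ((norm h)\<^sup>2)"
          by (simp only: power_mult_distrib power2_abs)
      qed auto
      also have "\<dots> = norm (W \<xi>) * min 1 ((norm h)\<^sup>2)"
      proof -
        have "norm (W \<xi>) = 8 * pi\<^sup>2 * (1 + norm \<xi>)\<^sup>2 * norm (a \<xi>)" by (simp add: W_def)
        then show ?thesis by (simp add: power_mult_distrib)
      qed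
      finally show "norm (?e x \<xi> - (?e (x + h) \<xi> + ?e (x - h) \<xi>) / 2) \<le> norm (W \<xi>) * min 1 ((norm h)\<^sup>2)" .
    qed
    also have "\<dots> = (LINT \<xi>|lborel. norm (W \<xi>)) * min 1 ((norm h)\<^sup>2)" by (rule integral_mult_left_zero)
    finally show ?thesis .
  qed
  then show ?thesis by (intro exI allI)
qed

lemma principal_value:
  fixes u :: "real^'n \<Rightarrow> complex"
  assumes s: "schwartz u"
  shows "0 < q \<Longrightarrow> integrable lborel (\<lambda>h. indicator {h. q < norm h} h *\<^sub>R ((u x - u (x + h)) * of_real (kb h)))"
    and "((\<lambda>q. LINT h|lborel. indicator {h. q < norm h} h *\<^sub>R ((u x - u (x + h)) * of_real (kb h)))
      \<longlongrightarrow> - nonlocal_laplacian \<rho> u x) (at_right 0)"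
proof -
  have [measurable]: "u \<in> borel_measurable borel" by (rule schwartz_measurable[OF s])
  have ucont: "isCont u y" for y using s smooth_fun_continuous by (auto simp: schwartz_def continuous_on_eq_continuous_at)
  obtain M where M: "\<And>y. norm (u y) \<le> M" using schwartz_decay[OF s, of "[]" 0] by auto
  have M0: "0 \<le> M" using order_trans[OF norm_ge_zero M] by auto
  \<comment> \<open>v is the even part of \<open>u x - u (x + h)\<close> in h, and
    \<open>w q\<close> is minus its odd part, cut off at radius q. Only v is quadratic at the
    origin, so only w needs the cutoff.\<close>
  define v where "v h = u x - (u (x + h) + u (x - h)) / 2" for h
  define w where "w q h = indicator {h. q < norm h} h *\<^sub>R ((u (x + h) - u (x - h)) / 2)" for q h
  obtain C where C: "\<And>h. norm (v h) \<le> C * min 1 ((norm h)\<^sup>2)" unfolding v_def using second_difference_bound[OF s] by blast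
  have set[measurable]: "{h::real^'n. q < norm h} \<in> sets borel" for q by measurable
  have [measurable]: "v \<in> borel_measurable borel" "w q \<in> borel_measurable borel" for q
    unfolding v_def w_def by measurable
  have vc: "isCont v h" for h
    unfolding v_def by (intro continuous_intros isCont_o2[OF _ ucont] ucont) simp
  note v = K_pairing_tendsto[OF \<open>v \<in> borel_measurable borel\<close> C AE_I2[OF vc]]
  have uI: "integrable lborel u" by (rule schwartz_integrable[OF s])
  have KI: "integrable lborel (\<lambda>h. K d h * f h)" if d: "0 < d" and [measurable]: "f \<in> borel_measurable borel" and f: "\<And>h. norm (f h) \<le> B"
    for d f B
  proof (rule integrable_real_bound[OF integrable_mult_right[OF integrable_norm[OF K_integrable(1)[OF d]], of B]])
    have [measurable]: "K d \<in> borel_measurable borel" by (rule K_measurable[OF d])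
    show "norm (K d h * f h) \<le> B * norm (K d h)" for h
      using mult_left_mono[OF f[of h] norm_ge_zero[of "K d h"]] by (simp add: norm_mult mult.commute)
    show "(\<lambda>h. K d h * f h) \<in> borel_measurable lborel" by measurable
  qed
  have Kv: "(LINT h|lborel. K d h * v h) = (LINT h|lborel. K d h * (u x - u (x + h)))" if d: "0 < d" for d
  proof -
    have [measurable]: "K d \<in> borel_measurable borel" by (rule K_measurable[OF d])
    let ?g = "\<lambda>h. K d h * (u x - u (x + h))"
    have b: "norm (u x - u (x + h)) \<le> 2 * M" for h
      using norm_triangle_ineq4[of "u x" "u (x + h)"] M[of x] M[of "x + h"] by linarith
    have gI: "integrable lborel ?g" by (rule KI[OF d _ b]) measurable
    have gI': "integrable lborel (\<lambda>h. ?g (- h))" using gI by (subst lborel_integrable_minus) auto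
    have "(LINT h|lborel. K d h * v h) = (LINT h|lborel. (?g h + ?g (- h)) / 2)"
      by (intro Bochner_Integration.integral_cong refl) (simp add: v_def K_minus field_simps)
    also have "\<dots> = ((LINT h|lborel. ?g h) + (LINT h|lborel. ?g (- h))) / 2"
      using gI gI' by simp
    also have "(LINT h|lborel. ?g (- h)) = (LINT h|lborel. ?g h)" by (rule lborel_integral_minus(2)) measurable
    finally show ?thesis by simp
  qed
  have "(\<lambda>m. LINT h|lborel. K (ds m) h * v h) \<longlonglongrightarrow> ft (\<lambda>\<xi>. psi \<xi> *\<^sub>R ft u \<xi>) (- x)"
    unfolding Kv[OF ds(2)] by (rule K_difference_tendsto[OF uI M nonlocal_laplacian_eq(2)[OF s]])
  with v(1) have kv: "(LINT y|lborel. of_real (kb y) * v y) = - nonlocal_laplacian \<rho> u x"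
    using LIMSEQ_unique nonlocal_laplacian_eq(1)[OF s, of x] by fastforce
  have wb: "norm (w q h) \<le> M / min 1 (q\<^sup>2) * min 1 ((norm h)\<^sup>2)" if q: "0 < q" for q h
  proof (cases "q < norm h")
    case True
    have "norm (w q h) \<le> M"
      using True norm_triangle_ineq4[of "u (x + h)" "u (x - h)"] M[of "x + h"] M[of "x - h"] by (simp add: w_def norm_divide)
    also have "M = M / min 1 (q\<^sup>2) * min 1 (q\<^sup>2)" using q by (simp add: min_def)
    also have "\<dots> \<le> M / min 1 (q\<^sup>2) * min 1 ((norm h)\<^sup>2)"
    proof (intro mult_left_mono)
      have "q\<^sup>2 \<le> (norm h)\<^sup>2" using True q by (intro power_mono) auto
      then show "min 1 (q\<^sup>2) \<le> min 1 ((norm h)\<^sup>2)" by auto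
    qed (use M0 q in auto)
    finally show ?thesis .
  qed (use M0 in \<open>simp add: w_def\<close>)
  \<comment> \<open>The cutoff jumps only on the sphere of radius q, a null set.\<close>
  have wc: "AE h in lborel. isCont (w q) h" for q
    using AE_norm_neq[of q, where 'a="real^'n"]
  proof eventually_elim
    case (elim h)
    have c0: "isCont (\<lambda>h. (u (x + h) - u (x - h)) / 2) h"
      by (intro continuous_intros isCont_o2[OF _ ucont])
        auto
    show ?case
    proof (cases "q < norm h")
      case True
      have "open {h::real^'n. q < norm h}" by (intro open_Collect_less continuous_intros)
      then have "\<forall>\<^sub>F h' in nhds h. w q h' = (u (x + h') - u (x - h')) / 2"
        using True by (auto simp: w_def eventually_nhds intro!: exI[of _ "{h. q < norm h}"])
      then have "isCont (w q) h = isCont (\<lambda>h. (u (x + h) - u (x - h)) / 2) h" by (rule isCont_cong)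
      then show ?thesis using c0 by (simp only:)
    next
      case False
      have "open {h::real^'n. norm h < q}" by (intro open_Collect_less continuous_intros)
      then have "\<forall>\<^sub>F h' in nhds h. w q h' = 0"
        using False elim by (auto simp: w_def eventually_nhds intro!: exI[of _ "{h. norm h < q}"])
      then show ?thesis using isCont_cong[of "w q" "\<lambda>_. 0" h] by simp
    qed
  qed
  note w = K_pairing_tendsto[OF \<open>\<And>q. w q \<in> borel_measurable borel\<close> wb wc]
  have w_minus: "w q (- h) = - w q h" for q h
    by (simp add: w_def minus_divide_left split: split_indicator)
  have Kw: "(LINT h|lborel. K d h * w q h) = 0" if d: "0 < d" for d q
  proof -
    have [measurable]: "K d \<in> borel_measurable borel" by (rule K_measurable[OF d])
    have "(LINT h|lborel. K d h * w q h) = (LINT h|lborel. K d (- h) * w q (- h))"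
      by (rule lborel_integral_minus(2)[symmetric]) measurable
    also have "\<dots> = - (LINT h|lborel. K d h * w q h)" by (simp add: K_minus w_minus)
    finally show ?thesis by simp
  qed
  \<comment> \<open>The vanishing is inherited from the even functions \<open>K d\<close> in the
    limit; evenness of \<open>kb\<close> itself is never established.\<close>
  have kw: "(LINT y|lborel. of_real (kb y) * w q y) = 0" if "0 < q" for q
    using w(1)[OF that] unfolding Kw[OF ds(2)] by (simp add: LIMSEQ_const_iff)
  have split: "indicator {h. q < norm h} h *\<^sub>R ((u x - u (x + h)) * of_real (kb h))
      = indicator {h. q < norm h} h *\<^sub>R (of_real (kb h) * v h) - of_real (kb h) * w q h" for q h
    by (simp add: v_def w_def split: split_indicator) (simp add: field_simps)
  have ivI: "integrable lborel (\<lambda>h. indicator {h. q < norm h} h *\<^sub>R (of_real (kb h) * v h))" for q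
    by (rule integrable_real_bound[OF integrable_norm[OF v(2)]]) (auto split: split_indicator)
  show "integrable lborel (\<lambda>h. indicator {h. q < norm h} h *\<^sub>R ((u x - u (x + h)) * of_real (kb h)))" if "0 < q"
    unfolding split using ivI w(2)[OF that] by (rule Bochner_Integration.integrable_diff)
  have e: "(LINT h|lborel. indicator {h. q < norm h} h *\<^sub>R ((u x - u (x + h)) * of_real (kb h)))
      = (LINT h|lborel. indicator {h. q < norm h} h *\<^sub>R (of_real (kb h) * v h))" if "0 < q" for q
    unfolding split using ivI w(2)[OF that] kw[OF that] by simp
  show "((\<lambda>q. LINT h|lborel. indicator {h. q < norm h} h *\<^sub>R ((u x - u (x + h)) * of_real (kb h)))
      \<longlongrightarrow> - nonlocal_laplacian \<rho> u x) (at_right 0)"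
    unfolding tendsto_at_iff_sequentially
  proof (intro allI impI)
    fix X :: "nat \<Rightarrow> real" assume X: "\<forall>i. X i \<in> {0<..} - {0}" "X \<longlonglongrightarrow> 0"
    have "(\<lambda>m. LINT h|lborel. indicator {h. X m < norm h} h *\<^sub>R (of_real (kb h) * v h)) \<longlonglongrightarrow> (LINT h|lborel. of_real (kb h) * v h)"
    proof (rule integral_dominated_convergence[OF _ _ integrable_norm[OF v(2)]])
      show "AE h in lborel. (\<lambda>m. indicator {h. X m < norm h} h *\<^sub>R (of_real (kb h) * v h)) \<longlonglongrightarrow> of_real (kb h) * v h"
        using AE_lborel_singleton[of "0 :: real^'n"]
      proof eventually_elim
        case (elim h)
        have "\<forall>\<^sub>F m in sequentially. X m < norm h" using elim by (intro order_tendstoD(2)[OF X(2)]) simp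
        then have "\<forall>\<^sub>F m in sequentially. of_real (kb h) * v h = indicator {h. X m < norm h} h *\<^sub>R (of_real (kb h) * v h)"
          by eventually_elim simp
        then show ?case by (rule Lim_transform_eventually[OF tendsto_const])
      qed
      show "AE h in lborel. norm (indicator {h. X m < norm h} h *\<^sub>R (of_real (kb h) * v h)) \<le> norm (of_real (kb h) * v h)" for m
        by (auto split: split_indicator)
    qed measurable
    then show "((\<lambda>q. LINT h|lborel. indicator {h. q < norm h} h *\<^sub>R ((u x - u (x + h)) * of_real (kb h))) \<circ> X) \<longlonglongrightarrow> - nonlocal_laplacian \<rho> u x"
      using X(1) by (simp add: o_def e kv)
  qed
qed

end

section \<open>Reduction to Borel representatives\<close>

theorem proposition4p12:
  fixes \<rho> k :: "real ^ 'n \<Rightarrow> real"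
  assumes nonneg: "\<And>x. x \<noteq> 0 \<Longrightarrow> 0 \<le> \<rho> x"
    and radial: "radial \<rho>"
    and loc_int: "\<And>S. compact S \<Longrightarrow> set_integrable lebesgue S \<rho>"
    and int: "integrable lebesgue (\<lambda>x. min 1 (1 / norm x) * \<rho> x)"
    and inf_pos: "\<exists>\<epsilon>>0. (INF x\<in>cball 0 \<epsilon> - {0}. \<rho> x) > 0"
    and K_fun: "given_off_zero_by (K_dist \<rho>) (\<lambda>h. complex_of_real (k h))"
    and K_nonneg: "\<And>h. h \<noteq> 0 \<Longrightarrow> 0 \<le> k h"
  shows "\<forall>u x. schwartz u \<longrightarrow>
      (\<forall>r>0. set_integrable lebesgue {h. r < norm h} (\<lambda>h. (u x - u (x + h)) * of_real (k h))) \<and>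
      ((\<lambda>r. LINT h:{h. r < norm h}|lebesgue. (u x - u (x + h)) * of_real (k h))
         \<longlongrightarrow> - nonlocal_laplacian \<rho> u x) (at_right 0)"
proof -
  have ne: "AE x in lborel. x \<noteq> (0 :: real^'n)" by (rule AE_lborel_singleton)
  \<comment> \<open>Measurability is read off from the weighted integrability by dividing by the
    weight. By the convention 1/0 = 0 the weight vanishes at the origin, and only there.\<close>
  have meas: "\<rho> \<in> borel_measurable lebesgue"
  proof (rule borel_measurable_AE)
    have "(\<lambda>x::real^'n. 1 / min 1 (1 / norm x)) \<in> borel_measurable lebesgue"
      by (rule measurable_completion) measurable
    then show "(\<lambda>x. 1 / min 1 (1 / norm x) * (min 1 (1 / norm x) * \<rho> x)) \<in> borel_measurable lebesgue"
      using borel_measurable_integrable[OF int] by (rule borel_measurable_times)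
    show "AE x in lebesgue. 1 / min 1 (1 / norm x) * (min 1 (1 / norm x) * \<rho> x) = \<rho> x"
      using AE_completion[OF ne]
    proof eventually_elim
      case (elim x)
      then have "min 1 (1 / norm x) \<noteq> 0" by (simp add: min_def)
      then show ?case by simp
    qed
  qed
  obtain b where [measurable]: "b \<in> borel_measurable borel" and b0: "\<forall>t. 0 \<le> b t"
    and rep: "AE t in lborel. 0 < t \<longrightarrow> radial_rep \<rho> t = b t" and b\<rho>: "AE x in lborel. \<rho> x = b (norm x)"
    by (rule radial_borel_rep[OF radial _ meas], erule nonneg, rule that, assumption+)
  have ae: "AE x in lborel. min 1 (1 / norm x) * \<rho> x = min 1 (1 / norm x) * b (norm x)"
    using b\<rho> by eventually_elim simp
  have "(\<lambda>x::real^'n. min 1 (1 / norm x) * b (norm x)) \<in> borel_measurable borel" by measurable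
  from integral_lebesgue_cong_AE(2)[OF this ae] int
  have bint: "integrable lborel (\<lambda>x::real^'n. min 1 (1 / norm x) * b (norm x))" by (rule iffD1)
  interpret represented_kernel b "\<lambda>x. b (norm x)" \<rho>
  proof unfold_locales
    show "b (norm x) = b (norm x)" for x :: "real^'n" by (rule refl)
    show "b \<in> borel_measurable borel" by measurable
    show "0 \<le> b t" for t using b0 by (rule spec)
  qed (rule bint rep b\<rho>)+
  \<comment> \<open>Closed annuli exhausting the punctured space. Since k is integrable on each of
    them, it is measurable there, and the value 0 at the origin is a normalisation.\<close>
  define S where "S m = cball (0::real^'n) (real (Suc m)) - ball 0 (1 / real (Suc m))" for m
  have S: "compact (S m)" "0 \<notin> S m" for m unfolding S_def by (auto intro!: compact_diff)
  have kS: "set_integrable lebesgue T (\<lambda>h. complex_of_real (k h))" if "compact T" "0 \<notin> T" for T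
    using K_fun that by (auto simp: given_off_zero_by_def)
  have kmeas: "(\<lambda>h. if h = 0 then 0 else k h) \<in> borel_measurable lebesgue"
  proof (rule borel_measurable_LIMSEQ_metric)
    show "(\<lambda>h. Re (indicator (S m) h *\<^sub>R complex_of_real (k h))) \<in> borel_measurable lebesgue" for m
      using borel_measurable_integrable[OF kS[OF S, of m, unfolded set_integrable_def]] by measurable
    fix h :: "real^'n"
    show "(\<lambda>m. Re (indicator (S m) h *\<^sub>R complex_of_real (k h))) \<longlonglongrightarrow> (if h = 0 then 0 else k h)"
    proof (cases "h = 0")
      case True
      then show ?thesis using S(2) by simp
    next
      case False
      have "(\<lambda>m. 1 / real (Suc m)) \<longlonglongrightarrow> 0" by (rule LIMSEQ_Suc[OF lim_1_over_n])
      then have "\<forall>\<^sub>F m in sequentially. 1 / real (Suc m) < norm h" by (rule order_tendstoD(2)) (use False in simp)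
      moreover have "\<forall>\<^sub>F m in sequentially. norm h \<le> real (Suc m)"
        using eventually_ge_at_top[of "nat \<lceil>norm h\<rceil>"] by eventually_elim linarith
      ultimately have "\<forall>\<^sub>F m in sequentially. k h = Re (indicator (S m) h *\<^sub>R complex_of_real (k h))"
        by eventually_elim (auto simp: S_def)
      then have "(\<lambda>m. Re (indicator (S m) h *\<^sub>R complex_of_real (k h))) \<longlonglongrightarrow> k h"
        by (rule Lim_transform_eventually[OF tendsto_const])
      then show ?thesis using False by simp
    qed
  qed
  obtain k' where [measurable]: "k' \<in> borel_measurable borel" and k': "AE h in lborel. (if h = 0 then 0 else k h) = k' h"
    using completion_ex_borel_measurable_real[OF kmeas] by auto
  \<comment> \<open>The hypothesis gives nonnegativity of k off the origin, hence of its Borel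
    version almost everywhere; the maximum makes it hold everywhere and changes a null set
    only.\<close>
  define kb where "kb h = max 0 (k' h)" for h
  have [measurable]: "kb \<in> borel_measurable borel" unfolding kb_def by measurable
  have kb: "AE h in lborel. k h = kb h"
    using k' ne
  proof eventually_elim
    case (elim h)
    then show ?case using K_nonneg[of h] by (simp add: kb_def)
  qed
  interpret levy_kernel b "\<lambda>x. b (norm x)" \<rho> kb
  proof unfold_locales
    show "0 \<le> kb y" for y by (simp add: kb_def)
    show "integrable lborel (\<lambda>y. indicator T y *\<^sub>R kb y)" if T: "compact T" "0 \<notin> T" for T
    proof -
      have [measurable]: "T \<in> sets borel" using T(1) by (simp add: borel_compact)
      have ae: "AE y in lborel. indicator T y *\<^sub>R complex_of_real (k y) = complex_of_real (indicator T y *\<^sub>R kb y)"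
        using kb by eventually_elim (simp add: scaleR_conv_of_real)
      have "(\<lambda>y. complex_of_real (indicator T y *\<^sub>R kb y)) \<in> borel_measurable borel" by measurable
      from integral_lebesgue_cong_AE(2)[OF this ae] kS[OF T, unfolded set_integrable_def]
      have "integrable lborel (\<lambda>y. complex_of_real (indicator T y *\<^sub>R kb y))" by (rule iffD1)
      from integrable_Re[OF this] show ?thesis unfolding Re_complex_of_real .
    qed
    show "K_dist \<rho> \<phi> = (LINT y|lborel. of_real (kb y) * \<phi> y)" if \<phi>: "test_fun_off_zero \<phi>" for \<phi>
    proof -
      have [measurable]: "\<phi> \<in> borel_measurable borel" by (rule schwartz_measurable[OF test_fun_schwartz[OF \<phi>]])
      have "K_dist \<rho> \<phi> = regular_dist (\<lambda>h. complex_of_real (k h)) \<phi>" using K_fun \<phi> by (simp add: given_off_zero_by_def)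
      also have "\<dots> = (LINT y|lborel. of_real (kb y) * \<phi> y)"
        unfolding regular_dist_def
      proof (rule integral_lebesgue_cong_AE(1))
        show "AE y in lborel. of_real (k y) * \<phi> y = of_real (kb y) * \<phi> y" using kb by eventually_elim simp
      qed measurable
      finally show ?thesis .
    qed
  qed measurable
  show ?thesis
  proof (intro allI impI conjI)
    fix u :: "real^'n \<Rightarrow> complex" and x assume s: "schwartz u"
    have [measurable]: "u \<in> borel_measurable borel" by (rule schwartz_measurable[OF s])
    have [measurable]: "{h::real^'n. q < norm h} \<in> sets borel" for q by measurable
    have m: "(\<lambda>h. indicator {h. q < norm h} h *\<^sub>R ((u x - u (x + h)) * of_real (kb h))) \<in> borel_measurable borel" for q
      by measurable
    have ae: "AE h in lborel. indicator {h. q < norm h} h *\<^sub>R ((u x - u (x + h)) * of_real (k h))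
        = indicator {h. q < norm h} h *\<^sub>R ((u x - u (x + h)) * of_real (kb h))" for q
      using kb by eventually_elim simp
    show "set_integrable lebesgue {h. q < norm h} (\<lambda>h. (u x - u (x + h)) * of_real (k h))" if "0 < q" for q
      unfolding set_integrable_def integral_lebesgue_cong_AE(2)[OF m ae] by (rule principal_value(1)[OF s that])
    show "((\<lambda>q. LINT h:{h. q < norm h}|lebesgue. (u x - u (x + h)) * of_real (k h))
         \<longlongrightarrow> - nonlocal_laplacian \<rho> u x) (at_right 0)"
      unfolding set_lebesgue_integral_def integral_lebesgue_cong_AE(1)[OF m ae] by (rule principal_value(2)[OF s])
  qed
qed


end
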